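(* Let $n\ge1$, $D_n=G(2,2,n)$ and $\mu(D_n)=\mu(G(2,2,n))$. Precomposition with the algebra isomorphism $J_{-\mathbf i}\colon\mathbb C\mu(D_n)\to\mathbb C D_n$ induces a bijection $\chi\mapsto \chi\circ J_{-\mathbf i}$ from the set of irreducible characters of $D_n$ to the set of irreducible characters of $\mu(D_n)$. In particular, for every bipartition $(\lambda,\mu)$ of $n$ with $\lambda\ne\mu$, this bijection sends $\chi^{D_n}_{(\lambda,\mu)}\mapsto\chi^{\mu(D_n)}_{(\lambda,\mu^* )}$, where $\mu^*$ is the partition dual (conjugate) to $\mu$.
   Context: $B_n=G(2,1,n)$ is the group of $n\times n$ monomial matrices with non-zero entries $\pm1$. $D_n=G(2,2,n)$ is its subgroup of matrices in which the product of the non-zero entries is $1$ (the Coxeter group of type $D_n$), and $\mu(D_n)=\mu(G(2,2,n))$ is its subgroup of matrices of determinant $1$. $s_i$ is the permutation matrix of $(i\ i+1)$ and $t_i$ is the diagonal matrix with $(i,i)$ entry $-1$ and other diagonal entries $1$. With $\mathbf i^2=-1$, $J_{-\mathbf i}\colon\mathbb CB_n\to\mathbb CB_n$ is the $\mathbb C$-algebra automorphism determined by $J_{-\mathbf i}(t_i)=t_i$ and $J_{-\mathbf i}(s_i)=\frac12 s_i\big((1-\mathbf i)t_i+(1+\mathbf i)t_{i+1}\big)$. It is known that it restricts to an algebra isomorphism $\mathbb C\mu(D_n)\to\mathbb CD_n$, also denoted $J_{-\mathbf i}$. Irreducible complex characters of $B_n$ are labelled by bipartitions $(\lambda,\mu)$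 of $n$ ($\lambda\vdash a$, $\mu\vdash b$, $a+b=n$): $\chi_{(\lambda,\mu)}=\mathrm{Ind}_{B_a\times B_b}^{B_n}(\tilde\chi_\lambda\boxtimes(\epsilon'_b\otimes\tilde\chi_\mu))$, where $\tilde\chi_\lambda$ is the pullback to $B_a$ of the irreducible character $\chi_\lambda$ of $S_a$ (with $\chi_{(a)}$ trivial) along the projection $B_a\to S_a$, similarly $\tilde\chi_\mu$, and $\epsilon'_b$ is the linear character of $B_b$ with $t_i\mapsto-1$, $s_i\mapsto1$. For $\lambda\ne\mu$ the restriction of $\chi_{(\lambda,\mu)}$ to $D_n$ is irreducible and is denoted $\chi^{D_n}_{(\lambda,\mu)}$. For $\lambda\ne\mu^*$ the restriction of $\chi_{(\lambda,\mu)}$ to $\mu(D_n)$ is irreducible and is denoted $\chi^{\mu(D_n)}_{(\lambda,\mu)}$. *)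

theory Defs
  imports
    "HOL-Library.Function_Algebras"
    "HOL-Algebra.Sym_Groups"
    "HOL-Algebra.Module"
    "HOL-Algebra.QuotRing"
    "Jordan_Normal_Form.VS_Connect"
begin

section \<open>Group algebras\<close>

text \<open>For a finite group \<open>G\<close>, an element \<open>\<Sum>g. f g \<cdot> g\<close> of \<open>\<complex>G\<close> is its coefficient function \<open>f\<close>,
  which vanishes outside the carrier. Hence the group algebra of a subgroup (with the same
  multiplication) is literally a subset of the group algebra of the group.\<close>

definition group_algebra :: "('g, 'm) monoid_scheme \<Rightarrow> (complex, 'g \<Rightarrow> complex) module" where
  "group_algebra G = \<lparr>
     carrier = {f. \<forall>x. x \<notin> carrier G \<longrightarrow> f x = 0},
     mult = (\<lambda>f h x. \<Sum>(y, z) \<in> {(y, z). y \<in> carrier G \<and> z \<in> carrier G \<and> y \<otimes>\<^bsub>G\<^esub> z = x}. f y * h z),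
     one = (\<lambda>x. if x = \<one>\<^bsub>G\<^esub> then 1 else 0),
     zero = (\<lambda>x. 0),
     add = (\<lambda>f h x. f x + h x),
     smult = (\<lambda>c f x. c * f x)\<rparr>"

definition delta :: "'g \<Rightarrow> 'g \<Rightarrow> complex" where
  "delta g = (\<lambda>x. if x = g then 1 else 0)"

definition algebra_iso ::
  "(complex, 'a, 'm) module_scheme \<Rightarrow> (complex, 'b, 'n) module_scheme \<Rightarrow> ('a \<Rightarrow> 'b) set" where
  "algebra_iso A B = {h \<in> ring_iso A B.
     \<forall>c. \<forall>x \<in> carrier A. h (c \<odot>\<^bsub>A\<^esub> x) = c \<odot>\<^bsub>B\<^esub> h x}"

section \<open>Irreducible characters\<close>

definition matrix_rep :: "('g, 'm) monoid_scheme \<Rightarrow> nat \<Rightarrow> ('g \<Rightarrow> complex mat) \<Rightarrow> bool" where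
  "matrix_rep G d \<rho> \<longleftrightarrow>
     (\<forall>g \<in> carrier G. \<rho> g \<in> carrier_mat d d) \<and> \<rho> \<one>\<^bsub>G\<^esub> = 1\<^sub>m d \<and>
     (\<forall>g \<in> carrier G. \<forall>h \<in> carrier G. \<rho> (g \<otimes>\<^bsub>G\<^esub> h) = \<rho> g * \<rho> h)"

definition irreducible_rep :: "('g, 'm) monoid_scheme \<Rightarrow> nat \<Rightarrow> ('g \<Rightarrow> complex mat) \<Rightarrow> bool" where
  "irreducible_rep G d \<rho> \<longleftrightarrow> matrix_rep G d \<rho> \<and> d > 0 \<and>
     (\<forall>W. VectorSpace.subspace class_ring W (module_vec TYPE(complex) d) \<and>
          (\<forall>g \<in> carrier G. \<forall>v \<in> W. \<rho> g *\<^sub>v v \<in> W)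
        \<longrightarrow> W = {0\<^sub>v d} \<or> W = carrier_vec d)"

definition rep_character :: "('g, 'm) monoid_scheme \<Rightarrow> nat \<Rightarrow> ('g \<Rightarrow> complex mat) \<Rightarrow> 'g \<Rightarrow> complex" where
  "rep_character G d \<rho> = (\<lambda>g \<in> carrier G. \<Sum>i<d. \<rho> g $$ (i, i))"

text \<open>All characters are extensional functions on the carrier of the group, so that equality of
  characters is equality of functions.\<close>

definition irr_chars :: "('g, 'm) monoid_scheme \<Rightarrow> ('g \<Rightarrow> complex) set" where
  "irr_chars G = {rep_character G d \<rho> | d \<rho>. irreducible_rep G d \<rho>}"

definition linear_ext :: "('g, 'm) monoid_scheme \<Rightarrow> ('g \<Rightarrow> complex) \<Rightarrow> ('g \<Rightarrow> complex) \<Rightarrow> complex" where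
  "linear_ext G \<chi> f = (\<Sum>g \<in> carrier G. f g * \<chi> g)"

text \<open>For \<open>J : \<complex>H \<rightarrow> \<complex>G\<close>, the function \<open>\<chi> \<circ> J\<close> on \<open>H\<close>, where \<open>\<chi>\<close> is extended linearly to \<open>\<complex>G\<close>.\<close>

definition precompose ::
  "('g, 'm) monoid_scheme \<Rightarrow> ('h, 'n) monoid_scheme \<Rightarrow> (('h \<Rightarrow> complex) \<Rightarrow> ('g \<Rightarrow> complex))
     \<Rightarrow> ('g \<Rightarrow> complex) \<Rightarrow> 'h \<Rightarrow> complex" where
  "precompose G H J \<chi> = (\<lambda>h \<in> carrier H. linear_ext G \<chi> (J (delta h)))"

definition induced_char ::
  "('g, 'm) monoid_scheme \<Rightarrow> 'g set \<Rightarrow> ('g \<Rightarrow> complex) \<Rightarrow> 'g \<Rightarrow> complex" where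
  "induced_char G H \<psi> = (\<lambda>g \<in> carrier G.
     (\<Sum>x \<in> carrier G.
        (let y = inv\<^bsub>G\<^esub> x \<otimes>\<^bsub>G\<^esub> g \<otimes>\<^bsub>G\<^esub> x in if y \<in> H then \<psi> y else 0)) / of_nat (card H))"

section \<open>Irreducible characters of symmetric groups\<close>

text \<open>Partitions are weakly decreasing lists of positive numbers.\<close>

definition is_partition :: "nat list \<Rightarrow> bool" where
  "is_partition \<alpha> \<longleftrightarrow> sorted_wrt (\<ge>) \<alpha> \<and> 0 \<notin> set \<alpha>"

definition is_bipartition :: "nat \<Rightarrow> nat list \<Rightarrow> nat list \<Rightarrow> bool" where
  "is_bipartition n \<alpha> \<beta> \<longleftrightarrow> is_partition \<alpha> \<and> is_partition \<beta> \<and> sum_list \<alpha> + sum_list \<beta> = n"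

definition conjugate_partition :: "nat list \<Rightarrow> nat list" where
  "conjugate_partition \<alpha> =
     map (\<lambda>j. length (filter (\<lambda>p. j < p) \<alpha>)) [0..<(if \<alpha> = [] then 0 else hd \<alpha>)]"

text \<open>Row and column (from 0) of the entry \<open>k\<close> in the Young tableau of shape \<open>\<alpha>\<close> which is filled
  with \<open>1, 2, \<dots>\<close> row by row.\<close>

definition tableau_row :: "nat list \<Rightarrow> nat \<Rightarrow> nat" where
  "tableau_row \<alpha> k = (LEAST r. k \<le> sum_list (take (Suc r) \<alpha>))"

definition tableau_col :: "nat list \<Rightarrow> nat \<Rightarrow> nat" where
  "tableau_col \<alpha> k = k - 1 - sum_list (take (tableau_row \<alpha> k) \<alpha>)"

definition row_symmetrizer :: "nat list \<Rightarrow> (nat \<Rightarrow> nat) \<Rightarrow> complex" where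
  "row_symmetrizer \<alpha> p =
     (if p permutes {1..sum_list \<alpha>} \<and> (\<forall>k \<in> {1..sum_list \<alpha>}. tableau_row \<alpha> (p k) = tableau_row \<alpha> k)
      then 1 else 0)"

definition column_antisymmetrizer :: "nat list \<Rightarrow> (nat \<Rightarrow> nat) \<Rightarrow> complex" where
  "column_antisymmetrizer \<alpha> p =
     (if p permutes {1..sum_list \<alpha>} \<and> (\<forall>k \<in> {1..sum_list \<alpha>}. tableau_col \<alpha> (p k) = tableau_col \<alpha> k)
      then of_int (sign p) else 0)"

definition young_symmetrizer :: "nat list \<Rightarrow> (nat \<Rightarrow> nat) \<Rightarrow> complex" where
  "young_symmetrizer \<alpha> =
     row_symmetrizer \<alpha> \<otimes>\<^bsub>group_algebra (sym_group (sum_list \<alpha>))\<^esub> column_antisymmetrizer \<alpha>"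

definition specht_module :: "nat list \<Rightarrow> ((nat \<Rightarrow> nat) \<Rightarrow> complex) set" where
  "specht_module \<alpha> = (let A = group_algebra (sym_group (sum_list \<alpha>)) in
     (\<lambda>f. f \<otimes>\<^bsub>A\<^esub> young_symmetrizer \<alpha>) ` carrier A)"

global_interpretation cfun: vector_space "\<lambda>(c::complex) (f :: 'a \<Rightarrow> complex). (\<lambda>x. c * f x)"
  by standard (auto simp: algebra_simps fun_eq_iff)

text \<open>The trace of a linear endomorphism \<open>T\<close> of a finite-dimensional subspace \<open>V\<close>; it does not
  depend on the chosen basis.\<close>

definition trace_on :: "('a \<Rightarrow> complex) set \<Rightarrow> (('a \<Rightarrow> complex) \<Rightarrow> ('a \<Rightarrow> complex)) \<Rightarrow> complex" where
  "trace_on V T = (let B = (SOME B. cfun.independent B \<and> cfun.span B = V) in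
     \<Sum>b \<in> B. cfun.representation B (T b) b)"

definition sym_char :: "nat list \<Rightarrow> (nat \<Rightarrow> nat) \<Rightarrow> complex" where
  "sym_char \<alpha> = (let S = sym_group (sum_list \<alpha>) in
     (\<lambda>p \<in> carrier S. trace_on (specht_module \<alpha>) (\<lambda>f. delta p \<otimes>\<^bsub>group_algebra S\<^esub> f)))"

section \<open>The groups\<close>

definition signed_monomial :: "nat \<Rightarrow> complex mat \<Rightarrow> bool" where
  "signed_monomial n A \<longleftrightarrow> A \<in> carrier_mat n n \<and>
     (\<forall>i<n. \<exists>!j. j < n \<and> A $$ (i, j) \<noteq> 0) \<and>
     (\<forall>j<n. \<exists>!i. i < n \<and> A $$ (i, j) \<noteq> 0) \<and>
     (\<forall>i<n. \<forall>j<n. A $$ (i, j) \<noteq> 0 \<longrightarrow> A $$ (i, j) = 1 \<or> A $$ (i, j) = -1)"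

definition entry_prod :: "complex mat \<Rightarrow> complex" where
  "entry_prod A = (\<Prod>(i, j) \<in> {(i, j). i < dim_row A \<and> j < dim_col A \<and> A $$ (i, j) \<noteq> 0}. A $$ (i, j))"

definition B_group :: "nat \<Rightarrow> complex mat monoid" where
  "B_group n = \<lparr>carrier = {A. signed_monomial n A}, mult = (*), one = 1\<^sub>m n\<rparr>"

definition D_group :: "nat \<Rightarrow> complex mat monoid" where
  "D_group n = (B_group n)\<lparr>carrier := {A \<in> carrier (B_group n). entry_prod A = 1}\<rparr>"

text \<open>All elements of \<open>B_n\<close> of determinant 1; this is not contained in \<open>D_n\<close>.\<close>

definition muD_group :: "nat \<Rightarrow> complex mat monoid" where
  "muD_group n = (B_group n)\<lparr>carrier := {A \<in> carrier (B_group n). det A = 1}\<rparr>"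

section \<open>The automorphism of the group algebra\<close>

text \<open>As matrix indices start at 0, \<open>s_gen n i\<close> and \<open>t_gen n i\<close> are \<open>s\<^sub>i\<^sub>+\<^sub>1\<close> and \<open>t\<^sub>i\<^sub>+\<^sub>1\<close> in the
  usual numbering from 1.\<close>

definition s_gen :: "nat \<Rightarrow> nat \<Rightarrow> complex mat" where
  "s_gen n i = mat n n (\<lambda>(r, c). if r = Transposition.transpose i (Suc i) c then 1 else 0)"

definition t_gen :: "nat \<Rightarrow> nat \<Rightarrow> complex mat" where
  "t_gen n i = mat n n (\<lambda>(r, c). if r = c then (if r = i then -1 else 1) else 0)"

definition J_aut :: "nat \<Rightarrow> (complex mat \<Rightarrow> complex) \<Rightarrow> (complex mat \<Rightarrow> complex)" where
  "J_aut n = (let A = group_algebra (B_group n) in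
     THE J. J \<in> extensional (carrier A) \<and> J \<in> algebra_iso A A \<and>
       (\<forall>i<n. J (delta (t_gen n i)) = delta (t_gen n i)) \<and>
       (\<forall>i. Suc i < n \<longrightarrow>
          J (delta (s_gen n i)) =
            (1 / 2) \<odot>\<^bsub>A\<^esub> (delta (s_gen n i) \<otimes>\<^bsub>A\<^esub>
               ((1 - \<i>) \<odot>\<^bsub>A\<^esub> delta (t_gen n i) \<oplus>\<^bsub>A\<^esub> (1 + \<i>) \<odot>\<^bsub>A\<^esub> delta (t_gen n (Suc i))))))"

section \<open>Irreducible characters of the hyperoctahedral group\<close>

text \<open>The projection \<open>B_n \<rightarrow> S_n\<close>: the monomial matrix \<open>A\<close> sends the \<open>j\<close>-th coordinate line to the
  \<open>perm_of n A j\<close>-th one, with coordinates numbered from 1 as in \<^const>\<open>sym_group\<close>.\<close>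

definition perm_of :: "nat \<Rightarrow> complex mat \<Rightarrow> nat \<Rightarrow> nat" where
  "perm_of n A j =
     (if j \<in> {1..n} then THE i. i \<in> {1..n} \<and> A $$ (i - 1, j - 1) \<noteq> 0 else j)"

definition pullback_char :: "nat list \<Rightarrow> complex mat \<Rightarrow> complex" where
  "pullback_char \<alpha> A = sym_char \<alpha> (perm_of (sum_list \<alpha>) A)"

definition block_subgroup :: "nat \<Rightarrow> nat \<Rightarrow> complex mat set" where
  "block_subgroup a b = {four_block_mat X (0\<^sub>m a b) (0\<^sub>m b a) Y | X Y.
     X \<in> carrier (B_group a) \<and> Y \<in> carrier (B_group b)}"

text \<open>The linear character with \<open>t\<^sub>i \<mapsto> -1\<close> and \<open>s\<^sub>i \<mapsto> 1\<close> is \<^const>\<open>entry_prod\<close>.\<close>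

definition bipartition_char :: "nat list \<Rightarrow> nat list \<Rightarrow> complex mat \<Rightarrow> complex" where
  "bipartition_char \<alpha> \<beta> = (let a = sum_list \<alpha>; b = sum_list \<beta> in
     induced_char (B_group (a + b)) (block_subgroup a b)
       (\<lambda>M. case split_block M a a of (X, _, _, Y) \<Rightarrow>
          pullback_char \<alpha> X * (entry_prod Y * pullback_char \<beta> Y)))"

definition D_char :: "nat \<Rightarrow> nat list \<Rightarrow> nat list \<Rightarrow> complex mat \<Rightarrow> complex" where
  "D_char n \<alpha> \<beta> = restrict (bipartition_char \<alpha> \<beta>) (carrier (D_group n))"

definition muD_char :: "nat \<Rightarrow> nat list \<Rightarrow> nat list \<Rightarrow> complex mat \<Rightarrow> complex" where
  "muD_char n \<alpha> \<beta> = restrict (bipartition_char \<alpha> \<beta>) (carrier (muD_group n))"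

end

theory Submission
  imports Defs
begin

text \<open>
  Write elements of \<open>B\<^sub>n\<close> as \<open>w t\<^sub>K\<close>, where \<open>w\<close> is a permutation and \<open>t\<^sub>K\<close> the diagonal matrix with
  \<open>-1\<close> at the positions in \<open>K\<close>, and let \<open>e\<^sub>I\<close> be the primitive idempotents of the group algebra of
  the diagonal subgroup, indexed by subsets \<open>I\<close> via the characters \<open>\<chi>\<^sub>I(t\<^sub>K) = (-1)\<^bsup>|I \<inter> K|\<^esup>\<close>.
  The elements \<open>w e\<^sub>I\<close> are a basis of \<open>\<complex>B\<^sub>n\<close> in which \<open>J\<close> is diagonal. On the generators,
  \<open>J(s\<^sub>k e\<^sub>I) = c s\<^sub>k e\<^sub>I\<close> with \<open>c = 1, -1, -\<i>, \<i>\<close> according to which of \<open>k, k+1\<close> lie in \<open>I\<close>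
  (none; both; only the larger; only the smaller). The two mixed values are inverse to each
  other, so the product \<open>u\<^sub>w(I)\<close> of these factors over all inverted pairs of \<open>w\<close> satisfies
  \<open>u\<^sub>v\<^sub>w(I) = u\<^sub>v(w I) u\<^sub>w(I)\<close> (\<open>cocycle_compose\<close>). Hence \<open>w e\<^sub>I \<mapsto> u\<^sub>w(I) w e\<^sub>I\<close> is an algebra
  automorphism, and it is \<open>J\<close> because \<open>B\<^sub>n\<close> is generated by the \<open>s\<^sub>k\<close> and \<open>t\<^sub>k\<close> (\<open>J_aut_eq\<close>).

  Replacing \<open>I\<close> by its complement changes every factor by the sign \<open>-1\<close>, so it multiplies
  \<open>u\<^sub>w(I)\<close> by the sign of \<open>w\<close>. On the coefficients of \<open>w e\<^sub>I\<close>, complementation of \<open>I\<close> detects the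
  support: invariance characterises \<open>\<complex>D\<^sub>n\<close>, invariance up to the sign of \<open>w\<close> characterises
  \<open>\<complex>\<mu>(D\<^sub>n)\<close>. So \<open>J\<close> maps the second algebra onto the first (\<open>J_aut_muD_iso\<close>). Any isomorphism of
  group algebras transports irreducible representations, which gives the bijection of
  characters (\<open>algebra_iso_bij_irr_chars\<close>).

  For the labels, a summand of the induced character \<open>\<chi>\<^sub>(\<^sub>\<lambda>\<^sub>,\<^sub>\<mu>\<^sub>)\<close>, as a function of \<open>w t\<^sub>K\<close>, is
  \<open>\<chi>\<^sub>I(t\<^sub>K)\<close> times a function of \<open>w\<close> that vanishes unless \<open>w I = I\<close>, where \<open>|I| = |\<mu>|\<close>. Precomposing
  with \<open>J\<close> therefore multiplies it by \<open>u\<^sub>w(I)\<close>. When \<open>w I = I\<close>, the mixed pairs cancel and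
  \<open>u\<^sub>w(I)\<close> is the sign of the permutation that \<open>w\<close> induces on \<open>I\<close> (\<open>cocycle_conjugate\<close>,
  \<open>cocycle_block\<close>). The factor \<open>\<chi>\<^sub>\<mu>\<close> is thus multiplied by the sign character, and
  \<open>sign \<cdot> \<chi>\<^sub>\<mu> = \<chi>\<^sub>\<mu>\<^sub>*\<close> (\<open>sym_char_conjugate\<close>). The latter compares left ideals: with the row
  symmetrizer \<open>a\<close> and the column antisymmetrizer \<open>b\<close> of \<open>\<mu>\<close>, transposition of the diagram turns
  the Young symmetrizer of \<open>\<mu>*\<close> into the sign twist of \<open>b a = (a b)\<^sup>*\<close>, and for every \<open>x\<close> the left
  ideals generated by \<open>x\<close> and \<open>x\<^sup>*\<close> are isomorphic (\<open>trace_left_ideal_twist\<close>).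
\<close>

section \<open>Group algebras\<close>

abbreviation (input) scl :: "complex \<Rightarrow> ('a \<Rightarrow> complex) \<Rightarrow> 'a \<Rightarrow> complex" where
  "scl c f \<equiv> (\<lambda>x. c * f x)"

lemma group_algebra_simps:
  "carrier (group_algebra G) = {f. \<forall>x. x \<notin> carrier G \<longrightarrow> f x = 0}"
  "\<one>\<^bsub>group_algebra G\<^esub> = delta \<one>\<^bsub>G\<^esub>"
  "f \<oplus>\<^bsub>group_algebra G\<^esub> h = f + h"
  "c \<odot>\<^bsub>group_algebra G\<^esub> f = scl c f"
  by (auto simp: group_algebra_def delta_def fun_eq_iff)

lemma group_algebra_mult:
  assumes "finite (carrier G)"
  shows "f \<otimes>\<^bsub>group_algebra G\<^esub> h =
    (\<lambda>x. \<Sum>y\<in>carrier G. \<Sum>z\<in>carrier G. if y \<otimes>\<^bsub>G\<^esub> z = x then f y * h z else 0)"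
proof
  fix x
  let ?S = "{(y, z). y \<in> carrier G \<and> z \<in> carrier G \<and> y \<otimes>\<^bsub>G\<^esub> z = x}"
  have "(\<Sum>y\<in>carrier G. \<Sum>z\<in>carrier G. if y \<otimes>\<^bsub>G\<^esub> z = x then f y * h z else 0)
     = (\<Sum>(y,z)\<in>carrier G \<times> carrier G. if y \<otimes>\<^bsub>G\<^esub> z = x then f y * h z else 0)"
    by (simp add: sum.cartesian_product)
  also have "\<dots> = (\<Sum>(y,z)\<in>?S. f y * h z)"
    by (intro sum.mono_neutral_cong_right) (use assms in \<open>auto split: if_splits\<close>)
  finally show "(f \<otimes>\<^bsub>group_algebra G\<^esub> h) x =
      (\<Sum>y\<in>carrier G. \<Sum>z\<in>carrier G. if y \<otimes>\<^bsub>G\<^esub> z = x then f y * h z else 0)"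
    by (simp add: group_algebra_def)
qed

lemma group_algebra_mult_closed:
  assumes "group G" "finite (carrier G)"
  shows "f \<otimes>\<^bsub>group_algebra G\<^esub> h \<in> carrier (group_algebra G)"
proof -
  interpret group G by fact
  have "(\<Sum>y\<in>carrier G. \<Sum>z\<in>carrier G. if y \<otimes>\<^bsub>G\<^esub> z = x then f y * h z else 0) = 0"
    if "x \<notin> carrier G" for x
    using that by (intro sum.neutral ballI) auto
  then show ?thesis by (auto simp: group_algebra_simps group_algebra_mult[OF assms(2)])
qed

lemma group_algebra_mult_assoc:
  assumes "group G" "finite (carrier G)"
  shows "(f \<otimes>\<^bsub>group_algebra G\<^esub> g) \<otimes>\<^bsub>group_algebra G\<^esub> h
    = f \<otimes>\<^bsub>group_algebra G\<^esub> (g \<otimes>\<^bsub>group_algebra G\<^esub> h)"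
proof
  interpret group G by fact
  fix x
  let ?G = "carrier G"
  have "((f \<otimes>\<^bsub>group_algebra G\<^esub> g) \<otimes>\<^bsub>group_algebra G\<^esub> h) x =
     (\<Sum>y\<in>?G. \<Sum>z\<in>?G. \<Sum>a\<in>?G. \<Sum>b\<in>?G.
        if y = a \<otimes>\<^bsub>G\<^esub> b then (if a \<otimes>\<^bsub>G\<^esub> b \<otimes>\<^bsub>G\<^esub> z = x then f a * g b * h z else 0) else 0)"
    by (simp add: group_algebra_mult[OF assms(2)] sum_distrib_right if_distrib[of "\<lambda>u. u * _"]
         cong: if_cong) (intro sum.cong refl; auto intro!: sum.cong sum.neutral)
  also have "\<dots> = (\<Sum>a\<in>?G. \<Sum>b\<in>?G. \<Sum>z\<in>?G. \<Sum>y\<in>?G.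
        if y = a \<otimes>\<^bsub>G\<^esub> b then (if a \<otimes>\<^bsub>G\<^esub> b \<otimes>\<^bsub>G\<^esub> z = x then f a * g b * h z else 0) else 0)"
    by (simp only: sum.cartesian_product)
       (rule sum.reindex_bij_witness[of _ "\<lambda>(a,b,z,y). (y,z,a,b)" "\<lambda>(y,z,a,b). (a,b,z,y)"]; auto)
  also have "\<dots> = (\<Sum>a\<in>?G. \<Sum>b\<in>?G. \<Sum>z\<in>?G. if a \<otimes>\<^bsub>G\<^esub> b \<otimes>\<^bsub>G\<^esub> z = x then f a * g b * h z else 0)"
    by (intro sum.cong refl) (simp add: sum.delta[OF assms(2)])
  also have "\<dots> = (\<Sum>a\<in>?G. \<Sum>b\<in>?G. \<Sum>z\<in>?G. \<Sum>y\<in>?G.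
        if y = b \<otimes>\<^bsub>G\<^esub> z then (if a \<otimes>\<^bsub>G\<^esub> y = x then f a * (g b * h z) else 0) else 0)"
    by (intro sum.cong refl) (simp add: sum.delta[OF assms(2)] m_assoc)
  also have "\<dots> = (\<Sum>a\<in>?G. \<Sum>y\<in>?G. \<Sum>b\<in>?G. \<Sum>z\<in>?G. 
        if y = b \<otimes>\<^bsub>G\<^esub> z then (if a \<otimes>\<^bsub>G\<^esub> y = x then f a * (g b * h z) else 0) else 0)"
    by (simp only: sum.cartesian_product)
       (rule sum.reindex_bij_witness[of _ "\<lambda>(a,y,b,z). (a,b,z,y)" "\<lambda>(a,b,z,y). (a,y,b,z)"]; auto)
  also have "\<dots> = (f \<otimes>\<^bsub>group_algebra G\<^esub> (g \<otimes>\<^bsub>group_algebra G\<^esub> h)) x"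
    by (simp add: group_algebra_mult[OF assms(2)] sum_distrib_left if_distrib[of "\<lambda>u. _ * u"]
         cong: if_cong) (intro sum.cong refl; auto intro!: sum.cong sum.neutral)
  finally show "((f \<otimes>\<^bsub>group_algebra G\<^esub> g) \<otimes>\<^bsub>group_algebra G\<^esub> h) x
    = (f \<otimes>\<^bsub>group_algebra G\<^esub> (g \<otimes>\<^bsub>group_algebra G\<^esub> h)) x" .
qed

lemma group_algebra_mult_linear:
  assumes "finite (carrier G)"
  shows "(f + f') \<otimes>\<^bsub>group_algebra G\<^esub> h = f \<otimes>\<^bsub>group_algebra G\<^esub> h + f' \<otimes>\<^bsub>group_algebra G\<^esub> h"
    and "f \<otimes>\<^bsub>group_algebra G\<^esub> (h + h') = f \<otimes>\<^bsub>group_algebra G\<^esub> h + f \<otimes>\<^bsub>group_algebra G\<^esub> h'"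
    and "scl c f \<otimes>\<^bsub>group_algebra G\<^esub> h = scl c (f \<otimes>\<^bsub>group_algebra G\<^esub> h)"
    and "f \<otimes>\<^bsub>group_algebra G\<^esub> scl c h = scl c (f \<otimes>\<^bsub>group_algebra G\<^esub> h)"
proof -
  note M = group_algebra_mult[OF assms]
  show "(f + f') \<otimes>\<^bsub>group_algebra G\<^esub> h = f \<otimes>\<^bsub>group_algebra G\<^esub> h + f' \<otimes>\<^bsub>group_algebra G\<^esub> h"
    unfolding M plus_fun_def sum.distrib[symmetric]
    by (intro ext sum.cong refl) (simp add: distrib_right)
  show "f \<otimes>\<^bsub>group_algebra G\<^esub> (h + h') = f \<otimes>\<^bsub>group_algebra G\<^esub> h + f \<otimes>\<^bsub>group_algebra G\<^esub> h'"
    unfolding M plus_fun_def sum.distrib[symmetric]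
    by (intro ext sum.cong refl) (simp add: distrib_left)
  show "scl c f \<otimes>\<^bsub>group_algebra G\<^esub> h = scl c (f \<otimes>\<^bsub>group_algebra G\<^esub> h)"
    unfolding M sum_distrib_left by (intro ext sum.cong refl) simp
  show "f \<otimes>\<^bsub>group_algebra G\<^esub> scl c h = scl c (f \<otimes>\<^bsub>group_algebra G\<^esub> h)"
    unfolding M sum_distrib_left by (intro ext sum.cong refl) simp
qed

lemma delta_mult_delta:
  assumes "group G" "finite (carrier G)" "g \<in> carrier G" "h \<in> carrier G"
  shows "delta g \<otimes>\<^bsub>group_algebra G\<^esub> delta h = delta (g \<otimes>\<^bsub>G\<^esub> h)"
proof
  fix x
  have "(delta g \<otimes>\<^bsub>group_algebra G\<^esub> delta h) x =
    (\<Sum>y\<in>carrier G. if y = g then (\<Sum>z\<in>carrier G. if z = h then (if y \<otimes>\<^bsub>G\<^esub> z = x then 1 else 0) else 0) else 0)"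
    unfolding group_algebra_mult[OF assms(2)]
    by (intro sum.cong refl) (auto simp: delta_def intro!: sum.cong sum.neutral)
  then show "(delta g \<otimes>\<^bsub>group_algebra G\<^esub> delta h) x = delta (g \<otimes>\<^bsub>G\<^esub> h) x"
    using assms by (auto simp: delta_def)
qed

lemma delta_in_group_algebra: "g \<in> carrier G \<Longrightarrow> delta g \<in> carrier (group_algebra G)"
  by (auto simp: group_algebra_simps delta_def)

lemma delta_one_mult:
  assumes "group G" "finite (carrier G)" "f \<in> carrier (group_algebra G)"
  shows "delta \<one>\<^bsub>G\<^esub> \<otimes>\<^bsub>group_algebra G\<^esub> f = f" "f \<otimes>\<^bsub>group_algebra G\<^esub> delta \<one>\<^bsub>G\<^esub> = f"
proof -
  interpret group G by fact
  have "(delta \<one>\<^bsub>G\<^esub> \<otimes>\<^bsub>group_algebra G\<^esub> f) x = f x" for x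
  proof -
    have "(delta \<one>\<^bsub>G\<^esub> \<otimes>\<^bsub>group_algebra G\<^esub> f) x =
      (\<Sum>y\<in>carrier G. if y = \<one>\<^bsub>G\<^esub> then (\<Sum>z\<in>carrier G. if z = x then f z else 0) else 0)"
      unfolding group_algebra_mult[OF assms(2)]
      by (intro sum.cong refl) (auto simp: delta_def intro!: sum.cong sum.neutral)
    also have "\<dots> = f x" using assms by (auto simp: group_algebra_simps)
    finally show ?thesis .
  qed
  then show "delta \<one>\<^bsub>G\<^esub> \<otimes>\<^bsub>group_algebra G\<^esub> f = f" by auto
  have "(f \<otimes>\<^bsub>group_algebra G\<^esub> delta \<one>\<^bsub>G\<^esub>) x = f x" for x
  proof -
    have "(f \<otimes>\<^bsub>group_algebra G\<^esub> delta \<one>\<^bsub>G\<^esub>) x =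
      (\<Sum>y\<in>carrier G. \<Sum>z\<in>carrier G. if z = \<one>\<^bsub>G\<^esub> then (if y = x then f y else 0) else 0)"
      unfolding group_algebra_mult[OF assms(2)]
      by (intro sum.cong refl) (auto simp: delta_def intro!: sum.cong sum.neutral)
    also have "\<dots> = f x" using assms by (auto simp: group_algebra_simps)
    finally show ?thesis .
  qed
  then show "f \<otimes>\<^bsub>group_algebra G\<^esub> delta \<one>\<^bsub>G\<^esub> = f" by auto
qed

text \<open>Linearity is assumed on the carrier only, because an element of \<open>algebra_iso\<close> is unconstrained
  outside of it.\<close>

lemma algebra_hom_delta_expansion:
  assumes J: "\<And>f h. f \<in> carrier (group_algebra H) \<Longrightarrow> h \<in> carrier (group_algebra H) \<Longrightarrow> J (f + h) = J f + J h"
    "\<And>c f. f \<in> carrier (group_algebra H) \<Longrightarrow> J (scl c f) = scl c (J f)"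
    and fin: "finite (carrier H)" and f: "f \<in> carrier (group_algebra H)"
  shows "J f = (\<lambda>x. \<Sum>h\<in>carrier H. f h * J (delta h) x)"
proof -
  have "J (\<lambda>x. if x \<in> S then f x else 0) = (\<lambda>x. \<Sum>h\<in>S. f h * J (delta h) x)"
    if "finite S" "S \<subseteq> carrier H" for S
    using that
  proof (induction S rule: finite_induct)
    case empty
    have "J (scl 0 f) = scl 0 (J f)" by (rule J(2)[OF f])
    then show ?case by simp
  next
    case (insert a S)
    have *: "(\<lambda>x. if x \<in> insert a S then f x else 0) = scl (f a) (delta a) + (\<lambda>x. if x \<in> S then f x else 0)"
      using insert.hyps by (auto simp: fun_eq_iff delta_def)
    have d: "delta a \<in> carrier (group_algebra H)" using insert.prems by (intro delta_in_group_algebra) auto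
    have sd: "scl (f a) (delta a) \<in> carrier (group_algebra H)" using d by (auto simp: group_algebra_simps)
    have r: "(\<lambda>x. if x \<in> S then f x else 0) \<in> carrier (group_algebra H)"
      using insert.prems by (auto simp: group_algebra_simps)
    show ?case unfolding * J(1)[OF sd r] J(2)[OF d]
      using insert by (auto simp: fun_eq_iff)
  qed
  from this[OF fin] have "J (\<lambda>x. if x \<in> carrier H then f x else 0) = (\<lambda>x. \<Sum>h\<in>carrier H. f h * J (delta h) x)" by simp
  moreover have "(\<lambda>x. if x \<in> carrier H then f x else 0) = f" using f by (auto simp: group_algebra_simps)
  ultimately show ?thesis by simp
qed

lemma algebra_iso_linear:
  assumes "J \<in> algebra_iso (group_algebra H) (group_algebra G)"
  shows "f \<in> carrier (group_algebra H) \<Longrightarrow> h \<in> carrier (group_algebra H) \<Longrightarrow> J (f + h) = J f + J h"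
    "f \<in> carrier (group_algebra H) \<Longrightarrow> J (scl c f) = scl c (J f)"
    "f \<in> carrier (group_algebra H) \<Longrightarrow> h \<in> carrier (group_algebra H) \<Longrightarrow>
       J (f \<otimes>\<^bsub>group_algebra H\<^esub> h) = J f \<otimes>\<^bsub>group_algebra G\<^esub> J h"
    "J (delta \<one>\<^bsub>H\<^esub>) = delta \<one>\<^bsub>G\<^esub>"
    "f \<in> carrier (group_algebra H) \<Longrightarrow> J f \<in> carrier (group_algebra G)"
    "bij_betw J (carrier (group_algebra H)) (carrier (group_algebra G))"
  using assms by (auto simp: algebra_iso_def ring_iso_def Ring.ring_hom_def group_algebra_simps)

lemma algebra_isoI:
  assumes "\<And>f. f \<in> carrier (group_algebra H) \<Longrightarrow> J f \<in> carrier (group_algebra G)"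
    "\<And>f h. f \<in> carrier (group_algebra H) \<Longrightarrow> h \<in> carrier (group_algebra H) \<Longrightarrow> J (f + h) = J f + J h"
    "\<And>f h. f \<in> carrier (group_algebra H) \<Longrightarrow> h \<in> carrier (group_algebra H) \<Longrightarrow>
       J (f \<otimes>\<^bsub>group_algebra H\<^esub> h) = J f \<otimes>\<^bsub>group_algebra G\<^esub> J h"
    "\<And>c f. f \<in> carrier (group_algebra H) \<Longrightarrow> J (scl c f) = scl c (J f)"
    "J (delta \<one>\<^bsub>H\<^esub>) = delta \<one>\<^bsub>G\<^esub>"
    "bij_betw J (carrier (group_algebra H)) (carrier (group_algebra G))"
  shows "J \<in> algebra_iso (group_algebra H) (group_algebra G)"
  unfolding algebra_iso_def ring_iso_def Ring.ring_hom_def mem_Collect_eq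
  unfolding group_algebra_simps(2-4) using assms by auto

lemma group_algebra_closed:
  "f \<in> carrier (group_algebra H) \<Longrightarrow> h \<in> carrier (group_algebra H) \<Longrightarrow> f + h \<in> carrier (group_algebra H)"
  "f \<in> carrier (group_algebra H) \<Longrightarrow> scl c f \<in> carrier (group_algebra H)"
  by (auto simp: group_algebra_simps)

lemma algebra_iso_inverse:
  assumes J: "J \<in> algebra_iso (group_algebra H) (group_algebra G)"
    and H: "group H" "finite (carrier H)"
  shows "inv_into (carrier (group_algebra H)) J \<in> algebra_iso (group_algebra G) (group_algebra H)"
proof -
  let ?A = "carrier (group_algebra H)" and ?B = "carrier (group_algebra G)"
  let ?K = "inv_into ?A J"
  note L = algebra_iso_linear[OF J]
  have bij: "bij_betw ?K ?B ?A" using L(6) by (rule bij_betw_inv_into)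
  have K: "?K b \<in> ?A" "J (?K b) = b" if "b \<in> ?B" for b
    using L(6) that by (auto simp: bij_betw_def f_inv_into_f inv_into_into)
  have eq: "?K b = a" if "a \<in> ?A" "J a = b" for a b
    using L(6) that by (auto simp: bij_betw_def)
  have one: "delta \<one>\<^bsub>H\<^esub> \<in> ?A" using H by (intro delta_in_group_algebra) (simp add: group.is_monoid)
  show ?thesis
    by (rule algebra_isoI)
      (auto intro!: eq group_algebra_closed group_algebra_mult_closed[OF H] one bij simp: L K)
qed

section \<open>Transporting irreducible characters along an isomorphism of group algebras\<close>

definition rep_ext :: "('g, 'm) monoid_scheme \<Rightarrow> nat \<Rightarrow> ('g \<Rightarrow> complex mat) \<Rightarrow> ('g \<Rightarrow> complex) \<Rightarrow> complex mat" where
  "rep_ext G d \<rho> f = mat d d (\<lambda>(i, j). \<Sum>g\<in>carrier G. f g * \<rho> g $$ (i, j))"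

lemma rep_ext_delta:
  assumes "matrix_rep G d \<rho>" "finite (carrier G)" "g \<in> carrier G"
  shows "rep_ext G d \<rho> (delta g) = \<rho> g"
proof -
  have "(\<Sum>h\<in>carrier G. delta g h * \<rho> h $$ (i, j)) = \<rho> g $$ (i, j)" for i j
  proof -
    have "(\<Sum>h\<in>carrier G. delta g h * \<rho> h $$ (i, j)) = (\<Sum>h\<in>carrier G. if h = g then \<rho> h $$ (i, j) else 0)"
      by (intro sum.cong) (auto simp: delta_def)
    then show ?thesis using assms by simp
  qed
  then show ?thesis using assms by (intro eq_matI) (auto simp: rep_ext_def matrix_rep_def)
qed

lemma rep_ext_mult:
  assumes rep: "matrix_rep G d \<rho>" and G: "group G" and fin: "finite (carrier G)"
  shows "rep_ext G d \<rho> (f \<otimes>\<^bsub>group_algebra G\<^esub> h) = rep_ext G d \<rho> f * rep_ext G d \<rho> h"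
proof (rule eq_matI)
  interpret group G by fact
  let ?G = "carrier G"
  fix i j assume "i < dim_row (rep_ext G d \<rho> f * rep_ext G d \<rho> h)"
    "j < dim_col (rep_ext G d \<rho> f * rep_ext G d \<rho> h)"
  then have ij: "i < d" "j < d" by (auto simp: rep_ext_def)
  have prod: "\<rho> (y \<otimes>\<^bsub>G\<^esub> z) $$ (i, j) = (\<Sum>k<d. \<rho> y $$ (i, k) * \<rho> z $$ (k, j))"
    if "y \<in> ?G" "z \<in> ?G" for y z
  proof -
    have c: "\<rho> y \<in> carrier_mat d d" "\<rho> z \<in> carrier_mat d d" "\<rho> (y \<otimes>\<^bsub>G\<^esub> z) = \<rho> y * \<rho> z"
      using rep that by (auto simp: matrix_rep_def)
    then show ?thesis using ij by (auto simp: scalar_prod_def lessThan_atLeast0 intro!: sum.cong)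
  qed
  have "(\<Sum>x\<in>?G. (f \<otimes>\<^bsub>group_algebra G\<^esub> h) x * \<rho> x $$ (i, j)) =
    (\<Sum>x\<in>?G. \<Sum>y\<in>?G. \<Sum>z\<in>?G. if x = y \<otimes>\<^bsub>G\<^esub> z then f y * h z * \<rho> x $$ (i, j) else 0)"
    unfolding group_algebra_mult[OF fin] sum_distrib_right by (intro sum.cong refl) auto
  also have "\<dots> = (\<Sum>y\<in>?G. \<Sum>z\<in>?G. \<Sum>x\<in>?G. if x = y \<otimes>\<^bsub>G\<^esub> z then f y * h z * \<rho> x $$ (i, j) else 0)"
    by (rule trans[OF sum.swap]) (rule sum.cong[OF refl], rule sum.swap)
  also have "\<dots> = (\<Sum>y\<in>?G. \<Sum>z\<in>?G. f y * h z * \<rho> (y \<otimes>\<^bsub>G\<^esub> z) $$ (i, j))"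
    by (intro sum.cong refl) (simp add: fin)
  also have "\<dots> = (\<Sum>y\<in>?G. \<Sum>z\<in>?G. \<Sum>k<d. (f y * \<rho> y $$ (i, k)) * (h z * \<rho> z $$ (k, j)))"
    by (intro sum.cong refl) (simp add: prod sum_distrib_left mult_ac)
  also have "\<dots> = (\<Sum>y\<in>?G. \<Sum>k<d. \<Sum>z\<in>?G. (f y * \<rho> y $$ (i, k)) * (h z * \<rho> z $$ (k, j)))"
    by (intro sum.cong refl, rule sum.swap)
  also have "\<dots> = (\<Sum>k<d. \<Sum>y\<in>?G. \<Sum>z\<in>?G. (f y * \<rho> y $$ (i, k)) * (h z * \<rho> z $$ (k, j)))"
    by (rule sum.swap)
  also have "\<dots> = (\<Sum>k<d. (\<Sum>y\<in>?G. f y * \<rho> y $$ (i, k)) * (\<Sum>z\<in>?G. h z * \<rho> z $$ (k, j)))"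
    by (simp add: sum_product)
  finally show "rep_ext G d \<rho> (f \<otimes>\<^bsub>group_algebra G\<^esub> h) $$ (i, j) = (rep_ext G d \<rho> f * rep_ext G d \<rho> h) $$ (i, j)"
    using ij by (simp add: rep_ext_def scalar_prod_def lessThan_atLeast0)
qed (auto simp: rep_ext_def)

lemma matrix_rep_transport:
  assumes J: "J \<in> algebra_iso (group_algebra H) (group_algebra G)"
    and H: "group H" "finite (carrier H)" and G: "group G" "finite (carrier G)"
    and rep: "matrix_rep G d \<rho>"
  shows "matrix_rep H d (\<lambda>h. rep_ext G d \<rho> (J (delta h)))"
proof -
  note L = algebra_iso_linear[OF J]
  interpret G: group G by fact
  have "rep_ext G d \<rho> (J (delta \<one>\<^bsub>H\<^esub>)) = 1\<^sub>m d"
    using rep_ext_delta[OF rep G(2), of "\<one>\<^bsub>G\<^esub>"] rep by (simp add: L(4) matrix_rep_def)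
  moreover have "rep_ext G d \<rho> (J (delta (g \<otimes>\<^bsub>H\<^esub> h))) = rep_ext G d \<rho> (J (delta g)) * rep_ext G d \<rho> (J (delta h))"
    if "g \<in> carrier H" "h \<in> carrier H" for g h
    using that L(3)[of "delta g" "delta h"]
    by (simp add: delta_mult_delta[OF H] delta_in_group_algebra rep_ext_mult[OF rep G])
  ultimately show ?thesis by (auto simp: matrix_rep_def rep_ext_def)
qed

lemma rep_ext_transport:
  assumes J: "J \<in> algebra_iso (group_algebra H) (group_algebra G)"
    and fin: "finite (carrier H)" and f: "f \<in> carrier (group_algebra H)"
  shows "rep_ext H d (\<lambda>h. rep_ext G d \<rho> (J (delta h))) f = rep_ext G d \<rho> (J f)"
proof (rule eq_matI)
  fix i j assume "i < dim_row (rep_ext G d \<rho> (J f))" "j < dim_col (rep_ext G d \<rho> (J f))"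
  then have ij: "i < d" "j < d" by (auto simp: rep_ext_def)
  have "J f = (\<lambda>x. \<Sum>h\<in>carrier H. f h * J (delta h) x)"
    by (rule algebra_hom_delta_expansion[OF algebra_iso_linear(1,2)[OF J] fin f])
  then have "(\<Sum>g\<in>carrier G. J f g * \<rho> g $$ (i,j)) =
     (\<Sum>g\<in>carrier G. \<Sum>h\<in>carrier H. f h * (J (delta h) g * \<rho> g $$ (i,j)))"
    by (simp add: sum_distrib_right mult.assoc)
  also have "\<dots> = (\<Sum>h\<in>carrier H. f h * (\<Sum>g\<in>carrier G. J (delta h) g * \<rho> g $$ (i,j)))"
    by (subst sum.swap) (simp add: sum_distrib_left)
  finally show "rep_ext H d (\<lambda>h. rep_ext G d \<rho> (J (delta h))) f $$ (i,j) = rep_ext G d \<rho> (J f) $$ (i,j)"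
    using ij by (simp add: rep_ext_def)
qed (auto simp: rep_ext_def)

lemma rep_ext_invariant:
  assumes sub: "VectorSpace.subspace class_ring W (module_vec TYPE(complex) d)"
    and rep: "\<forall>h\<in>carrier H. \<rho> h \<in> carrier_mat d d"
    and inv: "\<forall>h\<in>carrier H. \<forall>v\<in>W. \<rho> h *\<^sub>v v \<in> W"
    and v: "v \<in> W" and fin: "finite (carrier H)"
  shows "rep_ext H d \<rho> f *\<^sub>v v \<in> W"
proof -
  have sm: "LinearCombinations.submodule class_ring W (module_vec TYPE(complex) d)"
    using sub by (simp add: VectorSpace.subspace_def)
  have Wd: "W \<subseteq> carrier_vec d"
    using LinearCombinations.submodule.subset[OF sm] by (simp add: module_vec_simps)
  have W0: "0\<^sub>v d \<in> W"
    using LinearCombinations.submodule.zero_closed[OF sm] by (simp add: module_vec_simps)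
  have Wadd: "a + b \<in> W" if "a \<in> W" "b \<in> W" for a b
    using LinearCombinations.submodule.m_closed[OF sm that] by (simp add: module_vec_simps)
  have Wsm: "c \<cdot>\<^sub>v a \<in> W" if "a \<in> W" for c a
    using LinearCombinations.submodule.smult_closed[OF sm _ that, of c]
    by (simp add: module_vec_simps class_ring_simps)
  define M where "M S = mat d d (\<lambda>(i, j). \<Sum>g\<in>S. f g * \<rho> g $$ (i, j))" for S
  have "M S *\<^sub>v v \<in> W" if "finite S" "S \<subseteq> carrier H" for S
    using that
  proof (induction S rule: finite_induct)
    case empty
    have "M {} *\<^sub>v v = 0\<^sub>v d" using Wd v by (intro eq_vecI) (auto simp: M_def scalar_prod_def)
    then show ?case using W0 by simp
  next
    case (insert a S)
    have a: "\<rho> a \<in> carrier_mat d d" using insert rep by auto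
    have "M (insert a S) = f a \<cdot>\<^sub>m \<rho> a + M S"
      using a insert by (intro eq_matI) (auto simp: M_def)
    moreover have "M S \<in> carrier_mat d d" by (simp add: M_def)
    ultimately have "M (insert a S) *\<^sub>v v = f a \<cdot>\<^sub>v (\<rho> a *\<^sub>v v) + M S *\<^sub>v v"
      using a subsetD[OF Wd v] by (intro eq_vecI) (auto simp: add_scalar_prod_distrib[of _ d])
    then show ?case using insert inv v by (auto intro!: Wadd Wsm)
  qed
  then show ?thesis using fin by (simp add: M_def rep_ext_def)
qed

text \<open>A subspace that is invariant under a representation is invariant under all of its linear
  combinations. Because \<open>J\<close> is onto, every \<open>\<rho> g\<close> is a linear combination of transported matrices;
  so an invariant subspace for these is invariant under \<open>\<rho>\<close>.\<close>

lemma irreducible_rep_transport: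
  assumes J: "J \<in> algebra_iso (group_algebra H) (group_algebra G)"
    and H: "group H" "finite (carrier H)" and G: "group G" "finite (carrier G)"
    and irr: "irreducible_rep G d \<rho>"
  shows "irreducible_rep H d (\<lambda>h. rep_ext G d \<rho> (J (delta h)))"
proof -
  let ?\<sigma> = "\<lambda>h. rep_ext G d \<rho> (J (delta h))"
  have rep: "matrix_rep G d \<rho>" using irr by (simp add: irreducible_rep_def)
  have rep': "matrix_rep H d ?\<sigma>" by (rule matrix_rep_transport[OF J H G rep])
  {
    fix W assume W: "VectorSpace.subspace class_ring W (module_vec TYPE(complex) d)"
      and inv: "\<forall>h\<in>carrier H. \<forall>v\<in>W. ?\<sigma> h *\<^sub>v v \<in> W"
    have "\<rho> g *\<^sub>v v \<in> W" if g: "g \<in> carrier G" and v: "v \<in> W" for g v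
    proof -
      obtain f where f: "f \<in> carrier (group_algebra H)" "J f = delta g"
        using algebra_iso_linear(6)[OF J] delta_in_group_algebra[OF g]
        by (metis bij_betw_imp_surj_on imageE)
      have "rep_ext H d ?\<sigma> f *\<^sub>v v \<in> W"
        by (rule rep_ext_invariant[OF W _ inv v H(2)]) (simp add: rep_ext_def)
      then show ?thesis
        using f g by (simp add: rep_ext_transport[OF J H(2)] rep_ext_delta[OF rep G(2)])
    qed
    then have "W = {0\<^sub>v d} \<or> W = carrier_vec d" using irr W by (auto simp: irreducible_rep_def)
  }
  then show ?thesis using rep' irr by (auto simp: irreducible_rep_def)
qed

lemma rep_character_transport:
  "rep_character H d (\<lambda>h. rep_ext G d \<rho> (J (delta h))) = precompose G H J (rep_character G d \<rho>)"
proof -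
  have "(\<Sum>i<d. rep_ext G d \<rho> f $$ (i,i)) = linear_ext G (rep_character G d \<rho>) f" for f
  proof -
    have "(\<Sum>i<d. rep_ext G d \<rho> f $$ (i,i)) = (\<Sum>i<d. \<Sum>g\<in>carrier G. f g * \<rho> g $$ (i,i))"
      by (simp add: rep_ext_def)
    also have "\<dots> = (\<Sum>g\<in>carrier G. \<Sum>i<d. f g * \<rho> g $$ (i,i))" by (rule sum.swap)
    also have "\<dots> = linear_ext G (rep_character G d \<rho>) f"
      by (simp add: linear_ext_def rep_character_def sum_distrib_left)
    finally show ?thesis .
  qed
  then show ?thesis by (simp add: rep_character_def precompose_def)
qed

lemma precompose_inverse:
  assumes J: "J \<in> algebra_iso (group_algebra H) (group_algebra G)"
    and H: "group H" "finite (carrier H)" and G: "finite (carrier G)"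
    and ext: "\<chi> \<in> extensional (carrier G)"
    and K: "\<And>f. f \<in> carrier (group_algebra G) \<Longrightarrow> K f \<in> carrier (group_algebra H) \<and> J (K f) = f"
  shows "precompose H G K (precompose G H J \<chi>) = \<chi>"
proof
  fix g
  show "precompose H G K (precompose G H J \<chi>) g = \<chi> g"
  proof (cases "g \<in> carrier G")
    case True
    note Kg = K[OF delta_in_group_algebra[OF True]]
    have JK: "(\<Sum>h\<in>carrier H. K (delta g) h * J (delta h) x) = delta g x" for x
      using algebra_hom_delta_expansion[OF algebra_iso_linear(1,2)[OF J] H(2) conjunct1[OF Kg]] Kg
      by metis
    have "(\<Sum>h\<in>carrier H. K (delta g) h * (\<Sum>x\<in>carrier G. J (delta h) x * \<chi> x)) =
      (\<Sum>h\<in>carrier H. \<Sum>x\<in>carrier G. K (delta g) h * J (delta h) x * \<chi> x)"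
      by (simp add: sum_distrib_left mult.assoc)
    also have "\<dots> = (\<Sum>x\<in>carrier G. \<Sum>h\<in>carrier H. K (delta g) h * J (delta h) x * \<chi> x)"
      by (rule sum.swap)
    also have "\<dots> = (\<Sum>x\<in>carrier G. delta g x * \<chi> x)"
      by (simp add: JK flip: sum_distrib_right)
    also have "\<dots> = (\<Sum>x\<in>carrier G. if x = g then \<chi> x else 0)"
      by (intro sum.cong) (auto simp: delta_def)
    also have "\<dots> = \<chi> g" using True G by simp
    finally show ?thesis using True by (simp add: precompose_def linear_ext_def)
  next
    case False
    then show ?thesis using ext by (simp add: precompose_def extensional_def)
  qed
qed

lemma precompose_irr_chars:
  assumes J: "J \<in> algebra_iso (group_algebra H) (group_algebra G)"
    and H: "group H" "finite (carrier H)" and G: "group G" "finite (carrier G)"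
    and "\<chi> \<in> irr_chars G"
  shows "precompose G H J \<chi> \<in> irr_chars H"
proof -
  obtain d \<rho> where \<rho>: "irreducible_rep G d \<rho>" "\<chi> = rep_character G d \<rho>"
    using assms(6) by (auto simp: irr_chars_def)
  show ?thesis
    using irreducible_rep_transport[OF J H G \<rho>(1)] rep_character_transport[of H d G \<rho> J]
    unfolding irr_chars_def \<rho>(2) by force
qed

text \<open>Precomposition with the inverse isomorphism is the inverse map: two extensional functions on a
  group that have the same linear extension are equal.\<close>

theorem algebra_iso_bij_irr_chars:
  assumes J: "J \<in> algebra_iso (group_algebra H) (group_algebra G)"
    and H: "group H" "finite (carrier H)" and G: "group G" "finite (carrier G)"
  shows "bij_betw (precompose G H J) (irr_chars G) (irr_chars H)"
proof -
  let ?K = "inv_into (carrier (group_algebra H)) J"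
  have K: "?K \<in> algebra_iso (group_algebra G) (group_algebra H)"
    by (rule algebra_iso_inverse[OF J H])
  note LJ = algebra_iso_linear[OF J] and LK = algebra_iso_linear[OF K]
  have ext: "irr_chars X \<subseteq> extensional (carrier X)" for X :: "('z,'u) monoid_scheme"
    by (auto simp: irr_chars_def rep_character_def)
  have JK: "?K f \<in> carrier (group_algebra H) \<and> J (?K f) = f" if "f \<in> carrier (group_algebra G)" for f
    using LJ(6) that by (auto simp: bij_betw_def f_inv_into_f inv_into_into)
  have KJ: "J f \<in> carrier (group_algebra G) \<and> ?K (J f) = f" if "f \<in> carrier (group_algebra H)" for f
    using LJ(6) that by (auto simp: bij_betw_def)
  show ?thesis
  proof (rule bij_betw_byWitness[where f' = "precompose H G ?K"])
    show "\<forall>\<chi>\<in>irr_chars G. precompose H G ?K (precompose G H J \<chi>) = \<chi>"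
      using precompose_inverse[OF J H G(2) _ JK] ext by blast
    show "\<forall>\<chi>\<in>irr_chars H. precompose G H J (precompose H G ?K \<chi>) = \<chi>"
      using precompose_inverse[OF K G H(2) _ KJ] ext by blast
  qed (auto intro!: precompose_irr_chars J K H G)
qed

section \<open>Traces on finite-dimensional spaces of functions\<close>

abbreviation (input) clinear_fun :: "(('a \<Rightarrow> complex) \<Rightarrow> 'b \<Rightarrow> complex) \<Rightarrow> bool" where
  "clinear_fun \<equiv> module_hom (\<lambda>c f x. c * f x) (\<lambda>c f x. c * f x)"

lemma sum_fun_apply: "(\<Sum>i\<in>A. F i) x = (\<Sum>i\<in>A. F i x :: 'b::comm_monoid_add)"
  by (induction A rule: infinite_finite_induct) auto

lemma clinear_funI:
  assumes "\<And>f h. \<phi> (f + h) = \<phi> f + \<phi> h" "\<And>c f. \<phi> (scl c f) = scl c (\<phi> f)"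
  shows "clinear_fun \<phi>"
  unfolding module_hom_iff using assms by (auto intro: cfun.module_axioms)

text \<open>Since \<open>trace_on\<close> picks some basis, every computation of a trace has to pass through the
  basis independence of the diagonal sum.\<close>

lemma trace_basis_change:
  fixes B C :: "('a \<Rightarrow> complex) set"
  assumes B: "cfun.independent B" "finite B" and C: "cfun.independent C" "finite C"
    and span: "cfun.span B = cfun.span C"
    and T: "clinear_fun T" "T ` cfun.span B \<subseteq> cfun.span B"
  shows "(\<Sum>b\<in>B. cfun.representation B (T b) b) = (\<Sum>c\<in>C. cfun.representation C (T c) c)"
proof -
  interpret T: module_hom "\<lambda>c f x. c * f x" "\<lambda>c f x. c * f x" T by (rule T)
  let ?P = "\<lambda>b. cfun.representation C b" and ?Q = "\<lambda>c. cfun.representation B c"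
  have TC: "T c \<in> cfun.span B" if "c \<in> C" for c
    using that T(2) cfun.span_base[of c C] span by blast
  (* Both b and the vectors T c are expanded in the basis C. *)
  have Tb: "?Q (T b) b = (\<Sum>c\<in>C. \<Sum>d\<in>C. ?P (T c) d * (?P b c * ?Q d b))" if b: "b \<in> B" for b
  proof -
    have beq: "b = (\<Sum>c\<in>C. scl (?P b c) c)"
      using cfun.sum_representation_eq[OF C(1) _ C(2) order_refl, of b] cfun.span_base[OF b] span by simp
    have "T b = (\<Sum>c\<in>C. scl (?P b c) (T c))"
      using arg_cong[OF beq, of T] by (simp only: T.sum T.scale)
    then have "?Q (T b) b = (\<Sum>c\<in>C. ?P b c * ?Q (T c) b)"
      by (simp add: cfun.representation_sum[OF B(1)] cfun.representation_scale[OF B(1)] TC cfun.span_scale)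
    also have "\<dots> = (\<Sum>c\<in>C. \<Sum>d\<in>C. ?P (T c) d * (?P b c * ?Q d b))"
    proof (rule sum.cong[OF refl])
      fix c assume c: "c \<in> C"
      have "T c = (\<Sum>d\<in>C. scl (?P (T c) d) d)"
        using cfun.sum_representation_eq[OF C(1) _ C(2) order_refl, of "T c"] TC[OF c] span by simp
      then have "?Q (T c) b = ?Q (\<Sum>d\<in>C. scl (?P (T c) d) d) b" by simp
      also have "\<dots> = (\<Sum>d\<in>C. ?P (T c) d * ?Q d b)"
        using span by (simp add: cfun.representation_sum[OF B(1)] cfun.representation_scale[OF B(1)]
            cfun.span_base cfun.span_scale)
      finally show "?P b c * ?Q (T c) b = (\<Sum>d\<in>C. ?P (T c) d * (?P b c * ?Q d b))"
        by (simp add: sum_distrib_left mult_ac)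
    qed
    finally show ?thesis .
  qed
  (* The two base change matrices are inverse to each other. *)
  have PQ: "(\<Sum>b\<in>B. ?P b c * ?Q d b) = (if c = d then 1 else 0)" if "c \<in> C" "d \<in> C" for c d
  proof -
    have "d = (\<Sum>b\<in>B. scl (?Q d b) b)"
      using cfun.sum_representation_eq[OF B(1) _ B(2) order_refl, of d] cfun.span_base[OF that(2)] span by simp
    then have "?P d c = ?P (\<Sum>b\<in>B. scl (?Q d b) b) c" by simp
    also have "\<dots> = (\<Sum>b\<in>B. ?Q d b * ?P b c)"
      using span[symmetric] by (simp add: cfun.representation_sum[OF C(1)] cfun.representation_scale[OF C(1)]
            cfun.span_base cfun.span_scale)
    also have "\<dots> = (\<Sum>b\<in>B. ?P b c * ?Q d b)" by (intro sum.cong refl mult.commute)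
    finally show ?thesis using cfun.representation_basis[OF C(1) that(2)] by simp
  qed
  have "(\<Sum>b\<in>B. ?Q (T b) b) = (\<Sum>b\<in>B. \<Sum>c\<in>C. \<Sum>d\<in>C. ?P (T c) d * (?P b c * ?Q d b))"
    by (intro sum.cong refl Tb)
  also have "\<dots> = (\<Sum>c\<in>C. \<Sum>b\<in>B. \<Sum>d\<in>C. ?P (T c) d * (?P b c * ?Q d b))"
    by (rule sum.swap)
  also have "\<dots> = (\<Sum>c\<in>C. \<Sum>d\<in>C. \<Sum>b\<in>B. ?P (T c) d * (?P b c * ?Q d b))"
    by (rule sum.cong[OF refl], rule sum.swap)
  also have "\<dots> = (\<Sum>c\<in>C. \<Sum>d\<in>C. if c = d then ?P (T c) d else 0)"
  proof (rule sum.cong[OF refl], rule sum.cong[OF refl])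
    fix c d assume cd: "c \<in> C" "d \<in> C"
    show "(\<Sum>b\<in>B. ?P (T c) d * (?P b c * ?Q d b)) = (if c = d then ?P (T c) d else 0)"
      unfolding sum_distrib_left[symmetric] PQ[OF cd] by simp
  qed
  also have "\<dots> = (\<Sum>c\<in>C. ?P (T c) c)" using C by simp
  finally show ?thesis .
qed

lemma trace_on_eq:
  assumes B: "cfun.independent B" "finite B" and T: "clinear_fun T" "T ` cfun.span B \<subseteq> cfun.span B"
  shows "trace_on (cfun.span B) T = (\<Sum>b\<in>B. cfun.representation B (T b) b)"
proof -
  define C where "C = (SOME C. cfun.independent C \<and> cfun.span C = cfun.span B)"
  have C: "cfun.independent C" "cfun.span C = cfun.span B"
    using someI[of "\<lambda>C. cfun.independent C \<and> cfun.span C = cfun.span B" B] B by (auto simp: C_def)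
  have fin: "finite C"
    using cfun.independent_span_bound[OF B(2) C(1)] C(2) cfun.span_superset[of C] by auto
  have "trace_on (cfun.span B) T = (\<Sum>c\<in>C. cfun.representation C (T c) c)"
    by (simp only: trace_on_def Let_def C_def)
  also have "\<dots> = (\<Sum>b\<in>B. cfun.representation B (T b) b)"
    using B C fin T by (intro trace_basis_change) auto
  finally show ?thesis .
qed

lemma span_eq_of_card:
  assumes C: "finite C" and B: "cfun.independent B" "B \<subseteq> cfun.span C" "card C \<le> card B"
  shows "cfun.span B = cfun.span C"
proof -
  have "finite B \<and> card B \<le> card C" by (rule cfun.independent_span_bound[OF C B(1,2)])
  then have B': "finite B" "card B = card C" using B(3) by auto
  show ?thesis
  proof (rule antisym)
    show "cfun.span B \<subseteq> cfun.span C" using B(2) cfun.span_minimal cfun.subspace_span by metis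
    have "x \<in> cfun.span B" if x: "x \<in> C" for x
    proof (rule ccontr)
      assume n: "x \<notin> cfun.span B"
      have ins: "cfun.independent (insert x B)" using n B(1) by (simp add: cfun.independent_insertI)
      have "card (insert x B) \<le> card C"
        using cfun.independent_span_bound[OF C ins] B(2) x cfun.span_base[OF x] by auto
      moreover have "x \<notin> B" using n cfun.span_base by blast
      ultimately show False using B' by simp
    qed
    then show "cfun.span C \<subseteq> cfun.span B" using cfun.span_minimal[OF _ cfun.subspace_span] by blast
  qed
qed

text \<open>Injective linear maps in both directions force the dimensions to agree, so that \<open>\<phi>\<close> is an
  isomorphism. Only \<open>\<phi>\<close> has to intertwine the endomorphisms, up to the scalar \<open>s\<close>; the maps are linear
  on all functions, but injective on the subspaces only.\<close>

lemma trace_on_transport: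
  assumes V: "cfun.subspace V" "V \<subseteq> cfun.span D" "finite D"
    and W: "cfun.subspace W" "W \<subseteq> cfun.span E" "finite E"
    and \<phi>: "clinear_fun \<phi>" "\<phi> ` V \<subseteq> W" "inj_on \<phi> V"
    and \<psi>: "clinear_fun \<psi>" "\<psi> ` W \<subseteq> V" "inj_on \<psi> W"
    and T: "clinear_fun T" "T ` V \<subseteq> V" and U: "clinear_fun U" "U ` W \<subseteq> W"
    and equi: "\<And>v. v \<in> V \<Longrightarrow> U (\<phi> v) = scl s (\<phi> (T v))"
  shows "trace_on W U = s * trace_on V T"
proof -
  interpret \<phi>: module_hom "\<lambda>c f x. c * f x" "\<lambda>c f x. c * f x" \<phi> by (rule \<phi>)
  interpret \<psi>: module_hom "\<lambda>c f x. c * f x" "\<lambda>c f x. c * f x" \<psi> by (rule \<psi>)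
  have ex: "\<exists>B. cfun.independent B \<and> cfun.span B = X \<and> finite B"
    if X: "cfun.subspace X" "X \<subseteq> cfun.span D'" "finite D'" for X and D' :: "('z \<Rightarrow> complex) set"
  proof -
    obtain B where B: "B \<subseteq> X" "cfun.independent B" "X \<subseteq> cfun.span B"
      using cfun.maximal_independent_subset by blast
    then show ?thesis
      using cfun.independent_span_bound[OF X(3) B(2)] X cfun.span_minimal[OF B(1) X(1)]
      by (intro exI[of _ B]) auto
  qed
  obtain B where B: "cfun.independent B" "cfun.span B = V" "finite B" using ex[OF V] by auto
  obtain C where C: "cfun.independent C" "cfun.span C = W" "finite C" using ex[OF W] by auto
  have injB: "inj_on \<phi> B" and injC: "inj_on \<psi> C"
    using \<phi>(3) \<psi>(3) B(2) C(2) cfun.span_superset by (metis inj_on_subset)+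
  have ind: "cfun.independent (\<phi> ` B)" "cfun.independent (\<psi> ` C)"
    using \<phi>.independent_injective_image[OF B(1)] \<psi>.independent_injective_image[OF C(1)] \<phi>(3) \<psi>(3) B(2) C(2) by auto
  have sub: "\<phi> ` B \<subseteq> cfun.span C" "\<psi> ` C \<subseteq> cfun.span B"
    using \<phi>(2) \<psi>(2) B(2) C(2) cfun.span_superset[of B] cfun.span_superset[of C] by blast+
  have "card C \<le> card B"
    using cfun.independent_span_bound[OF B(3) ind(2) sub(2)] injC by (simp add: card_image)
  then have sp: "cfun.span (\<phi> ` B) = W"
    using span_eq_of_card[OF C(3) ind(1) sub(1)] injB C(2) by (simp add: card_image)
  have rep: "cfun.representation (\<phi> ` B) (U (\<phi> b)) (\<phi> b) = s * cfun.representation B (T b) b" if b: "b \<in> B" for b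
  proof -
    let ?r = "cfun.representation B (T b)"
    have Tb: "T b \<in> cfun.span B" using b T(2) B(2) cfun.span_base by blast
    have bV: "b \<in> V" using b B(2) cfun.span_base by blast
    have "U (\<phi> b) = scl s (\<phi> (\<Sum>c\<in>B. scl (?r c) c))"
      using equi[OF bV] cfun.sum_representation_eq[OF B(1) Tb B(3) order_refl] by simp
    also have "\<dots> = (\<Sum>c\<in>B. scl (s * ?r c) (\<phi> c))"
      unfolding \<phi>.sum \<phi>.scale cfun.scale_sum_right by (simp only: mult.assoc)
    finally have "cfun.representation (\<phi> ` B) (U (\<phi> b)) (\<phi> b)
        = cfun.representation (\<phi> ` B) (\<Sum>c\<in>B. scl (s * ?r c) (\<phi> c)) (\<phi> b)" by simp
    also have "\<dots> = (\<Sum>c\<in>B. (s * ?r c) * cfun.representation (\<phi> ` B) (\<phi> c) (\<phi> b))"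
      by (simp add: cfun.representation_sum[OF ind(1)] cfun.representation_scale[OF ind(1)]
          cfun.span_base cfun.span_scale)
    also have "\<dots> = (\<Sum>c\<in>B. if c = b then s * ?r c else 0)"
      using injB b by (intro sum.cong) (auto simp: cfun.representation_basis[OF ind(1)] inj_on_def)
    finally show ?thesis using b B(3) by simp
  qed
  have "trace_on W U = (\<Sum>c\<in>\<phi> ` B. cfun.representation (\<phi> ` B) (U c) c)"
    using trace_on_eq[OF ind(1) _ U(1)] B(3) U(2) sp by simp
  also have "\<dots> = (\<Sum>b\<in>B. s * cfun.representation B (T b) b)"
    by (simp add: sum.reindex[OF injB] rep)
  also have "\<dots> = s * trace_on V T"
    using trace_on_eq[OF B(1,3) T(1)] T(2) B(2) by (simp add: sum_distrib_left)
  finally show ?thesis .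
qed

section \<open>Left ideals of a group algebra\<close>

locale finite_group = group G for G (structure) + assumes fin: "finite (carrier G)"
begin

abbreviation conv (infixl "\<star>" 70) where "f \<star> h \<equiv> f \<otimes>\<^bsub>group_algebra G\<^esub> h"
abbreviation "GA \<equiv> carrier (group_algebra G)"

lemmas conv_closed [simp] = group_algebra_mult_closed[OF is_group fin]
lemmas conv_assoc = group_algebra_mult_assoc[OF is_group fin]
lemmas conv_linear = group_algebra_mult_linear[OF fin]
lemmas conv_delta = delta_mult_delta[OF is_group fin]
lemmas delta_one_conv = delta_one_mult[OF is_group fin]

lemma conv_inverse_deltas:
  assumes "u \<in> carrier G" "f \<in> GA"
  shows "f \<star> delta u \<star> delta (inv u) = f" "f \<star> delta (inv u) \<star> delta u = f"
  using assms by (simp_all add: conv_assoc conv_delta delta_one_conv)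

lemma conv_0 [simp]: "0 \<star> f = 0" "f \<star> 0 = 0"
  using conv_linear(3)[of 0 0 f] conv_linear(4)[of f 0 0] by (simp_all add: zero_fun_def)

lemma linear_conv_right: "clinear_fun (\<lambda>f. f \<star> h)"
  by (intro clinear_funI conv_linear)

lemma linear_conv_left: "clinear_fun (\<lambda>f. h \<star> f)"
  by (intro clinear_funI conv_linear)

text \<open>The conjugate-linear anti-involution \<open>g \<mapsto> g\<^sup>-\<^sup>1\<close> of the group algebra.\<close>

definition star :: "('a \<Rightarrow> complex) \<Rightarrow> 'a \<Rightarrow> complex" where
  "star f = (\<lambda>x. if x \<in> carrier G then cnj (f (inv x)) else 0)"

lemma star_closed [simp]: "star f \<in> GA"
  by (auto simp: star_def group_algebra_simps)

lemma star_star: "f \<in> GA \<Longrightarrow> star (star f) = f"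
  by (auto simp: star_def group_algebra_simps fun_eq_iff)

lemma sum_inv: "(\<Sum>x\<in>carrier G. F (inv x)) = (\<Sum>x\<in>carrier G. F x)"
  by (rule sum.reindex_bij_witness[of _ "\<lambda>x. inv x" "\<lambda>x. inv x"]) auto

lemma star_conv: "star (f \<star> h) = star h \<star> star f"
proof
  fix x
  show "star (f \<star> h) x = (star h \<star> star f) x"
  proof (cases "x \<in> carrier G")
    case True
    have eq: "inv z \<otimes> inv y = x \<longleftrightarrow> y \<otimes> z = inv x" if "y \<in> carrier G" "z \<in> carrier G" for y z
      using that True by (metis inv_inv inv_mult_group m_closed)
    have "(star h \<star> star f) x = (\<Sum>y\<in>carrier G. \<Sum>z\<in>carrier G. if z \<otimes> y = x then star h z * star f y else 0)"
      unfolding group_algebra_mult[OF fin] by (rule sum.swap)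
    also have "\<dots> = (\<Sum>y\<in>carrier G. \<Sum>z\<in>carrier G. if inv z \<otimes> inv y = x then star h (inv z) * star f (inv y) else 0)"
      by (subst sum_inv[symmetric], rule sum.cong[OF refl], rule sum_inv[symmetric])
    also have "\<dots> = (\<Sum>y\<in>carrier G. \<Sum>z\<in>carrier G. cnj (if y \<otimes> z = inv x then f y * h z else 0))"
      by (intro sum.cong refl) (simp add: eq star_def)
    also have "\<dots> = star (f \<star> h) x"
      using True by (simp add: star_def group_algebra_mult[OF fin])
    finally show ?thesis by simp
  next
    case False
    have "star h \<star> star f \<in> GA" by simp
    then show ?thesis using False by (auto simp: star_def group_algebra_simps)
  qed
qed

text \<open>Positivity: the coefficient of \<open>f f\<^sup>*\<close> at the identity is the sum of the squared absolute values of the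
  coefficients of \<open>f\<close>.\<close>

lemma conv_star_eq_0:
  assumes f: "f \<in> GA" and 0: "f \<star> star f = 0"
  shows "f = 0"
proof -
  have eq: "y \<otimes> z = \<one> \<longleftrightarrow> z = inv y" if "y \<in> carrier G" "z \<in> carrier G" for y z
    using that by (metis inv_equality inv_inv inv_closed r_inv)
  have "0 = (f \<star> star f) \<one>" using 0 by simp
  also have "\<dots> = (\<Sum>y\<in>carrier G. \<Sum>z\<in>carrier G. if z = inv y then f y * star f z else 0)"
    unfolding group_algebra_mult[OF fin] by (intro sum.cong refl) (simp add: eq)
  also have "\<dots> = (\<Sum>y\<in>carrier G. f y * star f (inv y))" by (intro sum.cong refl) (simp add: fin)
  also have "\<dots> = (\<Sum>y\<in>carrier G. of_real ((cmod (f y))\<^sup>2))"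
    by (intro sum.cong refl) (simp add: star_def complex_norm_square del: of_real_power)
  finally have "(\<Sum>y\<in>carrier G. (cmod (f y))\<^sup>2) = 0"
    by (metis of_real_eq_0_iff of_real_sum)
  then have "\<forall>y\<in>carrier G. f y = 0" by (subst (asm) sum_nonneg_eq_0_iff) (auto simp: fin)
  then show ?thesis using f by (auto simp: group_algebra_simps fun_eq_iff)
qed

text \<open>Right multiplication by \<open>x\<^sup>*\<close> is injective on the left ideal generated by \<open>x\<close>: if
  \<open>a x x\<^sup>* = 0\<close>, then \<open>(a x) (a x)\<^sup>* = a x x\<^sup>* a\<^sup>* = 0\<close>.\<close>

lemma conv_conv_star_eq_0:
  assumes "a \<star> x \<in> GA" "a \<star> x \<star> star x = 0"
  shows "a \<star> x = 0"
  using conv_star_eq_0[OF assms(1)] assms(2) by (simp add: star_conv conv_assoc[symmetric])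

definition left_ideal :: "('a \<Rightarrow> complex) \<Rightarrow> ('a \<Rightarrow> complex) set" where
  "left_ideal x = (\<lambda>f. f \<star> x) ` GA"

lemma left_ideal_subset: "left_ideal x \<subseteq> GA"
  by (auto simp: left_ideal_def)

lemma subspace_GA: "cfun.subspace GA"
  by (auto simp: cfun.subspace_def group_algebra_simps)

lemma GA_span: "GA \<subseteq> cfun.span (delta ` carrier G)"
proof
  fix f assume f: "f \<in> GA"
  have "f = (\<Sum>g\<in>carrier G. scl (f g) (delta g))"
  proof
    fix x
    have "(\<Sum>g\<in>carrier G. f g * delta g x) = (\<Sum>g\<in>carrier G. if g = x then f g else 0)"
      by (intro sum.cong) (auto simp: delta_def)
    also have "\<dots> = f x" using f by (simp add: fin group_algebra_simps)
    finally show "f x = (\<Sum>g\<in>carrier G. scl (f g) (delta g)) x" by (simp add: sum_fun_apply)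
  qed
  also have "\<dots> \<in> cfun.span (delta ` carrier G)"
    by (intro cfun.span_sum cfun.span_scale cfun.span_base) auto
  finally show "f \<in> cfun.span (delta ` carrier G)" .
qed

lemma subspace_left_ideal: "cfun.subspace (left_ideal x)"
proof -
  interpret R: module_hom "\<lambda>c f x. c * f x" "\<lambda>c f x. c * f x" "\<lambda>f. f \<star> x" by (rule linear_conv_right)
  show ?thesis unfolding left_ideal_def by (rule R.subspace_image[OF subspace_GA])
qed

lemma inj_on_subspaceI:
  assumes "clinear_fun \<phi>" "cfun.subspace V" "\<And>v. v \<in> V \<Longrightarrow> \<phi> v = 0 \<Longrightarrow> v = 0"
  shows "inj_on \<phi> V"
proof -
  interpret \<phi>: module_hom "\<lambda>c f x. c * f x" "\<lambda>c f x. c * f x" \<phi> by (rule assms)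
  show ?thesis
  proof (rule inj_onI)
    fix x y assume "x \<in> V" "y \<in> V" "\<phi> x = \<phi> y"
    then show "x = y"
      using assms(3)[of "x - y"] cfun.subspace_diff[OF assms(2), of x y] \<phi>.diff[of x y] by simp
  qed
qed

text \<open>For a linear character \<open>s\<close> of the group, this is the algebra automorphism \<open>g \<mapsto> s(g) g\<close>.\<close>

definition twist :: "('a \<Rightarrow> complex) \<Rightarrow> ('a \<Rightarrow> complex) \<Rightarrow> 'a \<Rightarrow> complex" where
  "twist s f = (\<lambda>g. s g * f g)"

lemma twist_conv:
  assumes "\<And>y z. y \<in> carrier G \<Longrightarrow> z \<in> carrier G \<Longrightarrow> s (y \<otimes> z) = s y * s z"
  shows "twist s (f \<star> h) = twist s f \<star> twist s h"
  unfolding group_algebra_mult[OF fin] twist_def sum_distrib_left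
  by (intro ext sum.cong refl) (auto simp: assms)

text \<open>Right multiplication by \<open>x\<^sup>*\<close> embeds \<open>A x\<close> into \<open>A x\<^sup>*\<close> as a left module, and right
  multiplication by \<open>x\<close> embeds \<open>A x\<^sup>*\<close> into \<open>A x\<close>, so these ideals are isomorphic. The twist by \<open>s\<close>
  makes the isomorphism equivariant up to \<open>s\<close>, and right multiplication by \<open>u\<^sup>-\<^sup>1\<close> identifies
  \<open>A z\<close> with \<open>A u z u\<^sup>-\<^sup>1\<close>. Symmetry of the argument in \<open>x\<close> and \<open>x\<^sup>*\<close> replaces the usual
  computation that a Young symmetrizer is idempotent up to a non-zero scalar.\<close>

theorem trace_left_ideal_twist:
  assumes s: "\<And>y z. y \<in> carrier G \<Longrightarrow> z \<in> carrier G \<Longrightarrow> s (y \<otimes> z) = s y * s z"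
    "\<And>y. y \<in> carrier G \<Longrightarrow> s y * s y = 1"
    and x: "x \<in> GA" and u: "u \<in> carrier G" and p: "p \<in> carrier G"
  defines "y \<equiv> delta u \<star> twist s (star x) \<star> delta (inv u)"
  shows "trace_on (left_ideal y) (\<lambda>f. delta p \<star> f) = s p * trace_on (left_ideal x) (\<lambda>f. delta p \<star> f)"
proof -
  note tw = twist_conv[of s, OF s(1)]
  have tw_closed: "twist s f \<in> GA" if "f \<in> GA" for f
    using that by (auto simp: twist_def group_algebra_simps)
  have twtw: "twist s (twist s f) = f" if "f \<in> GA" for f
  proof
    fix g
    show "twist s (twist s f) g = f g"
      using that s(2)[of g] by (cases "g \<in> carrier G") (simp_all add: twist_def group_algebra_simps flip: mult.assoc)
  qed
  have tw0: "f = 0" if "twist s f = 0" "f \<in> GA" for f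
  proof -
    have "f = twist s 0" using twtw[OF that(2)] that(1) by simp
    then show ?thesis by (simp add: twist_def fun_eq_iff)
  qed
  have u': "inv u \<in> carrier G" using u by simp
  (* phi is the isomorphism of the ideals up to the twist; psi is only needed to compare dimensions. *)
  let ?\<phi> = "\<lambda>f. twist s (f \<star> star x) \<star> delta (inv u)"
  let ?\<psi> = "\<lambda>f. twist s (f \<star> delta u) \<star> x"
  have lin_twist: "clinear_fun (twist s)"
    by (intro clinear_funI) (auto simp: twist_def fun_eq_iff algebra_simps)
  have lin: "clinear_fun ?\<phi>" "clinear_fun ?\<psi>"
    using module_hom_compose[OF module_hom_compose[OF linear_conv_right[of "star x"] lin_twist]
        linear_conv_right[of "delta (inv u)"]]
      module_hom_compose[OF module_hom_compose[OF linear_conv_right[of "delta u"] lin_twist]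
        linear_conv_right[of x]]
    by (simp_all only: o_def)
  have inv_p: "(\<lambda>f. delta p \<star> f) ` left_ideal z \<subseteq> left_ideal z" for z
    by (auto simp: left_ideal_def conv_assoc[symmetric])
  have ker\<phi>: "v = 0" if v: "v \<in> left_ideal x" "?\<phi> v = 0" for v
  proof -
    obtain a where a: "a \<in> GA" "v = a \<star> x" using v by (auto simp: left_ideal_def)
    have "twist s (v \<star> star x) = ?\<phi> v \<star> delta u"
      using conv_inverse_deltas(2)[OF u tw_closed[OF conv_closed]] by simp
    then have "twist s (v \<star> star x) = 0" using v(2) by simp
    then have "v \<star> star x = 0" by (rule tw0) simp_all
    then show ?thesis using a conv_conv_star_eq_0[of a x] by simp
  qed
  have y_u: "a \<star> y \<star> delta u = a \<star> delta u \<star> twist s (star x)" for a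
    unfolding y_def using conv_inverse_deltas(2)[OF u conv_closed] by (simp add: conv_assoc)
  have ker\<psi>: "v = 0" if v: "v \<in> left_ideal y" "?\<psi> v = 0" for v
  proof -
    obtain a where a: "a \<in> GA" "v = a \<star> y" using v by (auto simp: left_ideal_def)
    have eq: "twist s (v \<star> delta u) = twist s (a \<star> delta u) \<star> star x"
      by (simp add: a y_u tw twtw)
    then have "twist s (a \<star> delta u) \<star> star x \<star> star (star x) = 0" using v(2) x by (simp add: star_star)
    then have "twist s (v \<star> delta u) = 0" using conv_conv_star_eq_0[of "twist s (a \<star> delta u)" "star x"] eq by simp
    then have "v \<star> delta u = 0" by (rule tw0) simp_all
    then have "v \<star> delta u \<star> delta (inv u) = 0" by simp
    then show ?thesis using conv_inverse_deltas(1)[OF u, of v] v(1) left_ideal_subset[of y] by auto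
  qed
  show ?thesis
  proof (rule trace_on_transport[where \<phi> = ?\<phi> and \<psi> = ?\<psi> and D = "delta ` carrier G" and E = "delta ` carrier G"])
    show "?\<phi> ` left_ideal x \<subseteq> left_ideal y"
    proof clarsimp
      fix v assume "v \<in> left_ideal x"
      then obtain a where a: "a \<in> GA" "v = a \<star> x" by (auto simp: left_ideal_def)
      have "?\<phi> v = (twist s a \<star> twist s x \<star> delta (inv u)) \<star> y"
        using conv_inverse_deltas(2)[OF u conv_closed, of "twist s a" "twist s x"]
        unfolding y_def by (simp add: a tw conv_assoc[symmetric])
      then show "?\<phi> v \<in> left_ideal y" by (simp add: left_ideal_def)
    qed
    show "?\<psi> ` left_ideal y \<subseteq> left_ideal x"
      by (auto simp: left_ideal_def y_u intro!: imageI tw_closed)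
    show "delta p \<star> ?\<phi> v = scl (s p) (?\<phi> (delta p \<star> v))" for v
    proof -
      have "twist s (delta p) = scl (s p) (delta p)" by (auto simp: twist_def delta_def)
      then have "?\<phi> (delta p \<star> v) = scl (s p) (delta p \<star> ?\<phi> v)"
        by (simp add: tw conv_linear conv_assoc)
      then show ?thesis using s(2)[OF p] by (simp add: fun_eq_iff mult.assoc[symmetric])
    qed
    show "left_ideal x \<subseteq> cfun.span (delta ` carrier G)" "left_ideal y \<subseteq> cfun.span (delta ` carrier G)"
      using left_ideal_subset GA_span by blast+
    show "inj_on ?\<phi> (left_ideal x)" by (rule inj_on_subspaceI[OF lin(1) subspace_left_ideal ker\<phi>])
    show "inj_on ?\<psi> (left_ideal y)" by (rule inj_on_subspaceI[OF lin(2) subspace_left_ideal ker\<psi>])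
  qed (rule lin linear_conv_left subspace_left_ideal inv_p finite_imageI fin)+
qed

end

section \<open>Conjugate partitions and Specht modules\<close>

definition diagram :: "nat list \<Rightarrow> (nat \<times> nat) set" where
  "diagram \<alpha> = (SIGMA r:{..<length \<alpha>}. {..<\<alpha> ! r})"

text \<open>The entry of the row reading tableau in row \<open>r\<close> and column \<open>c\<close>; rows and columns are counted
  from 0, entries from 1.\<close>

definition tableau_entry :: "nat list \<Rightarrow> nat \<times> nat \<Rightarrow> nat" where
  "tableau_entry \<alpha> = (\<lambda>(r, c). sum_list (take r \<alpha>) + c + 1)"

lemma sum_list_take_mono: "r \<le> r' \<Longrightarrow> sum_list (take r \<alpha>) \<le> sum_list (take r' (\<alpha> :: nat list))"
  using take_add[of r "r' - r" \<alpha>] by simp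

lemma tableau_entry_coords:
  assumes "(r, c) \<in> diagram \<alpha>"
  shows "tableau_row \<alpha> (tableau_entry \<alpha> (r, c)) = r" "tableau_col \<alpha> (tableau_entry \<alpha> (r, c)) = c"
    "tableau_entry \<alpha> (r, c) \<in> {1..sum_list \<alpha>}"
proof -
  let ?k = "tableau_entry \<alpha> (r, c)"
  have r: "r < length \<alpha>" "c < \<alpha> ! r" using assms by (auto simp: diagram_def)
  have S: "sum_list (take (Suc r) \<alpha>) = sum_list (take r \<alpha>) + \<alpha> ! r"
    using r by (simp add: take_Suc_conv_app_nth)
  show row: "tableau_row \<alpha> ?k = r" unfolding tableau_row_def
  proof (rule Least_equality)
    show "?k \<le> sum_list (take (Suc r) \<alpha>)" using S r by (simp add: tableau_entry_def)
    fix y assume y: "?k \<le> sum_list (take (Suc y) \<alpha>)"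
    show "r \<le> y"
    proof (rule ccontr)
      assume "\<not> r \<le> y"
      then have "sum_list (take (Suc y) \<alpha>) \<le> sum_list (take r \<alpha>)" by (intro sum_list_take_mono) simp
      then show False using y by (simp add: tableau_entry_def)
    qed
  qed
  show "tableau_col \<alpha> ?k = c" unfolding tableau_col_def row by (simp add: tableau_entry_def)
  have "sum_list (take (Suc r) \<alpha>) \<le> sum_list \<alpha>"
    using sum_list_take_mono[of "Suc r" "length \<alpha>" \<alpha>] r by simp
  then show "?k \<in> {1..sum_list \<alpha>}" using S r by (simp add: tableau_entry_def)
qed

lemma card_diagram: "card (diagram \<alpha>) = sum_list \<alpha>"
  by (simp add: diagram_def sum_list_sum_nth lessThan_atLeast0)

text \<open>Injectivity holds since row and column can be recovered from the entry; then the image is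
  everything by counting.\<close>

lemma bij_tableau_entry: "bij_betw (tableau_entry \<alpha>) (diagram \<alpha>) {1..sum_list \<alpha>}"
proof -
  have inj: "inj_on (tableau_entry \<alpha>) (diagram \<alpha>)"
  proof (rule inj_onI)
    fix x y assume "x \<in> diagram \<alpha>" "y \<in> diagram \<alpha>" "tableau_entry \<alpha> x = tableau_entry \<alpha> y"
    then show "x = y"
      using tableau_entry_coords[of "fst x" "snd x" \<alpha>] tableau_entry_coords[of "fst y" "snd y" \<alpha>]
      by (simp add: prod_eq_iff)
  qed
  have "tableau_entry \<alpha> ` diagram \<alpha> \<subseteq> {1..sum_list \<alpha>}" using tableau_entry_coords(3) by auto
  then have "tableau_entry \<alpha> ` diagram \<alpha> = {1..sum_list \<alpha>}"
    by (intro card_subset_eq) (auto simp: card_image[OF inj] card_diagram)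
  then show ?thesis using inj by (simp add: bij_betw_def)
qed

lemma nth_gt_iff_less_length_filter:
  assumes "sorted_wrt (\<ge>) \<alpha>" "r < length \<alpha>"
  shows "c < \<alpha> ! r \<longleftrightarrow> r < length (filter (\<lambda>p. c < p) (\<alpha> :: nat list))"
  using assms
proof (induction \<alpha> arbitrary: r)
  case (Cons a \<alpha>)
  show ?case
  proof (cases r)
    case 0
    show ?thesis
    proof (cases "c < a")
      case False
      then have "filter (\<lambda>p. c < p) \<alpha> = []" using Cons.prems by (auto simp: filter_empty_conv)
      then show ?thesis using 0 False by simp
    qed (simp add: 0)
  next
    case (Suc r')
    then have r': "r' < length \<alpha>" using Cons.prems by simp
    show ?thesis
    proof (cases "c < a")
      case False
      then have "filter (\<lambda>p. c < p) \<alpha> = []" using Cons.prems by (auto simp: filter_empty_conv)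
      moreover have "\<alpha> ! r' \<le> a" using Cons.prems r' by simp
      ultimately show ?thesis using Suc False by simp
    qed (use Cons r' Suc in simp)
  qed
qed simp

lemma diagram_conjugate:
  assumes "is_partition \<alpha>"
  shows "(c, r) \<in> diagram (conjugate_partition \<alpha>) \<longleftrightarrow> (r, c) \<in> diagram \<alpha>"
proof -
  have s: "sorted_wrt (\<ge>) \<alpha>" using assms by (simp add: is_partition_def)
  have hd: "\<alpha> ! r \<le> hd \<alpha>" if "r < length \<alpha>" using s that by (cases \<alpha>; cases r) auto
  have len: "r < length \<alpha>" if "r < length (filter (\<lambda>p. c < p) \<alpha>)"
    using that by (rule order.strict_trans2) simp
  have "(c, r) \<in> diagram (conjugate_partition \<alpha>) \<longleftrightarrow>
      \<alpha> \<noteq> [] \<and> c < hd \<alpha> \<and> r < length (filter (\<lambda>p. c < p) \<alpha>)"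
    by (auto simp: diagram_def conjugate_partition_def)
  also have "\<dots> \<longleftrightarrow> r < length \<alpha> \<and> c < \<alpha> ! r"
    using nth_gt_iff_less_length_filter[OF s, of r c] hd len
    by (cases "r < length \<alpha>") auto
  finally show ?thesis by (auto simp: diagram_def)
qed

lemma bij_swap_diagram:
  assumes "is_partition \<alpha>"
  shows "bij_betw prod.swap (diagram \<alpha>) (diagram (conjugate_partition \<alpha>))"
  by (rule bij_betw_byWitness[where f' = prod.swap]) (use diagram_conjugate[OF assms] in auto)

lemma sum_list_conjugate: "is_partition \<alpha> \<Longrightarrow> sum_list (conjugate_partition \<alpha>) = sum_list \<alpha>"
  using bij_betw_same_card[OF bij_swap_diagram] by (simp add: card_diagram)

text \<open>The permutation \<open>\<pi>\<close> carries the transposed tableau of \<open>\<alpha>\<close>, which is filled column by column, to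
  the row reading tableau of the conjugate shape.\<close>

lemma tableau_transposition:
  assumes "is_partition \<alpha>"
  obtains \<pi> where "\<pi> permutes {1..sum_list \<alpha>}"
    "\<And>k. k \<in> {1..sum_list \<alpha>} \<Longrightarrow> tableau_row (conjugate_partition \<alpha>) (\<pi> k) = tableau_col \<alpha> k"
    "\<And>k. k \<in> {1..sum_list \<alpha>} \<Longrightarrow> tableau_col (conjugate_partition \<alpha>) (\<pi> k) = tableau_row \<alpha> k"
proof -
  let ?N = "{1..sum_list \<alpha>}" and ?\<beta> = "conjugate_partition \<alpha>"
  define g where "g = tableau_entry ?\<beta> \<circ> prod.swap \<circ> inv_into (diagram \<alpha>) (tableau_entry \<alpha>)"
  define \<pi> where "\<pi> k = (if k \<in> ?N then g k else k)" for k
  have "bij_betw g ?N ?N"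
    unfolding g_def
    using bij_betw_trans[OF bij_betw_inv_into[OF bij_tableau_entry[of \<alpha>]]
        bij_betw_trans[OF bij_swap_diagram[OF assms] bij_tableau_entry[of ?\<beta>]]]
    by (simp add: sum_list_conjugate[OF assms] comp_assoc)
  then have "bij_betw \<pi> ?N ?N" by (subst bij_betw_cong[of _ _ g]) (auto simp: \<pi>_def)
  then have perm: "\<pi> permutes ?N" by (rule bij_imp_permutes) (auto simp: \<pi>_def)
  have co: "tableau_row ?\<beta> (\<pi> k) = tableau_col \<alpha> k \<and> tableau_col ?\<beta> (\<pi> k) = tableau_row \<alpha> k"
    if k: "k \<in> ?N" for k
  proof -
    obtain r c where rc: "(r, c) \<in> diagram \<alpha>" "k = tableau_entry \<alpha> (r, c)"
      using bij_betw_imp_surj_on[OF bij_tableau_entry[of \<alpha>]] k by (metis imageE surj_pair)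
    then have "\<pi> k = tableau_entry ?\<beta> (c, r)"
      using k bij_tableau_entry[of \<alpha>] by (simp add: \<pi>_def g_def bij_betw_def)
    then show ?thesis
      using tableau_entry_coords[of r c \<alpha>] tableau_entry_coords[of c r ?\<beta>] rc diagram_conjugate[OF assms] by simp
  qed
  show thesis by (rule that[OF perm]) (use co in auto)
qed

lemma (in finite_group) conv_delta_apply:
  assumes "u \<in> carrier G" "x \<in> carrier G"
  shows "(delta u \<star> f) x = f (inv u \<otimes> x)" "(f \<star> delta u) x = f (x \<otimes> inv u)"
proof -
  have eq: "u \<otimes> z = x \<longleftrightarrow> z = inv u \<otimes> x" "z \<otimes> u = x \<longleftrightarrow> z = x \<otimes> inv u" if "z \<in> carrier G" for z
    using that assms by (auto simp: m_assoc inv_solve_left inv_solve_right)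
  have "(delta u \<star> f) x = (\<Sum>y\<in>carrier G. if y = u then (\<Sum>z\<in>carrier G. if y \<otimes> z = x then f z else 0) else 0)"
    unfolding group_algebra_mult[OF fin] by (intro sum.cong refl) (auto simp: delta_def intro!: sum.neutral sum.cong)
  also have "\<dots> = (\<Sum>z\<in>carrier G. if z = inv u \<otimes> x then f z else 0)"
    using assms by (simp add: fin eq cong: sum.cong if_cong)
  finally show "(delta u \<star> f) x = f (inv u \<otimes> x)" using assms by (simp add: fin)
  have "(f \<star> delta u) x = (\<Sum>y\<in>carrier G. \<Sum>z\<in>carrier G. if z = u then (if y \<otimes> u = x then f y else 0) else 0)"
    unfolding group_algebra_mult[OF fin] by (intro sum.cong refl) (auto simp: delta_def)
  also have "\<dots> = (\<Sum>y\<in>carrier G. if y = x \<otimes> inv u then f y else 0)"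
    using assms by (simp add: fin eq cong: sum.cong if_cong)
  finally show "(f \<star> delta u) x = f (x \<otimes> inv u)" using assms by (simp add: fin)
qed

lemma finite_group_sym: "finite_group (sym_group n)"
  unfolding finite_group_def finite_group_axioms_def
  using sym_group_is_group finite_permutations[of "{1..n}"] by (simp add: sym_group_def)

text \<open>Conjugation by the transposing permutation \<open>\<pi>\<close> exchanges row and column stabilisers. So the
  row symmetrizer of the conjugate shape is the conjugate of the sign twist of the column
  antisymmetrizer of \<open>\<alpha>\<close>, and vice versa. Both are fixed by the anti-involution, which reverses their
  product; hence the Young symmetrizer of the conjugate shape has the form that is
  required by \<open>trace_left_ideal_twist\<close>.\<close>

theorem sym_char_conjugate:
  assumes part: "is_partition \<alpha>" and p: "p permutes {1..sum_list \<alpha>}"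
  shows "sym_char (conjugate_partition \<alpha>) p = of_int (sign p) * sym_char \<alpha> p"
proof -
  let ?n = "sum_list \<alpha>" and ?\<beta> = "conjugate_partition \<alpha>"
  let ?N = "{1..?n}"
  define S where "S = sym_group ?n"
  interpret S: finite_group S unfolding S_def by (rule finite_group_sym)
  define s :: "(nat \<Rightarrow> nat) \<Rightarrow> complex" where "s q = of_int (sign q)" for q
  have carr: "q \<in> carrier S \<longleftrightarrow> q permutes ?N" for q by (simp add: S_def sym_group_def)
  have mult: "q \<otimes>\<^bsub>S\<^esub> r = q \<circ> r" for q r by (simp add: S_def sym_group_def)
  have inv_S: "inv\<^bsub>S\<^esub> q = inv' q" if "q permutes ?N" for q
    using sym_group_inv_equality[of q ?n] that by (simp add: S_def sym_group_def)
  have perm: "permutation q" if "q permutes ?N" for q using that permutation_permutes by blast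
  have s_mult: "s (q \<otimes>\<^bsub>S\<^esub> r) = s q * s r" if "q \<in> carrier S" "r \<in> carrier S" for q r
    using that by (simp add: carr mult s_def sign_compose perm)
  have s_sq: "s q * s q = 1" if "q \<in> carrier S" for q
    unfolding s_def by (metis of_int_1 of_int_mult sign_idempotent)
  let ?a = "row_symmetrizer \<alpha>" and ?b = "column_antisymmetrizer \<alpha>"
  have pres: "(\<forall>k\<in>?N. t (inv' q k) = t k) \<longleftrightarrow> (\<forall>k\<in>?N. t (q k) = t k)" if q: "q permutes ?N" for q and t :: "nat \<Rightarrow> nat"
  proof -
    have "t (q k) = t k" if "\<forall>k\<in>?N. t (inv' q k) = t k" "k \<in> ?N" for k
      using that permutes_in_image[OF q, of k] permutes_inverses(2)[OF q, of k] by metis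
    moreover have "t (inv' q k) = t k" if "\<forall>k\<in>?N. t (q k) = t k" "k \<in> ?N" for k
      using that permutes_in_image[OF permutes_inv[OF q], of k] permutes_inverses(1)[OF q, of k] by metis
    ultimately show ?thesis by blast
  qed
  have star_a: "S.star ?a = ?a"
  proof
    fix q show "S.star ?a q = ?a q"
      using pres[of q "tableau_row \<alpha>"] permutes_inv[of q ?N]
      by (cases "q permutes ?N") (simp_all add: S.star_def carr inv_S row_symmetrizer_def)
  qed
  have star_b: "S.star ?b = ?b"
  proof
    fix q show "S.star ?b q = ?b q"
      using pres[of q "tableau_col \<alpha>"] permutes_inv[of q ?N]
      by (cases "q permutes ?N")
        (simp_all add: S.star_def carr inv_S column_antisymmetrizer_def sign_inverse perm)
  qed
  obtain \<pi> where \<pi>: "\<pi> permutes ?N" "\<And>k. k \<in> ?N \<Longrightarrow> tableau_row ?\<beta> (\<pi> k) = tableau_col \<alpha> k"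
    "\<And>k. k \<in> ?N \<Longrightarrow> tableau_col ?\<beta> (\<pi> k) = tableau_row \<alpha> k"
    using tableau_transposition[OF part] by blast
  have \<pi>S: "\<pi> \<in> carrier S" using \<pi>(1) by (simp add: carr)
  have inv\<pi>: "inv\<^bsub>S\<^esub> \<pi> = inv' \<pi>" by (rule inv_S[OF \<pi>(1)])
  (* Conjugation by pi. *)
  define c where "c f = (delta \<pi> \<otimes>\<^bsub>group_algebra S\<^esub> f) \<otimes>\<^bsub>group_algebra S\<^esub> delta (inv\<^bsub>S\<^esub> \<pi>)" for f
  have c_apply: "c f q = (if q permutes ?N then f (inv' \<pi> \<circ> q \<circ> \<pi>) else 0)" for f q
  proof (cases "q permutes ?N")
    case True
    then have q: "q \<in> carrier S" "q \<otimes>\<^bsub>S\<^esub> \<pi> \<in> carrier S" using \<pi>S by (simp_all only: carr[symmetric] S.m_closed)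
    have "c f q = f (inv\<^bsub>S\<^esub> \<pi> \<otimes>\<^bsub>S\<^esub> (q \<otimes>\<^bsub>S\<^esub> \<pi>))"
      using S.conv_delta_apply(2)[OF S.inv_closed[OF \<pi>S] q(1)] S.conv_delta_apply(1)[OF \<pi>S q(2)] \<pi>S
      by (simp add: c_def)
    then show ?thesis using True by (simp add: inv\<pi> mult comp_assoc)
  next
    case False
    have "c f \<in> S.GA" unfolding c_def by simp
    then show ?thesis using False by (simp add: group_algebra_simps carr)
  qed
  have c_mult: "c (f \<otimes>\<^bsub>group_algebra S\<^esub> h) = c f \<otimes>\<^bsub>group_algebra S\<^esub> c h" for f h
  proof -
    have "f \<otimes>\<^bsub>group_algebra S\<^esub> h = f \<otimes>\<^bsub>group_algebra S\<^esub> (delta (inv\<^bsub>S\<^esub> \<pi>) \<otimes>\<^bsub>group_algebra S\<^esub> (delta \<pi> \<otimes>\<^bsub>group_algebra S\<^esub> h))" (is "?l = ?r")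
      if "h \<in> S.GA" for f h
      using that \<pi>S by (simp add: S.conv_assoc[symmetric] S.conv_delta S.delta_one_conv)
    note * = this
    show ?thesis unfolding c_def using *[of "h \<otimes>\<^bsub>group_algebra S\<^esub> delta (inv\<^bsub>S\<^esub> \<pi>)" f]
      by (simp add: S.conv_assoc)
  qed
  have conj_perm: "inv' \<pi> \<circ> q \<circ> \<pi> permutes ?N" if "q permutes ?N" for q
    by (intro permutes_compose \<pi>(1) permutes_inv that)
  have conj_pres: "(\<forall>k\<in>?N. t ((inv' \<pi> \<circ> q \<circ> \<pi>) k) = t k) \<longleftrightarrow> (\<forall>k\<in>?N. t' (q k) = t' k)"
    if q: "q permutes ?N" and t: "\<And>k. k \<in> ?N \<Longrightarrow> t' (\<pi> k) = t k" for q and t t' :: "nat \<Rightarrow> nat"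
  proof -
    have t2: "t (inv' \<pi> k) = t' k" if "k \<in> ?N" for k
      using t[of "inv' \<pi> k"] that permutes_in_image[OF permutes_inv[OF \<pi>(1)], of k]
        permutes_inverses(1)[OF \<pi>(1), of k] by simp
    have "(\<forall>k\<in>?N. t ((inv' \<pi> \<circ> q \<circ> \<pi>) k) = t k) \<longleftrightarrow> (\<forall>k\<in>?N. t' (q (\<pi> k)) = t' (\<pi> k))"
      using t t2 permutes_in_image[OF q] permutes_in_image[OF \<pi>(1)] by auto
    also have "\<dots> \<longleftrightarrow> (\<forall>k\<in>\<pi> ` ?N. t' (q k) = t' k)" by blast
    finally show ?thesis unfolding permutes_image[OF \<pi>(1)] .
  qed
  have sign_conj: "sign (inv' \<pi> \<circ> q \<circ> \<pi>) = sign q" if q: "q permutes ?N" for q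
    using perm[OF q] perm[OF \<pi>(1)] permutation_inverse[OF perm[OF \<pi>(1)]]
    by (simp add: sign_compose permutation_compose sign_inverse)
  have sl: "sum_list ?\<beta> = ?n" by (rule sum_list_conjugate[OF part])
  have rowc: "row_symmetrizer ?\<beta> = c (S.twist s ?b)"
  proof
    fix q show "row_symmetrizer ?\<beta> q = c (S.twist s ?b) q"
    proof (cases "q permutes ?N")
      case True
      then show ?thesis
        using conj_pres[OF True, of "tableau_row ?\<beta>" "tableau_col \<alpha>"] \<pi>(2) conj_perm[OF True] s_sq[of q]
        by (simp add: c_apply row_symmetrizer_def column_antisymmetrizer_def S.twist_def sl s_def sign_conj carr)
    qed (simp add: c_apply row_symmetrizer_def sl)
  qed
  have colc: "column_antisymmetrizer ?\<beta> = c (S.twist s ?a)"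
  proof
    fix q show "column_antisymmetrizer ?\<beta> q = c (S.twist s ?a) q"
    proof (cases "q permutes ?N")
      case True
      then show ?thesis
        using conj_pres[OF True, of "tableau_col ?\<beta>" "tableau_row \<alpha>"] \<pi>(3) conj_perm[OF True]
        by (simp add: c_apply row_symmetrizer_def column_antisymmetrizer_def S.twist_def sl s_def sign_conj)
    qed (simp add: c_apply column_antisymmetrizer_def sl)
  qed
  have y: "young_symmetrizer ?\<beta> = c (S.twist s (S.star (young_symmetrizer \<alpha>)))"
    by (simp add: young_symmetrizer_def sl rowc colc c_mult S.twist_conv[of s, OF s_mult] S.star_conv star_a star_b
        flip: S_def)
  have x: "young_symmetrizer \<alpha> \<in> S.GA"
    unfolding young_symmetrizer_def S_def[symmetric] by simp
  have ideal: "specht_module \<gamma> = S.left_ideal (young_symmetrizer \<gamma>)" if "sum_list \<gamma> = ?n" for \<gamma>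
    using that by (simp add: specht_module_def S.left_ideal_def Let_def flip: S_def)
  have pS: "p \<in> carrier S" using p by (simp add: carr)
  have "trace_on (specht_module ?\<beta>) (\<lambda>f. delta p \<otimes>\<^bsub>group_algebra S\<^esub> f) =
      s p * trace_on (specht_module \<alpha>) (\<lambda>f. delta p \<otimes>\<^bsub>group_algebra S\<^esub> f)"
    unfolding ideal[OF sl] ideal[OF refl] y c_def
    by (rule S.trace_left_ideal_twist[OF s_mult s_sq x \<pi>S pS])
  then show ?thesis using pS by (simp add: sym_char_def Let_def sl s_def flip: S_def)
qed

section \<open>Inversions of permutations\<close>

text \<open>The transposition \<open>(i j+1)\<close> is \<open>(j j+1) (i j) (j j+1)\<close>, so that all transpositions are products
  of adjacent ones. Multiplication is on the right, as in the cocycle identity for \<open>w s\<^sub>i\<close>.\<close>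

lemma adjacent_transposition_induct [consumes 1, case_names id step]:
  assumes p: "p permutes {l..<h::nat}"
    and id: "P id"
    and step: "\<And>p i. p permutes {l..<h} \<Longrightarrow> P p \<Longrightarrow> l \<le> i \<Longrightarrow> Suc i < h \<Longrightarrow> P (p \<circ> transpose i (Suc i))"
  shows "P p"
proof -
  (* Q consists of the q by which P may be extended on the right; it is closed under composition. *)
  define Q where "Q q \<longleftrightarrow> q permutes {l..<h} \<and> (\<forall>p. p permutes {l..<h} \<longrightarrow> P p \<longrightarrow> P (p \<circ> q))" for q
  have Q_id: "Q id" by (simp add: Q_def permutes_id)
  have Q_comp: "Q (q \<circ> r)" if "Q q" "Q r" for q r
    using that permutes_compose unfolding Q_def by (metis comp_assoc)
  have Q_adj: "Q (transpose i (Suc i))" if "l \<le> i" "Suc i < h" for i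
    using that step by (auto simp: Q_def permutes_swap_id)
  have Q_swap: "Q (transpose i (i + d))" if "l \<le> i" "i + d < h" for i d
    using that
  proof (induction d)
    case (Suc d)
    show ?case
    proof (cases "d = 0")
      case False
      have "transpose i (i + Suc d) =
          transpose (i + d) (Suc (i + d)) \<circ> transpose i (i + d) \<circ> transpose (i + d) (Suc (i + d))"
        using False by (auto simp: fun_eq_iff transpose_def)
      moreover have "Q \<dots>" using Suc.IH Suc.prems by (intro Q_comp Q_adj) auto
      ultimately show ?thesis by (simp only:)
    qed (use Suc.prems Q_adj[of i] in simp)
  qed (simp add: Q_id flip: id_def)
  have Q_swap': "Q (transpose a b)" if "a \<in> {l..<h}" "b \<in> {l..<h}" for a b
    using that Q_swap[of a "b - a"] Q_swap[of b "a - b"] by (cases "a \<le> b") (auto simp: transpose_commute)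
  have "Q p" using p finite_atLeastLessThan
    by (induction rule: permutes_induct) (blast intro: Q_comp Q_swap' Q_id)+
  then have "P (id \<circ> p)" using id permutes_id unfolding Q_def by blast
  then show ?thesis by (simp only: id_comp)
qed

definition pairs :: "nat set \<Rightarrow> nat set set" where
  "pairs A = {e. e \<subseteq> A \<and> card e = 2}"

text \<open>With \<open>c = -1\<close> this is the sign of a permutation of \<open>A\<close>; the cocycle below is another instance. A
  product over two-element sets, rather than over ordered pairs, can be reindexed by a permutation.\<close>

definition inversion_weight :: "(nat \<Rightarrow> nat \<Rightarrow> complex) \<Rightarrow> (nat \<Rightarrow> nat) \<Rightarrow> nat set \<Rightarrow> complex" where
  "inversion_weight c p A = (\<Prod>e\<in>pairs A. if p (Max e) < p (Min e) then c (Min e) (Max e) else 1)"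

lemma pairs_cases:
  assumes "e \<in> pairs A"
  obtains i j where "i < j" "e = {i, j}" "i \<in> A" "j \<in> A" "Min e = i" "Max e = j"
proof -
  obtain x y where xy: "e = {x, y}" "x \<noteq> y" using assms by (auto simp: pairs_def card_2_iff)
  show thesis
  proof (cases "x < y")
    case True
    then show ?thesis using xy assms by (intro that[of x y]) (auto simp: pairs_def)
  next
    case False
    then show ?thesis using xy assms by (intro that[of y x]) (auto simp: pairs_def)
  qed
qed

lemma finite_pairs: "finite A \<Longrightarrow> finite (pairs A)"
  by (auto simp: pairs_def)

lemma bij_betw_pairs:
  assumes "bij_betw q A B"
  shows "bij_betw ((`) q) (pairs A) (pairs B)"
proof -
  have inj: "inj_on q A" and im: "q ` A = B" using assms by (auto simp: bij_betw_def)
  have "(`) q ` pairs A = pairs B"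
  proof (intro equalityI subsetI)
    fix e assume "e \<in> pairs B"
    then have e: "e \<subseteq> q ` A" "card e = 2" using im by (auto simp: pairs_def)
    obtain d where d: "d \<subseteq> A" "e = q ` d" using e(1) by (auto simp: subset_image_iff)
    then have "card d = 2" using e(2) inj by (metis card_image inj_on_subset)
    then show "e \<in> (`) q ` pairs A" using d by (auto simp: pairs_def)
  next
    fix e assume "e \<in> (`) q ` pairs A"
    then obtain d where d: "d \<subseteq> A" "card d = 2" "e = q ` d" by (auto simp: pairs_def)
    then have "card e = 2" using inj by (metis card_image inj_on_subset)
    then show "e \<in> pairs B" using d im by (auto simp: pairs_def)
  qed
  moreover have "inj_on ((`) q) (pairs A)"
    using inj by (intro inj_onI) (auto simp: pairs_def inj_on_image_eq_iff)
  ultimately show ?thesis by (simp add: bij_betw_def)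
qed

text \<open>For a single pair, the factor of \<open>p \<circ> q\<close> is the factor of \<open>q\<close> at that pair times the factor of
  \<open>p\<close> at its image. If \<open>p\<close> and \<open>q\<close> both invert the pair, their composition does not, and the
  two factors cancel by \<open>c i j * c j i = 1\<close>.\<close>

lemma inversion_weight_compose:
  assumes q: "bij_betw q A B" and p: "inj_on p B"
    and c: "\<And>i j. i \<in> A \<Longrightarrow> j \<in> A \<Longrightarrow> i \<noteq> j \<Longrightarrow> c' (q i) (q j) = c i j"
    and c1: "\<And>i j. i \<in> A \<Longrightarrow> j \<in> A \<Longrightarrow> i \<noteq> j \<Longrightarrow> c i j * c j i = 1"
  shows "inversion_weight c (p \<circ> q) A = inversion_weight c' p B * inversion_weight c q A"
proof -
  have "inversion_weight c' p B = (\<Prod>e\<in>pairs A. if p (Max (q ` e)) < p (Min (q ` e)) then c' (Min (q ` e)) (Max (q ` e)) else 1)"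
    unfolding inversion_weight_def by (rule prod.reindex_bij_betw[OF bij_betw_pairs[OF q], symmetric])
  moreover have "(if (p \<circ> q) (Max e) < (p \<circ> q) (Min e) then c (Min e) (Max e) else 1) =
     (if p (Max (q ` e)) < p (Min (q ` e)) then c' (Min (q ` e)) (Max (q ` e)) else 1) *
     (if q (Max e) < q (Min e) then c (Min e) (Max e) else 1)" if e: "e \<in> pairs A" for e
  proof -
    obtain i j where ij: "i < j" "e = {i, j}" "i \<in> A" "j \<in> A" "Min e = i" "Max e = j"
      using pairs_cases[OF e] by blast
    have ne: "q i \<noteq> q j" "p (q i) \<noteq> p (q j)"
      using q p ij by (auto simp: bij_betw_def inj_on_def dest: less_imp_neq)
    show ?thesis
    proof (cases "q i < q j")
      case True
      then have "Min (q ` e) = q i" "Max (q ` e) = q j" using ij(2) by auto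
      then show ?thesis using ij True ne c by (auto simp: ij(5,6))
    next
      case False
      then have "Min (q ` e) = q j" "Max (q ` e) = q i" using ij(2) ne by auto
      then show ?thesis using ij False ne c[of j i] c1[of i j] by (auto simp: ij(5,6) mult.commute)
    qed
  qed
  ultimately show ?thesis by (simp add: inversion_weight_def prod.distrib)
qed

lemma inversion_weight_mono:
  assumes "\<And>i j. i \<in> A \<Longrightarrow> j \<in> A \<Longrightarrow> i < j \<Longrightarrow> p i \<le> p j"
  shows "inversion_weight c p A = 1"
  unfolding inversion_weight_def
proof (rule prod.neutral, rule ballI)
  fix e assume "e \<in> pairs A"
  then show "(if p (Max e) < p (Min e) then c (Min e) (Max e) else 1) = 1"
    by (rule pairs_cases) (use assms in \<open>force simp: not_less\<close>)
qed

lemma inversion_weight_transpose: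
  assumes A: "finite A" "i \<in> A" "Suc i \<in> A"
  shows "inversion_weight c (transpose i (Suc i)) A = c i (Suc i)"
proof -
  let ?f = "\<lambda>e. if transpose i (Suc i) (Max e) < transpose i (Suc i) (Min e) then c (Min e) (Max e) else 1"
  have e: "{i, Suc i} \<in> pairs A" using A by (auto simp: pairs_def)
  have "inversion_weight c (transpose i (Suc i)) A = ?f {i, Suc i} * (\<Prod>e\<in>pairs A - {{i, Suc i}}. ?f e)"
    unfolding inversion_weight_def by (rule prod.remove[OF finite_pairs[OF A(1)] e])
  also have "(\<Prod>e\<in>pairs A - {{i, Suc i}}. ?f e) = 1"
  proof (rule prod.neutral, rule ballI)
    fix e assume e': "e \<in> pairs A - {{i, Suc i}}"
    then obtain a b where ab: "a < b" "e = {a, b}" "Min e = a" "Max e = b"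
      using pairs_cases[of e A] by blast
    then have "\<not> (a = i \<and> b = Suc i)" using e' by auto
    then show "?f e = 1" using ab(1) unfolding ab(3,4) by (auto simp: transpose_def)
  qed
  finally show ?thesis by simp
qed

lemma sign_inversions:
  assumes "p permutes {l..<h::nat}"
  shows "of_int (sign p) = inversion_weight (\<lambda>_ _. - 1) p {l..<h}"
  using assms
proof (induction rule: adjacent_transposition_induct)
  case id
  show ?case by (simp add: inversion_weight_mono)
next
  case (step p i)
  have t: "transpose i (Suc i) permutes {l..<h}" using step by (intro permutes_swap_id) auto
  have "inversion_weight (\<lambda>_ _. - 1) (p \<circ> transpose i (Suc i)) {l..<h} =
      inversion_weight (\<lambda>_ _. - 1) p {l..<h} * inversion_weight (\<lambda>_ _. - 1) (transpose i (Suc i)) {l..<h}"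
    by (rule inversion_weight_compose) (use t step permutes_inj in \<open>auto simp: permutes_imp_bij inj_on_def dest: injD\<close>)
  also have "\<dots> = inversion_weight (\<lambda>_ _. - 1) p {l..<h} * (- 1)"
    using step by (subst inversion_weight_transpose) auto
  also have "\<dots> = of_int (sign (p \<circ> transpose i (Suc i)))"
    using step permutation_permutes[of p]
    by (subst sign_compose) (auto simp: sign_swap_id permutation_swap_id)
  finally show ?case by (rule sym)
qed

section \<open>The cocycle\<close>

definition sgn_set :: "nat set \<Rightarrow> nat \<Rightarrow> complex" where
  "sgn_set K i = (if i \<in> K then - 1 else 1)"

text \<open>The eigenvalue of \<open>((1 - \<i>) t\<^sub>i + (1 + \<i>) t\<^sub>j) / 2\<close> on the line on which the diagonal subgroup
  acts by the character of \<open>I\<close>: it is \<open>1\<close>, \<open>-1\<close>, \<open>-\<i>\<close> or \<open>\<i>\<close> if neither, both, only \<open>j\<close>, or only \<open>i\<close>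
  belongs to \<open>I\<close>.\<close>

definition pair_factor :: "nat set \<Rightarrow> nat \<Rightarrow> nat \<Rightarrow> complex" where
  "pair_factor I i j = ((1 - \<i>) * sgn_set I i + (1 + \<i>) * sgn_set I j) / 2"

definition cocycle :: "nat \<Rightarrow> (nat \<Rightarrow> nat) \<Rightarrow> nat set \<Rightarrow> complex" where
  "cocycle n p I = inversion_weight (pair_factor I) p {..<n}"

lemma pair_factor_swap: "pair_factor I i j * pair_factor I j i = 1"
  by (auto simp: pair_factor_def sgn_set_def field_simps complex_eq_iff)

lemma pair_factor_compl: "i < n \<Longrightarrow> j < n \<Longrightarrow> pair_factor ({..<n} - I) i j = - pair_factor I i j"
  by (auto simp: pair_factor_def sgn_set_def field_simps complex_eq_iff)

lemma cocycle_compose: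
  assumes "p permutes {..<n}" "q permutes {..<n}"
  shows "cocycle n (p \<circ> q) I = cocycle n p (q ` I) * cocycle n q I"
  unfolding cocycle_def
proof (rule inversion_weight_compose)
  show "bij_betw q {..<n} {..<n}" using assms by (simp add: permutes_imp_bij)
  show "inj_on p {..<n}" using assms by (simp add: permutes_inj_on)
  have "inj q" using assms permutes_inj by blast
  then show "pair_factor (q ` I) (q i) (q j) = pair_factor I i j" for i j
    by (simp add: pair_factor_def sgn_set_def inj_image_mem_iff)
qed (rule pair_factor_swap)

lemma cocycle_id: "cocycle n id I = 1"
  by (simp add: cocycle_def inversion_weight_mono)

lemma cocycle_transpose:
  "Suc i < n \<Longrightarrow> cocycle n (transpose i (Suc i)) I = pair_factor I i (Suc i)"
  unfolding cocycle_def by (rule inversion_weight_transpose) auto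

lemma cocycle_nonzero:
  assumes "p permutes {..<n}"
  shows "cocycle n p I \<noteq> 0"
proof
  assume 0: "cocycle n p I = 0"
  have "cocycle n (inv' p \<circ> p) I = cocycle n (inv' p) (p ` I) * cocycle n p I"
    using assms by (intro cocycle_compose permutes_inv)
  then show False using 0 permutes_inv_o[OF assms] by (simp add: cocycle_id)
qed

lemma cocycle_compl:
  assumes "p permutes {..<n}"
  shows "cocycle n p ({..<n} - I) = of_int (sign p) * cocycle n p I"
proof -
  have "of_int (sign p) = inversion_weight (\<lambda>_ _. - 1) p {..<n}"
    using sign_inversions[of p 0 n] assms by (simp add: lessThan_atLeast0)
  then have "of_int (sign p) * cocycle n p I = (\<Prod>e\<in>pairs {..<n}.
      (if p (Max e) < p (Min e) then - 1 else 1) * (if p (Max e) < p (Min e) then pair_factor I (Min e) (Max e) else 1))"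
    by (simp add: cocycle_def inversion_weight_def prod.distrib)
  also have "\<dots> = cocycle n p ({..<n} - I)"
    unfolding cocycle_def inversion_weight_def
  proof (rule prod.cong[OF refl])
    fix e assume e: "e \<in> pairs {..<n}"
    obtain i j where "i < n" "j < n" "Min e = i" "Max e = j" using pairs_cases[OF e] by blast
    then show "(if p (Max e) < p (Min e) then - 1 else 1) * (if p (Max e) < p (Min e) then pair_factor I (Min e) (Max e) else 1) =
       (if p (Max e) < p (Min e) then pair_factor ({..<n} - I) (Min e) (Max e) else 1)"
      by (simp add: pair_factor_compl)
  qed
  finally show ?thesis by simp
qed

text \<open>Expanding both sides of \<open>w v = v u\<close> by the cocycle identity, the factor of \<open>v\<close> cancels, whether or
  not \<open>v\<close> preserves the order of \<open>I\<close>. This reduces the stabiliser of any set to that of a final segment.\<close>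

lemma cocycle_conjugate:
  assumes w: "w permutes {..<n}" and v: "v permutes {..<n}" and u: "u permutes {..<n}"
    and eq: "w \<circ> v = v \<circ> u" and I: "u ` I = I"
  shows "cocycle n w (v ` I) = cocycle n u I"
proof -
  have "cocycle n w (v ` I) * cocycle n v I = cocycle n v I * cocycle n u I"
    using cocycle_compose[OF w v, of I] cocycle_compose[OF v u, of I] by (simp only: eq I)
  then show ?thesis using cocycle_nonzero[OF v] by simp
qed

text \<open>A pair with one element on either side of \<open>a\<close> is never inverted by \<open>u\<close>, a pair below \<open>a\<close> has
  factor \<open>1\<close>, and a pair from \<open>a\<close> on has factor \<open>-1\<close>. The permutation \<open>q\<close> is the restriction of \<open>u\<close> to
  the final segment, renumbered from 1.\<close>

lemma cocycle_block:
  assumes u: "u permutes {..<a + b}" and pres: "u ` {..<a} = {..<a}"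
    and q: "q permutes {1..b}" "\<And>j. j \<in> {1..b} \<Longrightarrow> u (j - 1 + a) = q j - 1 + a"
  shows "cocycle (a + b) u {a..<a + b} = of_int (sign q)"
proof -
  let ?I = "{a..<a + b}" and ?f = "\<lambda>j. j - 1 + a"
  let ?g = "\<lambda>e. if u (Max e) < u (Min e) then pair_factor ?I (Min e) (Max e) else 1"
  have inj: "inj u" using u permutes_inj by blast
  have lt: "u i < a \<longleftrightarrow> i < a" for i
    using inj pres by (metis inj_image_mem_iff lessThan_iff)
  have bij: "bij_betw ?f {1..<Suc b} ?I"
    by (rule bij_betw_byWitness[where f' = "\<lambda>i. i - a + 1"]) auto
  have "cocycle (a + b) u ?I = (\<Prod>e\<in>pairs {..<a + b}. ?g e)" by (simp add: cocycle_def inversion_weight_def)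
  also have "\<dots> = (\<Prod>e\<in>pairs ?I. ?g e)"
  proof (rule prod.mono_neutral_right)
    show "pairs ?I \<subseteq> pairs {..<a + b}" by (auto simp: pairs_def)
    show "\<forall>e\<in>pairs {..<a + b} - pairs ?I. ?g e = 1"
    proof
      fix e assume e: "e \<in> pairs {..<a + b} - pairs ?I"
      then obtain i j where ij: "i < j" "e = {i, j}" "j < a + b" "Min e = i" "Max e = j"
        using pairs_cases[of e "{..<a + b}"] by (metis DiffD1 lessThan_iff)
      then have i: "i < a" using e by (force simp: pairs_def)
      show "?g e = 1"
      proof (cases "j < a")
        case True
        then show ?thesis using i unfolding ij(4,5) by (simp add: pair_factor_def sgn_set_def)
      next
        case False
        then show ?thesis using i lt[of i] lt[of j] unfolding ij(4,5) by simp
      qed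
    qed
  qed (simp add: finite_pairs)
  also have "\<dots> = (\<Prod>e\<in>pairs {1..<Suc b}. ?g (?f ` e))"
    by (rule prod.reindex_bij_betw[OF bij_betw_pairs[OF bij], symmetric])
  also have "\<dots> = inversion_weight (\<lambda>_ _. - 1) q {1..<Suc b}"
    unfolding inversion_weight_def
  proof (rule prod.cong[OF refl])
    fix e assume e: "e \<in> pairs {1..<Suc b}"
    obtain i j where ij: "i < j" "e = {i, j}" "i \<in> {1..<Suc b}" "j \<in> {1..<Suc b}" "Min e = i" "Max e = j"
      using pairs_cases[OF e] by blast
    have m: "Min (?f ` e) = ?f i" "Max (?f ` e) = ?f j"
      using ij(1,3,4) by (auto simp: ij(2))
    have qp: "q i \<ge> 1" "q j \<ge> 1" 
      using permutes_in_image[OF q(1), of i] permutes_in_image[OF q(1), of j] ij(3,4) by auto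
    have "u (?f j) < u (?f i) \<longleftrightarrow> q j < q i"
      using q(2)[of i] q(2)[of j] ij(3,4) qp by auto
    moreover have "pair_factor ?I (?f i) (?f j) = - 1"
      using ij(3,4) by (auto simp: pair_factor_def sgn_set_def)
    ultimately show "?g (?f ` e) = (if q (Max e) < q (Min e) then - 1 else 1)"
      unfolding m ij(5,6) by simp
  qed
  also have "\<dots> = of_int (sign q)"
    using sign_inversions[of q 1 "Suc b"] q(1) by (simp add: atLeastLessThanSuc_atLeastAtMost)
  finally show ?thesis .
qed

section \<open>Coordinates on the hyperoctahedral group\<close>

text \<open>The product of the permutation matrix of \<open>w\<close> and the diagonal matrix with entry \<open>-1\<close> exactly at
  the positions in \<open>K\<close>.\<close>

definition smat :: "nat \<Rightarrow> (nat \<Rightarrow> nat) \<Rightarrow> nat set \<Rightarrow> complex mat" where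
  "smat n w K = mat n n (\<lambda>(i, j). if i = w j then sgn_set K j else 0)"

abbreviation perms :: "nat \<Rightarrow> (nat \<Rightarrow> nat) set" where
  "perms n \<equiv> {w. w permutes {..<n}}"

text \<open>The sign set of a product: moving \<open>t\<^sub>K\<close> past \<open>v\<close> gives \<open>t\<^sub>K v t\<^sub>L = v t\<^sub>M\<close>, where \<open>M\<close> is
  the symmetric difference of the preimage of \<open>K\<close> under \<open>v\<close> and \<open>L\<close>.\<close>

definition pull_sign :: "nat \<Rightarrow> (nat \<Rightarrow> nat) \<Rightarrow> nat set \<Rightarrow> nat set \<Rightarrow> nat set" where
  "pull_sign n v K L = {j\<in>{..<n}. (v j \<in> K) \<noteq> (j \<in> L)}"

lemma sgn_set_nonzero [simp]: "sgn_set K i \<noteq> 0"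
  by (simp add: sgn_set_def)

lemma sgn_set_square [simp]: "sgn_set K i * sgn_set K i = 1"
  by (simp add: sgn_set_def)

lemma sgn_set_pull_sign: "j < n \<Longrightarrow> sgn_set (pull_sign n v K L) j = sgn_set K (v j) * sgn_set L j"
  by (auto simp: sgn_set_def pull_sign_def)

lemma smat_carrier [simp]: "smat n w K \<in> carrier_mat n n"
  by (simp add: smat_def)

lemma perms_less: "w \<in> perms n \<Longrightarrow> w j < n \<longleftrightarrow> j < n"
  using permutes_in_image[of w "{..<n}" j] by simp

lemma smat_mult:
  assumes "v \<in> perms n"
  shows "smat n w K * smat n v L = smat n (w \<circ> v) (pull_sign n v K L)"
proof (rule eq_matI)
  fix i j assume "i < dim_row (smat n (w \<circ> v) (pull_sign n v K L))" "j < dim_col (smat n (w \<circ> v) (pull_sign n v K L))"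
  then have ij: "i < n" "j < n" by (simp_all add: smat_def)
  have "(smat n w K * smat n v L) $$ (i, j) =
      (\<Sum>k<n. (if i = w k then sgn_set K k else 0) * (if k = v j then sgn_set L j else 0))"
    using ij by (simp add: smat_def scalar_prod_def lessThan_atLeast0)
  also have "\<dots> = (\<Sum>k<n. if k = v j then (if i = w k then sgn_set K k else 0) * sgn_set L j else 0)"
    by (intro sum.cong refl) simp
  also have "\<dots> = (if i = w (v j) then sgn_set K (v j) else 0) * sgn_set L j"
    using perms_less[OF assms, of j] ij by simp
  finally show "(smat n w K * smat n v L) $$ (i, j) = smat n (w \<circ> v) (pull_sign n v K L) $$ (i, j)"
    using ij by (simp add: smat_def sgn_set_pull_sign)
qed (simp_all add: smat_def)

lemma one_smat: "1\<^sub>m n = smat n id {}"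
  by (rule eq_matI) (auto simp: smat_def sgn_set_def)

lemma smat_eqD:
  assumes eq: "smat n w K = smat n v L" and w: "w \<in> perms n" "v \<in> perms n" and K: "K \<subseteq> {..<n}" "L \<subseteq> {..<n}"
  shows "w = v \<and> K = L"
proof -
  have ent: "smat n w K $$ (w j, j) = smat n v L $$ (w j, j)" if "j < n" for j by (simp add: eq)
  have wv: "w j = v j" if j: "j < n" for j
    using ent[OF j] perms_less[OF w(1), of j] j by (auto simp: smat_def split: if_splits)
  have "w j = v j" for j
    using wv w by (cases "j < n") (auto simp: permutes_not_in)
  then have "w = v" by auto
  moreover have "j \<in> K \<longleftrightarrow> j \<in> L" if j: "j < n" for j
    using ent[OF j] perms_less[OF w(1), of j] j wv[OF j] by (auto simp: smat_def sgn_set_def split: if_splits)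
  ultimately show ?thesis using K by auto
qed

lemma signed_monomial_smat:
  assumes w: "w \<in> perms n"
  shows "signed_monomial n (smat n w K)"
proof -
  have "inv' w i < n" "w (inv' w i) = i" if "i < n" for i
    using that permutes_in_image[OF permutes_inv, of w "{..<n}" i] permutes_inverses(1)[of w "{..<n}"] w by auto
  moreover have "j = inv' w i" if "w j = i" for i j
    using that permutes_inverses(2)[of w "{..<n}"] w by auto
  ultimately have "\<exists>!j. j < n \<and> i = w j" if "i < n" for i using that by metis
  moreover have "\<exists>!i. i < n \<and> i = w j" if "j < n" for j using that perms_less[OF w] by auto
  moreover have "(\<lambda>j. j < n \<and> smat n w K $$ (i, j) \<noteq> 0) = (\<lambda>j. j < n \<and> i = w j)" if "i < n" for i
    using that by (auto simp: smat_def split: if_splits)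
  moreover have "(\<lambda>i. i < n \<and> smat n w K $$ (i, j) \<noteq> 0) = (\<lambda>i. i < n \<and> i = w j)" if "j < n" for j
    using that by (auto simp: smat_def split: if_splits)
  moreover have "smat n w K $$ (i, j) = 1 \<or> smat n w K $$ (i, j) = - 1"
    if "i < n" "j < n" "smat n w K $$ (i, j) \<noteq> 0" for i j
    using that by (auto simp: smat_def sgn_set_def split: if_splits)
  ultimately show ?thesis by (simp add: signed_monomial_def)
qed

lemma signed_monomial_obtain:
  assumes A: "signed_monomial n A"
  obtains w K where "w \<in> perms n" "K \<subseteq> {..<n}" "A = smat n w K"
proof -
  define w where "w j = (if j < n then THE i. i < n \<and> A $$ (i, j) \<noteq> 0 else j)" for j
  define K where "K = {j\<in>{..<n}. A $$ (w j, j) = - 1}"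
  have col: "\<exists>!i. i < n \<and> A $$ (i, j) \<noteq> 0" if "j < n" for j using A that by (simp add: signed_monomial_def)
  have row: "\<exists>!j. j < n \<and> A $$ (i, j) \<noteq> 0" if "i < n" for i using A that by (simp add: signed_monomial_def)
  have w: "w j < n" "A $$ (w j, j) \<noteq> 0" if "j < n" for j
    using theI'[OF col[OF that]] that by (simp_all add: w_def)
  have "inj_on w {..<n}"
  proof (rule inj_onI)
    fix j k assume "j \<in> {..<n}" "k \<in> {..<n}" "w j = w k"
    then show "j = k" using row[of "w j"] w[of j] w[of k] by auto
  qed
  moreover have "w ` {..<n} \<subseteq> {..<n}" using w by auto
  ultimately have "bij_betw w {..<n} {..<n}"
    by (simp add: bij_betw_def endo_inj_surj)
  then have "w permutes {..<n}" by (rule bij_imp_permutes) (simp add: w_def)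
  then have wp: "w \<in> perms n" by simp
  have pm: "A $$ (i, j) = 1 \<or> A $$ (i, j) = - 1" if "i < n" "j < n" "A $$ (i, j) \<noteq> 0" for i j
    using A that by (simp add: signed_monomial_def)
  have "A = smat n w K"
  proof (rule eq_matI)
    fix i j assume "i < dim_row (smat n w K)" "j < dim_col (smat n w K)"
    then have ij: "i < n" "j < n" by (simp_all add: smat_def)
    show "A $$ (i, j) = smat n w K $$ (i, j)"
    proof (cases "i = w j")
      case True
      then show ?thesis using pm[OF ij] w[OF ij(2)] ij by (auto simp: smat_def sgn_set_def K_def)
    next
      case False
      then have "A $$ (i, j) = 0" using col[OF ij(2)] w[OF ij(2)] ij by auto
      then show ?thesis using ij False by (simp add: smat_def)
    qed
  qed (use A in \<open>auto simp: signed_monomial_def smat_def\<close>)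
  then show thesis by (rule that[OF wp, rotated]) (auto simp: K_def)
qed

lemma B_simps:
  "A \<in> carrier (B_group n) \<longleftrightarrow> signed_monomial n A"
  "A \<otimes>\<^bsub>B_group n\<^esub> C = A * C" "\<one>\<^bsub>B_group n\<^esub> = smat n id {}"
  by (simp_all add: B_group_def one_smat)

lemma bij_smat: "bij_betw (\<lambda>(w, K). smat n w K) (perms n \<times> Pow {..<n}) (carrier (B_group n))"
  unfolding bij_betw_def
proof
  show "inj_on (\<lambda>(w, K). smat n w K) (perms n \<times> Pow {..<n})"
    by (rule inj_onI) (auto dest: smat_eqD)
  show "(\<lambda>(w, K). smat n w K) ` (perms n \<times> Pow {..<n}) = carrier (B_group n)"
  proof (intro equalityI subsetI)
    fix A assume "A \<in> carrier (B_group n)"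
    then obtain w K where "w \<in> perms n" "K \<subseteq> {..<n}" "A = smat n w K"
      using signed_monomial_obtain by (metis B_simps(1))
    then show "A \<in> (\<lambda>(w, K). smat n w K) ` (perms n \<times> Pow {..<n})" by force
  qed (auto simp: B_simps intro!: signed_monomial_smat)
qed

lemma finite_perms: "finite (perms n)"
  by (rule finite_permutations) simp

lemma finite_B: "finite (carrier (B_group n))"
  using bij_betw_finite[OF bij_smat] finite_perms by auto

lemma sum_B: "(\<Sum>A\<in>carrier (B_group n). \<phi> A) = (\<Sum>w\<in>perms n. \<Sum>K\<in>Pow {..<n}. \<phi> (smat n w K))"
  by (simp add: sum.cartesian_product sum.reindex_bij_betw[OF bij_smat, symmetric] case_prod_unfold)

lemma B_obtain:
  assumes "A \<in> carrier (B_group n)"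
  obtains w K where "w \<in> perms n" "K \<subseteq> {..<n}" "A = smat n w K"
  using signed_monomial_obtain[of n A] assms by (auto simp: B_simps)

lemma smat_in_B: "w \<in> perms n \<Longrightarrow> smat n w K \<in> carrier (B_group n)"
  using signed_monomial_smat by (simp add: B_simps)

lemma perms_compose: "w \<in> perms n \<Longrightarrow> v \<in> perms n \<Longrightarrow> w \<circ> v \<in> perms n"
  using permutes_compose by blast

lemma perms_inv: "w \<in> perms n \<Longrightarrow> inv' w \<in> perms n"
  using permutes_inv by blast

lemma pull_sign_subset: "pull_sign n v K L \<subseteq> {..<n}"
  by (auto simp: pull_sign_def)

lemma group_B: "group (B_group n)"
proof (rule groupI)
  fix x y assume "x \<in> carrier (B_group n)" "y \<in> carrier (B_group n)"
  then show "x \<otimes>\<^bsub>B_group n\<^esub> y \<in> carrier (B_group n)"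
    by (elim B_obtain) (simp only: B_simps(2) smat_mult smat_in_B perms_compose)
next
  fix x y z assume "x \<in> carrier (B_group n)" "y \<in> carrier (B_group n)" "z \<in> carrier (B_group n)"
  then show "x \<otimes>\<^bsub>B_group n\<^esub> y \<otimes>\<^bsub>B_group n\<^esub> z = x \<otimes>\<^bsub>B_group n\<^esub> (y \<otimes>\<^bsub>B_group n\<^esub> z)"
    by (simp add: B_simps signed_monomial_def assoc_mult_mat[of _ n n _ n _ n])
next
  fix x assume "x \<in> carrier (B_group n)"
  then obtain w K where w: "w \<in> perms n" "K \<subseteq> {..<n}" "x = smat n w K" by (rule B_obtain)
  show "\<one>\<^bsub>B_group n\<^esub> \<otimes>\<^bsub>B_group n\<^esub> x = x" 
    unfolding B_simps(2,3) w(3) one_smat[symmetric] by (rule left_mult_one_mat[OF smat_carrier])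
  have "smat n (inv' w) {i. inv' w i \<in> K} * smat n w K = smat n id {}"
    using w permutes_inv_o(2)[of w] permutes_inverses(2)[of w]
    by (simp add: smat_mult pull_sign_def)
  then show "\<exists>y\<in>carrier (B_group n). y \<otimes>\<^bsub>B_group n\<^esub> x = \<one>\<^bsub>B_group n\<^esub>"
    using w by (auto simp: B_simps(2,3) intro!: bexI[OF _ smat_in_B[OF perms_inv]])
qed (simp add: B_simps(3) smat_in_B permutes_id)

section \<open>Fourier transform along the diagonal subgroup\<close>

text \<open>The value at \<open>t\<^sub>K\<close> of the character of the diagonal subgroup that is labelled by \<open>I\<close>, that is,
  \<open>(-1)\<^bsup>|I \<inter> K|\<^esup>\<close>.\<close>

definition chi :: "nat set \<Rightarrow> nat set \<Rightarrow> complex" where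
  "chi I K = (\<Prod>j\<in>I. sgn_set K j)"

lemma chi_commute: "finite I \<Longrightarrow> finite K \<Longrightarrow> chi I K = chi K I"
  by (simp add: chi_def sgn_set_def prod.If_cases Int_commute)

lemma chi_square: "chi I K * chi I K = 1"
  by (simp add: chi_def prod.distrib[symmetric])

lemma chi_empty [simp]: "chi {} K = 1" "chi I {} = 1"
  by (simp_all add: chi_def sgn_set_def)

lemma chi_compl:
  assumes "I \<subseteq> {..<n}"
  shows "chi ({..<n} - I) K = chi {..<n} K * chi I K"
proof -
  have "chi {..<n} K = chi ({..<n} - I) K * chi I K"
    unfolding chi_def by (rule prod.subset_diff[OF assms]) simp
  then show ?thesis using chi_square[of I K] by (simp add: mult.assoc)
qed

lemma chi_pull_sign:
  assumes "v \<in> perms n" "I \<subseteq> {..<n}"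
  shows "chi I (pull_sign n v K L) = chi (v ` I) K * chi I L"
proof -
  have "inj_on v I" using assms permutes_inj_on by auto
  then have "chi (v ` I) K = (\<Prod>j\<in>I. sgn_set K (v j))" by (simp add: chi_def prod.reindex)
  moreover have "chi I (pull_sign n v K L) = (\<Prod>j\<in>I. sgn_set K (v j) * sgn_set L j)"
    unfolding chi_def using assms by (intro prod.cong refl sgn_set_pull_sign) auto
  ultimately show ?thesis by (simp add: chi_def prod.distrib)
qed

text \<open>The sum over subsets expands the product of the factors \<open>1 + \<epsilon>\<^sub>j \<epsilon>'\<^sub>j\<close>, one of which vanishes
  as soon as the two sets differ at some position \<open>j\<close>.\<close>

lemma chi_orthogonal:
  assumes "I \<subseteq> {..<n}" "I' \<subseteq> {..<n}"
  shows "(\<Sum>K\<in>Pow {..<n}. chi I K * chi I' K) = (if I = I' then 2 ^ n else 0)"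
proof -
  have fin: "finite I" "finite I'" using assms finite_subset by auto
  have "(\<Sum>K\<in>Pow {..<n}. chi I K * chi I' K) = (\<Sum>K\<in>Pow {..<n}. \<Prod>j\<in>K. sgn_set I j * sgn_set I' j)"
  proof (rule sum.cong[OF refl])
    fix K assume "K \<in> Pow {..<n}"
    then have "finite K" using finite_subset by auto
    then have "chi I K * chi I' K = chi K I * chi K I'" using fin chi_commute by metis
    then show "chi I K * chi I' K = (\<Prod>j\<in>K. sgn_set I j * sgn_set I' j)"
      by (simp add: chi_def prod.distrib)
  qed
  also have "\<dots> = (\<Prod>j<n. sgn_set I j * sgn_set I' j + 1)"
    by (subst prod_add) simp_all
  also have "\<dots> = (if I = I' then 2 ^ n else 0)"
  proof (cases "I = I'")
    case False
    then obtain j where "j < n" "(j \<in> I) \<noteq> (j \<in> I')" using assms by blast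
    then show ?thesis using False by (auto simp: sgn_set_def intro!: prod_zero bexI[of _ j])
  qed simp
  finally show ?thesis .
qed

text \<open>The coefficient of \<open>f\<close> at \<open>w e\<^sub>I\<close>, where \<open>e\<^sub>I\<close> is the idempotent of the character labelled by \<open>I\<close>.\<close>

definition fourier :: "nat \<Rightarrow> (complex mat \<Rightarrow> complex) \<Rightarrow> (nat \<Rightarrow> nat) \<Rightarrow> nat set \<Rightarrow> complex" where
  "fourier n f w I = (\<Sum>K\<in>Pow {..<n}. chi I K * f (smat n w K))"

definition inv_fourier :: "nat \<Rightarrow> ((nat \<Rightarrow> nat) \<Rightarrow> nat set \<Rightarrow> complex) \<Rightarrow> complex mat \<Rightarrow> complex" where
  "inv_fourier n \<Phi> A = (if A \<in> carrier (B_group n) then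
     (case the_inv_into (perms n \<times> Pow {..<n}) (\<lambda>(w, K). smat n w K) A of (w, K) \<Rightarrow>
        (\<Sum>I\<in>Pow {..<n}. chi I K * \<Phi> w I) / 2 ^ n) else 0)"

lemma inv_fourier_closed: "inv_fourier n \<Phi> \<in> carrier (group_algebra (B_group n))"
  by (simp add: inv_fourier_def group_algebra_simps)

lemma inv_fourier_smat:
  assumes "w \<in> perms n" "K \<subseteq> {..<n}"
  shows "inv_fourier n \<Phi> (smat n w K) = (\<Sum>I\<in>Pow {..<n}. chi I K * \<Phi> w I) / 2 ^ n"
proof -
  have "the_inv_into (perms n \<times> Pow {..<n}) (\<lambda>(w, K). smat n w K) (smat n w K) = (w, K)"
    using the_inv_into_f_f[OF bij_betw_imp_inj_on[OF bij_smat[of n]], of "(w, K)"] assms by simp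
  then show ?thesis using assms by (simp add: inv_fourier_def smat_in_B)
qed

lemma fourier_inv_fourier:
  assumes "w \<in> perms n" "I \<subseteq> {..<n}"
  shows "fourier n (inv_fourier n \<Phi>) w I = \<Phi> w I"
proof -
  have "fourier n (inv_fourier n \<Phi>) w I =
      (\<Sum>K\<in>Pow {..<n}. \<Sum>I'\<in>Pow {..<n}. chi I K * chi I' K * \<Phi> w I' / 2 ^ n)"
    unfolding fourier_def using assms
    by (intro sum.cong refl) (simp add: inv_fourier_smat sum_distrib_left sum_divide_distrib mult.assoc)
  also have "\<dots> = (\<Sum>I'\<in>Pow {..<n}. \<Sum>K\<in>Pow {..<n}. chi I K * chi I' K * \<Phi> w I' / 2 ^ n)"
    by (rule sum.swap)
  also have "\<dots> = (\<Sum>I'\<in>Pow {..<n}. (\<Sum>K\<in>Pow {..<n}. chi I K * chi I' K) * \<Phi> w I' / 2 ^ n)"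
    by (simp add: sum_distrib_right sum_divide_distrib)
  also have "\<dots> = (\<Sum>I'\<in>Pow {..<n}. if I' = I then \<Phi> w I' else 0)"
    using assms by (intro sum.cong refl) (auto simp: chi_orthogonal)
  finally show ?thesis using assms by simp
qed

lemma fourier_inversion:
  assumes "w \<in> perms n" "K \<subseteq> {..<n}"
  shows "f (smat n w K) = (\<Sum>I\<in>Pow {..<n}. chi I K * fourier n f w I) / 2 ^ n"
proof -
  have fin: "finite X" if "X \<in> Pow {..<n}" for X using that finite_subset by auto
  have "(\<Sum>I\<in>Pow {..<n}. chi I K * fourier n f w I) =
      (\<Sum>I\<in>Pow {..<n}. \<Sum>L\<in>Pow {..<n}. chi I K * chi I L * f (smat n w L))"
    by (simp add: fourier_def sum_distrib_left mult.assoc)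
  also have "\<dots> = (\<Sum>L\<in>Pow {..<n}. \<Sum>I\<in>Pow {..<n}. chi I K * chi I L * f (smat n w L))"
    by (rule sum.swap)
  also have "\<dots> = (\<Sum>L\<in>Pow {..<n}. (\<Sum>I\<in>Pow {..<n}. chi K I * chi L I) * f (smat n w L))"
    using fin assms(2) by (simp add: sum_distrib_right chi_commute)
  also have "\<dots> = (\<Sum>L\<in>Pow {..<n}. if L = K then 2 ^ n * f (smat n w L) else 0)"
    using assms by (intro sum.cong refl) (auto simp: chi_orthogonal)
  finally show ?thesis using assms by simp
qed

lemma fourier_eqI:
  assumes f: "f \<in> carrier (group_algebra (B_group n))" "g \<in> carrier (group_algebra (B_group n))"
    and eq: "\<And>w I. w \<in> perms n \<Longrightarrow> I \<subseteq> {..<n} \<Longrightarrow> fourier n f w I = fourier n g w I"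
  shows "f = g"
proof
  fix A
  show "f A = g A"
  proof (cases "A \<in> carrier (B_group n)")
    case True
    then obtain w K where w: "w \<in> perms n" "K \<subseteq> {..<n}" "A = smat n w K" by (rule B_obtain)
    have "(\<Sum>I\<in>Pow {..<n}. chi I K * fourier n f w I) = (\<Sum>I\<in>Pow {..<n}. chi I K * fourier n g w I)"
      by (intro sum.cong refl) (use eq[OF w(1)] in auto)
    then show ?thesis unfolding w(3) fourier_inversion[OF w(1,2)] by simp
  next
    case False
    then show ?thesis using f by (simp add: group_algebra_simps)
  qed
qed

lemma fourier_linear:
  "fourier n (f + g) w I = fourier n f w I + fourier n g w I"
  "fourier n (scl c f) w I = c * fourier n f w I"
  by (simp_all add: fourier_def sum.distrib distrib_left sum_distrib_left mult_ac)

lemma fourier_delta: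
  assumes "w \<in> perms n" "v \<in> perms n" "L \<subseteq> {..<n}"
  shows "fourier n (delta (smat n v L)) w I = (if w = v then chi I L else 0)"
proof -
  have "chi I K * delta (smat n v L) (smat n w K) = (if K = L then (if w = v then chi I L else 0) else 0)"
    if "K \<in> Pow {..<n}" for K
    using that assms smat_eqD[of n w K v L] by (auto simp: delta_def)
  then have "fourier n (delta (smat n v L)) w I =
      (\<Sum>K\<in>Pow {..<n}. if K = L then (if w = v then chi I L else 0) else 0)"
    unfolding fourier_def by (intro sum.cong refl)
  then show ?thesis using assms by simp
qed

text \<open>In Fourier coordinates, the group algebra is the convolution algebra of the action groupoid of
  the symmetric group on the subsets of \<open>{..<n}\<close>.\<close>

lemma fourier_mult:
  assumes w: "w \<in> perms n" and I: "I \<subseteq> {..<n}"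
  shows "fourier n (f \<otimes>\<^bsub>group_algebra (B_group n)\<^esub> g) w I =
    (\<Sum>v\<in>perms n. fourier n f (w \<circ> inv' v) (v ` I) * fourier n g v I)"
proof -
  let ?P = "perms n" and ?S = "Pow {..<n}"
  let ?t = "\<lambda>u K v L. f (smat n u K) * g (smat n v L)"
  have eq: "u \<circ> v = w \<longleftrightarrow> u = w \<circ> inv' v" if "u \<in> ?P" "v \<in> ?P" for u v
    using that permutes_inv_o[of v "{..<n}"] by (auto simp: comp_assoc simp flip: comp_assoc)
  have "fourier n (f \<otimes>\<^bsub>group_algebra (B_group n)\<^esub> g) w I =
     (\<Sum>M\<in>?S. \<Sum>u\<in>?P. \<Sum>K\<in>?S. \<Sum>v\<in>?P. \<Sum>L\<in>?S.
        if pull_sign n v K L = M then (if u \<circ> v = w then chi I M * ?t u K v L else 0) else 0)"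
    unfolding fourier_def group_algebra_mult[OF finite_B] sum_B sum_distrib_left B_simps(2)
  proof (intro sum.cong refl)
    fix M u K v L assume H: "M \<in> ?S" "u \<in> ?P" "K \<in> ?S" "v \<in> ?P" "L \<in> ?S"
    then have "smat n u K * smat n v L = smat n w M \<longleftrightarrow> u \<circ> v = w \<and> pull_sign n v K L = M"
      using smat_eqD[of n "u \<circ> v" "pull_sign n v K L" w M] w perms_compose[OF H(2,4)] pull_sign_subset[of n v K L]
      by (auto simp: smat_mult)
    then show "chi I M * (if smat n u K * smat n v L = smat n w M then ?t u K v L else 0) =
      (if pull_sign n v K L = M then (if u \<circ> v = w then chi I M * ?t u K v L else 0) else 0)" by simp
  qed
  also have "\<dots> = (\<Sum>v\<in>?P. \<Sum>u\<in>?P. \<Sum>L\<in>?S. \<Sum>K\<in>?S. \<Sum>M\<in>?S.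
        if pull_sign n v K L = M then (if u \<circ> v = w then chi I M * ?t u K v L else 0) else 0)"
    unfolding sum.cartesian_product
    by (rule sum.reindex_bij_witness[of _ "\<lambda>(v,u,L,K,M). (M,u,K,v,L)" "\<lambda>(M,u,K,v,L). (v,u,L,K,M)"]) auto
  also have "\<dots> = (\<Sum>v\<in>?P. \<Sum>u\<in>?P. if u = w \<circ> inv' v then
      (\<Sum>L\<in>?S. \<Sum>K\<in>?S. chi I (pull_sign n v K L) * ?t u K v L) else 0)"
    using pull_sign_subset[of n] by (intro sum.cong refl) (simp add: eq)
  also have "\<dots> = (\<Sum>v\<in>?P. \<Sum>L\<in>?S. \<Sum>K\<in>?S. chi I (pull_sign n v K L) * ?t (w \<circ> inv' v) K v L)"
    using w perms_compose perms_inv by (intro sum.cong refl) (simp add: finite_perms)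
  also have "\<dots> = (\<Sum>v\<in>?P. \<Sum>L\<in>?S. \<Sum>K\<in>?S.
      (chi (v ` I) K * f (smat n (w \<circ> inv' v) K)) * (chi I L * g (smat n v L)))"
    using I by (intro sum.cong refl) (simp add: chi_pull_sign)
  also have "\<dots> = (\<Sum>v\<in>perms n. fourier n f (w \<circ> inv' v) (v ` I) * fourier n g v I)"
    unfolding fourier_def sum_product by (intro sum.cong refl sum.swap)
  finally show ?thesis .
qed

section \<open>The automorphism\<close>

abbreviation GB :: "nat \<Rightarrow> (complex mat \<Rightarrow> complex) set" where
  "GB n \<equiv> carrier (group_algebra (B_group n))"

text \<open>The automorphism in closed form: it is diagonal in Fourier coordinates.\<close>

definition fourier_J :: "nat \<Rightarrow> (complex mat \<Rightarrow> complex) \<Rightarrow> complex mat \<Rightarrow> complex" where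
  "fourier_J n f = inv_fourier n (\<lambda>w I. cocycle n w I * fourier n f w I)"

lemma fourier_J_closed: "fourier_J n f \<in> GB n"
  by (simp add: fourier_J_def inv_fourier_closed)

lemma fourier_fourier_J:
  "w \<in> perms n \<Longrightarrow> I \<subseteq> {..<n} \<Longrightarrow> fourier n (fourier_J n f) w I = cocycle n w I * fourier n f w I"
  by (simp add: fourier_J_def fourier_inv_fourier)

lemma perms_image_subset: "v \<in> perms n \<Longrightarrow> I \<subseteq> {..<n} \<Longrightarrow> v ` I \<subseteq> {..<n}"
  using perms_less[of v n] by auto

text \<open>The coefficient at \<open>w e\<^sub>I\<close> of a product collects the factorisations \<open>w = (w v\<^sup>-\<^sup>1) v\<close>, and the
  cocycle identity splits \<open>u\<^sub>w(I)\<close> accordingly.\<close>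

lemma fourier_J_mult:
  "fourier_J n (f \<otimes>\<^bsub>group_algebra (B_group n)\<^esub> g) =
    fourier_J n f \<otimes>\<^bsub>group_algebra (B_group n)\<^esub> fourier_J n g"
proof (rule fourier_eqI)
  fix w I assume w: "w \<in> perms n" and I: "I \<subseteq> {..<n}"
  have "cocycle n w I * (fourier n f (w \<circ> inv' v) (v ` I) * fourier n g v I) =
      fourier n (fourier_J n f) (w \<circ> inv' v) (v ` I) * fourier n (fourier_J n g) v I" if v: "v \<in> perms n" for v
  proof -
    have wv: "w \<circ> inv' v \<in> perms n" using w v perms_compose perms_inv by blast
    have "w = (w \<circ> inv' v) \<circ> v" using v permutes_inv_o(2)[of v "{..<n}"] by (simp add: comp_assoc)
    then have "cocycle n w I = cocycle n (w \<circ> inv' v) (v ` I) * cocycle n v I"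
      using cocycle_compose[of "w \<circ> inv' v" n v I] wv v by simp
    then show ?thesis
      using fourier_fourier_J[OF wv perms_image_subset[OF v I]] fourier_fourier_J[OF v I] by simp
  qed
  then show "fourier n (fourier_J n (f \<otimes>\<^bsub>group_algebra (B_group n)\<^esub> g)) w I =
      fourier n (fourier_J n f \<otimes>\<^bsub>group_algebra (B_group n)\<^esub> fourier_J n g) w I"
    using fourier_fourier_J[OF w I] fourier_mult[OF w I] by (simp add: sum_distrib_left)
qed (simp_all add: fourier_J_closed group_algebra_mult_closed[OF group_B finite_B])

lemma fourier_J_linear:
  "fourier_J n (f + g) = fourier_J n f + fourier_J n g"
  "fourier_J n (scl c f) = scl c (fourier_J n f)"
proof -
  have cl: "fourier_J n f + fourier_J n g \<in> GB n" "scl c (fourier_J n f) \<in> GB n"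
    by (intro group_algebra_closed fourier_J_closed)+
  show "fourier_J n (f + g) = fourier_J n f + fourier_J n g"
    by (rule fourier_eqI[OF fourier_J_closed cl(1)])
      (simp only: fourier_fourier_J fourier_linear distrib_left)
  show "fourier_J n (scl c f) = scl c (fourier_J n f)"
    by (rule fourier_eqI[OF fourier_J_closed cl(2)])
      (simp only: fourier_fourier_J fourier_linear mult.left_commute)
qed

lemma fourier_J_delta_diagonal:
  assumes "L \<subseteq> {..<n}"
  shows "fourier_J n (delta (smat n id L)) = delta (smat n id L)"
proof (rule fourier_eqI)
  have id: "id \<in> perms n" by (simp add: permutes_id)
  show "delta (smat n id L) \<in> GB n" by (rule delta_in_group_algebra[OF smat_in_B[OF id]])
  show "fourier n (fourier_J n (delta (smat n id L))) w I = fourier n (delta (smat n id L)) w I"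
    if "w \<in> perms n" "I \<subseteq> {..<n}" for w I
    using that assms by (simp add: fourier_fourier_J fourier_delta[OF _ id] cocycle_id)
qed (rule fourier_J_closed)

lemma bij_fourier_J: "bij_betw (fourier_J n) (GB n) (GB n)"
proof (rule bij_betw_byWitness[where f' = "\<lambda>f. inv_fourier n (\<lambda>w I. fourier n f w I / cocycle n w I)"])
  have nz: "cocycle n w I \<noteq> 0" if "w \<in> perms n" for w I using that cocycle_nonzero by blast
  show "\<forall>f\<in>GB n. inv_fourier n (\<lambda>w I. fourier n (fourier_J n f) w I / cocycle n w I) = f"
  proof
    fix f assume f: "f \<in> GB n"
    show "inv_fourier n (\<lambda>w I. fourier n (fourier_J n f) w I / cocycle n w I) = f"
    proof (rule fourier_eqI[OF inv_fourier_closed f])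
      fix w I assume w: "w \<in> perms n" and I: "I \<subseteq> {..<n}"
      show "fourier n (inv_fourier n (\<lambda>w I. fourier n (fourier_J n f) w I / cocycle n w I)) w I = fourier n f w I"
        unfolding fourier_inv_fourier[OF w I] fourier_fourier_J[OF w I] using nz[OF w] by simp
    qed
  qed
  show "\<forall>f\<in>GB n. fourier_J n (inv_fourier n (\<lambda>w I. fourier n f w I / cocycle n w I)) = f"
  proof
    fix f assume f: "f \<in> GB n"
    show "fourier_J n (inv_fourier n (\<lambda>w I. fourier n f w I / cocycle n w I)) = f"
    proof (rule fourier_eqI[OF fourier_J_closed f])
      fix w I assume w: "w \<in> perms n" and I: "I \<subseteq> {..<n}"
      show "fourier n (fourier_J n (inv_fourier n (\<lambda>w I. fourier n f w I / cocycle n w I))) w I = fourier n f w I"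
        unfolding fourier_fourier_J[OF w I] fourier_inv_fourier[OF w I] using nz[OF w] by simp
    qed
  qed
qed (auto simp: fourier_J_closed inv_fourier_closed)

lemma fourier_J_iso: "fourier_J n \<in> algebra_iso (group_algebra (B_group n)) (group_algebra (B_group n))"
  by (rule algebra_isoI)
    (simp_all add: fourier_J_closed fourier_J_mult fourier_J_linear bij_fourier_J fourier_J_delta_diagonal B_simps(3))

lemma s_gen_smat: "Suc i < n \<Longrightarrow> s_gen n i = smat n (transpose i (Suc i)) {}"
  by (rule eq_matI) (auto simp: s_gen_def smat_def sgn_set_def)

lemma t_gen_smat: "t_gen n i = smat n id {i}"
  by (rule eq_matI) (auto simp: t_gen_def smat_def sgn_set_def)

lemma transpose_in_perms: "Suc i < n \<Longrightarrow> transpose i (Suc i) \<in> perms n"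
  by (auto intro!: permutes_swap_id)

lemma fourier_J_s_gen:
  assumes i: "Suc i < n"
  shows "fourier_J n (delta (s_gen n i)) = scl (1 / 2) (delta (s_gen n i) \<otimes>\<^bsub>group_algebra (B_group n)\<^esub>
      (scl (1 - \<i>) (delta (t_gen n i)) + scl (1 + \<i>) (delta (t_gen n (Suc i)))))"
    (is "?l = scl (1 / 2) (?d \<otimes>\<^bsub>?A\<^esub> (scl _ _ + scl _ _))")
proof -
  let ?s = "transpose i (Suc i)"
  have s: "?s \<in> perms n" by (rule transpose_in_perms[OF i])
  have id: "id \<in> perms n" by (simp add: permutes_id)
  have prod: "?d \<otimes>\<^bsub>?A\<^esub> delta (t_gen n k) = delta (smat n ?s {k})" if "k < n" for k
  proof -
    have "pull_sign n id {} {k} = {k}" using that by (auto simp: pull_sign_def)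
    then show ?thesis
      using i by (simp add: s_gen_smat t_gen_smat delta_mult_delta[OF group_B finite_B smat_in_B[OF s] smat_in_B[OF id]]
          B_simps(2) smat_mult[OF id])
  qed
  have "?l = scl (1 / 2) (scl (1 - \<i>) (delta (smat n ?s {i})) + scl (1 + \<i>) (delta (smat n ?s {Suc i})))" (is "_ = ?r")
  proof (rule fourier_eqI)
    show "?r \<in> GB n" by (intro group_algebra_closed delta_in_group_algebra smat_in_B s)
    fix w I assume w: "w \<in> perms n" and I: "I \<subseteq> {..<n}"
    have chi: "chi I {k} = sgn_set I k" for k
      using chi_commute[of I "{k}"] finite_subset[OF I] by (simp add: chi_def)
    show "fourier n ?l w I = fourier n ?r w I"
      unfolding fourier_fourier_J[OF w I] fourier_linear s_gen_smat[OF i]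
      using i by (simp add: fourier_delta[OF w s] chi cocycle_transpose pair_factor_def)
  qed (rule fourier_J_closed)
  then show ?thesis
    using i by (simp add: group_algebra_mult_linear[OF finite_B] prod)
qed

text \<open>The group is generated by the \<open>s\<^sub>i\<close> and \<open>t\<^sub>i\<close>: a permutation matrix is built from adjacent
  transpositions, and the signs are then inserted one at a time.\<close>

lemma algebra_hom_eq_on_generators:
  assumes J: "J \<in> algebra_iso (group_algebra (B_group n)) (group_algebra (B_group n))"
    and K: "K \<in> algebra_iso (group_algebra (B_group n)) (group_algebra (B_group n))"
    and t: "\<And>i. i < n \<Longrightarrow> J (delta (t_gen n i)) = K (delta (t_gen n i))"
    and s: "\<And>i. Suc i < n \<Longrightarrow> J (delta (s_gen n i)) = K (delta (s_gen n i))"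
    and f: "f \<in> GB n"
  shows "J f = K f"
proof -
  note LJ = algebra_iso_linear[OF J] and LK = algebra_iso_linear[OF K]
  have id: "id \<in> perms n" by (simp add: permutes_id)
  have deltas: "J (delta (A * C)) = K (delta (A * C))"
    if "A \<in> carrier (B_group n)" "C \<in> carrier (B_group n)"
      "J (delta A) = K (delta A)" "J (delta C) = K (delta C)" for A C
  proof -
    have "delta (A * C) = delta A \<otimes>\<^bsub>group_algebra (B_group n)\<^esub> delta C"
      using delta_mult_delta[OF group_B finite_B that(1,2)] by (simp add: B_simps(2))
    then show ?thesis using that by (simp add: LJ(3) LK(3) delta_in_group_algebra)
  qed
  have perm: "J (delta (smat n w {})) = K (delta (smat n w {}))" if "w permutes {0..<n}" for w
    using that
  proof (induction rule: adjacent_transposition_induct)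
    case id
    show ?case using LJ(4) LK(4) by (simp only: B_simps(3))
  next
    case (step p i)
    have p: "p \<in> perms n" and q: "transpose i (Suc i) \<in> perms n"
      using step transpose_in_perms by (auto simp: lessThan_atLeast0)
    have "smat n (p \<circ> transpose i (Suc i)) {} = smat n p {} * s_gen n i"
      using step q by (simp add: s_gen_smat smat_mult pull_sign_def)
    moreover have "s_gen n i \<in> carrier (B_group n)"
      using smat_in_B[OF q] step.hyps by (simp add: s_gen_smat)
    ultimately show ?case
      using deltas[OF smat_in_B[OF p] _ step.IH s] step.hyps by (simp only:)
  qed
  have all: "J (delta (smat n w L)) = K (delta (smat n w L))" if w: "w \<in> perms n" and L: "L \<subseteq> {..<n}" for w L
    using finite_subset[OF L finite_lessThan] L
  proof (induction L rule: finite_induct)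
    case empty
    show ?case using perm[of w] w by (simp add: lessThan_atLeast0)
  next
    case (insert k L)
    have "pull_sign n id L {k} = insert k L" using insert by (auto simp: pull_sign_def)
    then have "smat n w (insert k L) = smat n w L * t_gen n k"
      by (simp add: t_gen_smat smat_mult[OF id])
    then show ?case
      using deltas[OF smat_in_B[OF w] smat_in_B[OF id, of "{k}"]] insert t[of k] by (simp add: t_gen_smat)
  qed
  have "J (delta A) = K (delta A)" if "A \<in> carrier (B_group n)" for A
    using that all by (metis B_obtain)
  then have eq: "(\<lambda>x. \<Sum>h\<in>carrier (B_group n). f h * J (delta h) x) = (\<lambda>x. \<Sum>h\<in>carrier (B_group n). f h * K (delta h) x)"
    by (intro ext sum.cong refl) simp
  have "J f = (\<lambda>x. \<Sum>h\<in>carrier (B_group n). f h * J (delta h) x)"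
    by (rule algebra_hom_delta_expansion[OF LJ(1,2) finite_B f])
  also note eq
  also have "(\<lambda>x. \<Sum>h\<in>carrier (B_group n). f h * K (delta h) x) = K f"
    by (rule algebra_hom_delta_expansion[OF LK(1,2) finite_B f, symmetric])
  finally show ?thesis .
qed

theorem J_aut_eq: "J_aut n = restrict (fourier_J n) (GB n)"
proof -
  let ?A = "group_algebra (B_group n)"
  define P where "P J \<longleftrightarrow> J \<in> extensional (GB n) \<and> J \<in> algebra_iso ?A ?A \<and>
       (\<forall>i<n. J (delta (t_gen n i)) = delta (t_gen n i)) \<and>
       (\<forall>i. Suc i < n \<longrightarrow> J (delta (s_gen n i)) =
            (1 / 2) \<odot>\<^bsub>?A\<^esub> (delta (s_gen n i) \<otimes>\<^bsub>?A\<^esub>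
               ((1 - \<i>) \<odot>\<^bsub>?A\<^esub> delta (t_gen n i) \<oplus>\<^bsub>?A\<^esub> (1 + \<i>) \<odot>\<^bsub>?A\<^esub> delta (t_gen n (Suc i)))))" for J
  let ?J = "restrict (fourier_J n) (GB n)"
  have id: "id \<in> perms n" by (simp add: permutes_id)
  have t: "t_gen n i \<in> carrier (B_group n)" for i by (simp only: t_gen_smat smat_in_B[OF id])
  have s: "s_gen n i \<in> carrier (B_group n)" if "Suc i < n" for i
    using smat_in_B[OF transpose_in_perms[OF that]] that by (simp add: s_gen_smat)
  have iso: "?J \<in> algebra_iso ?A ?A"
    using algebra_iso_linear[OF fourier_J_iso[of n]]
    by (intro algebra_isoI) (auto simp: group_algebra_closed group_algebra_mult_closed[OF group_B finite_B]
        delta_in_group_algebra B_simps(3) smat_in_B[OF id] cong: bij_betw_cong)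
  have J: "P ?J"
    unfolding P_def
  proof (intro conjI allI impI)
    fix i
    show "?J (delta (t_gen n i)) = delta (t_gen n i)" if "i < n"
      using that fourier_J_delta_diagonal[of "{i}" n] t[of i] by (simp add: delta_in_group_algebra t_gen_smat)
    show "?J (delta (s_gen n i)) = (1 / 2) \<odot>\<^bsub>?A\<^esub> (delta (s_gen n i) \<otimes>\<^bsub>?A\<^esub>
         ((1 - \<i>) \<odot>\<^bsub>?A\<^esub> delta (t_gen n i) \<oplus>\<^bsub>?A\<^esub> (1 + \<i>) \<odot>\<^bsub>?A\<^esub> delta (t_gen n (Suc i))))" if "Suc i < n"
      unfolding group_algebra_simps(3,4)
      using fourier_J_s_gen[OF that] delta_in_group_algebra[OF s[OF that]] by simp
  qed (use iso in auto)
  have "(THE J. P J) = ?J"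
  proof (rule the_equality[where P = P, OF J])
    fix K assume P: "P K"
    have gen: "L (delta (t_gen n i)) = delta (t_gen n i)" if "P L" "i < n" for L i
      using that unfolding P_def by blast
    have gen': "K (delta (s_gen n i)) = ?J (delta (s_gen n i))" if "Suc i < n" for i
      using P J that unfolding P_def by metis
    have "K f = ?J f" if "f \<in> GB n" for f
    proof (rule algebra_hom_eq_on_generators[OF _ iso _ gen' that])
      show "K \<in> algebra_iso ?A ?A" using P unfolding P_def by blast
      show "K (delta (t_gen n i)) = ?J (delta (t_gen n i))" if "i < n" for i
        using gen[OF P that] gen[OF J that] by (rule trans[OF _ sym])
    qed
    moreover have "K \<in> extensional (GB n)" using P unfolding P_def by blast
    ultimately show "K = ?J" by (intro extensionalityI[of _ "GB n"]) simp_all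
  qed
  then show ?thesis by (simp only: J_aut_def Let_def P_def)
qed

section \<open>Restriction to the two subgroups of index two\<close>

lemma entry_prod_smat:
  assumes w: "w \<in> perms n"
  shows "entry_prod (smat n w K) = chi {..<n} K"
proof -
  have w_less: "w j < n" if "j < n" for j using perms_less[OF w] that by blast
  have S: "{(i, j). i < dim_row (smat n w K) \<and> j < dim_col (smat n w K) \<and> smat n w K $$ (i, j) \<noteq> 0} =
      (\<lambda>j. (w j, j)) ` {..<n}"
    using w_less by (auto simp: smat_def split: if_splits)
  have "inj_on (\<lambda>j. (w j, j)) {..<n}" by (auto simp: inj_on_def)
  then have "entry_prod (smat n w K) = (\<Prod>j<n. smat n w K $$ (w j, j))"
    unfolding entry_prod_def S by (simp add: prod.reindex)
  also have "\<dots> = chi {..<n} K"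
    unfolding chi_def using w_less by (intro prod.cong) (auto simp: smat_def)
  finally show ?thesis .
qed

lemma det_smat:
  assumes w: "w \<in> perms n"
  shows "det (smat n w K) = of_int (sign w) * chi {..<n} K"
proof -
  have other: "of_int (sign p) * (\<Prod>j<n. smat n w K $$ (p j, j)) = 0" if p: "p \<in> perms n" "p \<noteq> w" for p
  proof -
    obtain j where j: "p j \<noteq> w j" using p(2) by auto
    then have jn: "j < n" using p(1) w permutes_not_in by (metis lessThan_iff mem_Collect_eq)
    then have "smat n w K $$ (p j, j) = 0" using perms_less[OF p(1), of j] j by (simp add: smat_def)
    then show ?thesis using jn by (auto intro!: prod_zero bexI[of _ j])
  qed
  have "det (smat n w K) = (\<Sum>p\<in>perms n. of_int (sign p) * (\<Prod>j<n. smat n w K $$ (p j, j)))"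
    using det_col[OF smat_carrier, of n w K] by (simp add: lessThan_atLeast0)
  also have "\<dots> = of_int (sign w) * (\<Prod>j<n. smat n w K $$ (w j, j))"
    by (subst sum.remove[OF finite_perms w]) (use other in \<open>simp add: sum.neutral\<close>)
  also have "(\<Prod>j<n. smat n w K $$ (w j, j)) = chi {..<n} K"
    unfolding chi_def using perms_less[OF w] by (intro prod.cong) (auto simp: smat_def)
  finally show ?thesis .
qed

text \<open>Both subgroups are kernels of linear characters \<open>h\<close> of the form
  \<open>h (w t\<^sub>K) = a(w) (-1)\<^bsup>|K|\<^esup>\<close>: for \<open>D\<^sub>n\<close> take \<open>a = 1\<close>, for \<open>\<mu>(D\<^sub>n)\<close> take the sign.\<close>

abbreviation kernel_group :: "nat \<Rightarrow> (complex mat \<Rightarrow> complex) \<Rightarrow> complex mat monoid" where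
  "kernel_group n h \<equiv> (B_group n)\<lparr>carrier := {A \<in> carrier (B_group n). h A = 1}\<rparr>"

lemma group_kernel:
  assumes h: "\<And>w K. w \<in> perms n \<Longrightarrow> h (smat n w K) = a w * chi {..<n} K"
    and a: "\<And>w v. w \<in> perms n \<Longrightarrow> v \<in> perms n \<Longrightarrow> a (w \<circ> v) = a w * a v" "a id = 1"
  shows "group (kernel_group n h)" "finite (carrier (kernel_group n h))"
proof -
  interpret B: group "B_group n" by (rule group_B)
  have mult: "h (A \<otimes>\<^bsub>B_group n\<^esub> C) = h A * h C" if AB: "A \<in> carrier (B_group n)" and CB: "C \<in> carrier (B_group n)" for A C
  proof -
    obtain w K where A: "w \<in> perms n" "K \<subseteq> {..<n}" "A = smat n w K" using AB by (rule B_obtain)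
    obtain v L where C: "v \<in> perms n" "L \<subseteq> {..<n}" "C = smat n v L" using CB by (rule B_obtain)
    have "v ` {..<n} = {..<n}" using C(1) permutes_image by auto
    then show ?thesis
      by (simp add: A(3) C(3) B_simps(2) smat_mult[OF C(1)] h[OF A(1)] h[OF C(1)] h[OF perms_compose[OF A(1) C(1)]]
          a(1)[OF A(1) C(1)] chi_pull_sign[OF C(1)])
  qed
  have one: "h \<one>\<^bsub>B_group n\<^esub> = 1" using h[of id "{}"] by (simp add: B_simps(3) permutes_id a)
  have inv: "h (inv\<^bsub>B_group n\<^esub> A) = 1" if "A \<in> carrier (B_group n)" "h A = 1" for A
    using mult[of "inv\<^bsub>B_group n\<^esub> A" A] that one by simp
  have "subgroup {A \<in> carrier (B_group n). h A = 1} (B_group n)"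
    by (rule B.subgroupI) (use one in \<open>auto simp: mult inv\<close>)
  then show "group (kernel_group n h)" by (rule B.subgroup_imp_group)
  show "finite (carrier (kernel_group n h))" using finite_B by simp
qed

text \<open>An element is supported on the kernel of \<open>h\<close> iff multiplying its coefficients by \<open>h\<close> does not
  change it. As \<open>(-1)\<^bsup>|K|\<^esup>\<close> is the character of the full set, this multiplication replaces \<open>I\<close> by its
  complement in Fourier coordinates, up to the factor \<open>a(w)\<close>.\<close>

lemma kernel_algebra_iff:
  assumes h: "\<And>w K. w \<in> perms n \<Longrightarrow> h (smat n w K) = a w * chi {..<n} K"
    and a: "\<And>w. w \<in> perms n \<Longrightarrow> a w * a w = 1"
    and f: "f \<in> GB n"
  shows "f \<in> carrier (group_algebra (kernel_group n h)) \<longleftrightarrow>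
    (\<forall>w\<in>perms n. \<forall>I\<subseteq>{..<n}. fourier n f w ({..<n} - I) = a w * fourier n f w I)"
proof -
  (* Zero outside the group even though h is arbitrary there. *)
  let ?hf = "\<lambda>A. if A \<in> carrier (B_group n) then h A * f A else 0"
  have hf: "?hf \<in> GB n" by (simp add: group_algebra_simps)
  have F: "fourier n f w ({..<n} - I) = a w * fourier n ?hf w I" if w: "w \<in> perms n" and I: "I \<subseteq> {..<n}" for w I
  proof -
    have "chi ({..<n} - I) K * f (smat n w K) = a w * (chi I K * ?hf (smat n w K))" for K
      using a[OF w] by (simp add: chi_compl[OF I] h[OF w] smat_in_B[OF w])
    then show ?thesis by (simp add: fourier_def sum_distrib_left)
  qed
  have "f \<in> carrier (group_algebra (kernel_group n h)) \<longleftrightarrow> f = ?hf"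
    using f by (auto simp: group_algebra_simps fun_eq_iff)
  also have "\<dots> \<longleftrightarrow> (\<forall>w\<in>perms n. \<forall>I\<subseteq>{..<n}. fourier n f w I = fourier n ?hf w I)"
    using fourier_eqI[OF f hf] by auto
  also have "\<dots> \<longleftrightarrow> (\<forall>w\<in>perms n. \<forall>I\<subseteq>{..<n}. fourier n f w ({..<n} - I) = a w * fourier n f w I)"
  proof (intro ball_cong refl all_cong)
    fix w I assume w: "w \<in> perms n" and I: "I \<subseteq> {..<n}"
    have "a w \<noteq> 0" using a[OF w] by auto
    then show "fourier n f w I = fourier n ?hf w I \<longleftrightarrow> fourier n f w ({..<n} - I) = a w * fourier n f w I"
      by (auto simp: F[OF w I])
  qed
  finally show ?thesis .
qed

lemma D_kernel: "D_group n = kernel_group n entry_prod"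
  by (simp add: D_group_def)

lemma muD_kernel: "muD_group n = kernel_group n det"
  by (simp add: muD_group_def)

lemma group_D: "group (D_group n)" "finite (carrier (D_group n))"
  unfolding D_kernel using group_kernel[of n entry_prod "\<lambda>_. 1"] entry_prod_smat by auto

lemma group_muD: "group (muD_group n)" "finite (carrier (muD_group n))"
proof -
  have "permutation w" if "w \<in> perms n" for w using that permutation_permutes by blast
  then have "of_int (sign (w \<circ> v)) = of_int (sign w) * (of_int (sign v) :: complex)"
    if "w \<in> perms n" "v \<in> perms n" for w v
    using that by (simp add: sign_compose)
  then show "group (muD_group n)" "finite (carrier (muD_group n))"
    unfolding muD_kernel using group_kernel[of n det "\<lambda>w. of_int (sign w)"] det_smat by auto
qed

text \<open>By \<open>cocycle_compl\<close>, the sign of \<open>w\<close> in the criterion for \<open>\<mu>(D\<^sub>n)\<close> is absorbed by the cocycle.\<close>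

lemma fourier_J_muD_iff:
  assumes f: "f \<in> GB n"
  shows "fourier_J n f \<in> carrier (group_algebra (D_group n)) \<longleftrightarrow> f \<in> carrier (group_algebra (muD_group n))"
proof -
  have sq: "of_int (sign w) * of_int (sign w) = (1::complex)" for w :: "nat \<Rightarrow> nat"
    by (metis of_int_1 of_int_mult sign_idempotent)
  have "fourier_J n f \<in> carrier (group_algebra (D_group n)) \<longleftrightarrow> (\<forall>w\<in>perms n. \<forall>I\<subseteq>{..<n}.
      fourier n (fourier_J n f) w ({..<n} - I) = 1 * fourier n (fourier_J n f) w I)"
    unfolding D_kernel
    by (rule kernel_algebra_iff) (simp_all add: entry_prod_smat fourier_J_closed)
  also have "\<dots> \<longleftrightarrow> (\<forall>w\<in>perms n. \<forall>I\<subseteq>{..<n}. fourier n f w ({..<n} - I) = of_int (sign w) * fourier n f w I)"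
  proof (intro ball_cong refl all_cong)
    fix w I assume w: "w \<in> perms n" and I: "I \<subseteq> {..<n}"
    have "fourier n (fourier_J n f) w ({..<n} - I) = of_int (sign w) * cocycle n w I * fourier n f w ({..<n} - I)"
      using w cocycle_compl[of w n I] by (simp add: fourier_fourier_J)
    moreover have "of_int (sign w) * c * x = 1 * (c * y) \<longleftrightarrow> x = of_int (sign w) * y"
      if "c \<noteq> 0" for c x y :: complex
    proof -
      have "x = of_int (sign w) * y \<longleftrightarrow> of_int (sign w) * x = y"
        using sq[of w] by (metis mult.assoc mult_1)
      moreover have "of_int (sign w) * c * x = 1 * (c * y) \<longleftrightarrow> c * (of_int (sign w) * x) = c * y"
        by (simp add: mult.left_commute mult.assoc)
      ultimately show ?thesis using that by simp
    qed
    moreover have "cocycle n w I \<noteq> 0" using w cocycle_nonzero[of w n I] by simp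
    ultimately show "fourier n (fourier_J n f) w ({..<n} - I) = 1 * fourier n (fourier_J n f) w I \<longleftrightarrow>
        fourier n f w ({..<n} - I) = of_int (sign w) * fourier n f w I"
      by (simp only: fourier_fourier_J[OF w I])
  qed
  also have "\<dots> \<longleftrightarrow> f \<in> carrier (group_algebra (muD_group n))"
    unfolding muD_kernel
    by (rule kernel_algebra_iff[symmetric]) (simp_all add: det_smat sq f)
  finally show ?thesis .
qed

lemma subgroup_algebra_mult:
  assumes fin: "finite (carrier G)" and S: "S \<subseteq> carrier G"
    and f: "f \<in> carrier (group_algebra (G\<lparr>carrier := S\<rparr>))" and g: "g \<in> carrier (group_algebra (G\<lparr>carrier := S\<rparr>))"
  shows "f \<otimes>\<^bsub>group_algebra (G\<lparr>carrier := S\<rparr>)\<^esub> g = f \<otimes>\<^bsub>group_algebra G\<^esub> g"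
proof
  fix x
  have fin': "finite (carrier (G\<lparr>carrier := S\<rparr>))" using finite_subset[OF S fin] by simp
  have 0: "f y = 0" "g y = 0" if "y \<notin> S" for y using that f g by (auto simp: group_algebra_simps)
  show "(f \<otimes>\<^bsub>group_algebra (G\<lparr>carrier := S\<rparr>)\<^esub> g) x = (f \<otimes>\<^bsub>group_algebra G\<^esub> g) x"
    unfolding group_algebra_mult[OF fin] group_algebra_mult[OF fin']
    using S fin by (intro sum.mono_neutral_cong_left) (auto simp: 0 intro!: sum.mono_neutral_left sum.neutral)
qed

lemma kernel_algebra_subset: "carrier (group_algebra (kernel_group n h)) \<subseteq> GB n"
  by (auto simp: group_algebra_simps)

theorem J_aut_muD_iso:
  "J_aut n \<in> algebra_iso (group_algebra (muD_group n)) (group_algebra (D_group n))"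
proof -
  let ?M = "carrier (group_algebra (muD_group n))" and ?D = "carrier (group_algebra (D_group n))"
  have sub: "?M \<subseteq> GB n" "?D \<subseteq> GB n" unfolding D_kernel muD_kernel by (rule kernel_algebra_subset)+
  have eq: "J_aut n f = fourier_J n f" if "f \<in> ?M" for f using that sub by (auto simp: J_aut_eq)
  have J: "fourier_J n f \<in> ?D" if "f \<in> ?M" for f using that sub fourier_J_muD_iff by blast
  have multM: "f \<otimes>\<^bsub>group_algebra (muD_group n)\<^esub> g = f \<otimes>\<^bsub>group_algebra (B_group n)\<^esub> g"
    if "f \<in> ?M" "g \<in> ?M" for f g
    using that unfolding muD_kernel by (intro subgroup_algebra_mult[OF finite_B]) auto
  have multD: "f \<otimes>\<^bsub>group_algebra (D_group n)\<^esub> g = f \<otimes>\<^bsub>group_algebra (B_group n)\<^esub> g"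
    if "f \<in> ?D" "g \<in> ?D" for f g
    using that unfolding D_kernel by (intro subgroup_algebra_mult[OF finite_B]) auto
  have one: "\<one>\<^bsub>muD_group n\<^esub> = smat n id {}" "\<one>\<^bsub>D_group n\<^esub> = smat n id {}"
    using B_simps(3)[of n] by (simp_all add: muD_group_def D_group_def)
  have bij: "bij_betw (fourier_J n) ?M ?D"
    unfolding bij_betw_def
  proof
    show "inj_on (fourier_J n) ?M" using bij_fourier_J sub(1) by (metis bij_betw_def inj_on_subset)
    show "fourier_J n ` ?M = ?D"
    proof (intro equalityI subsetI)
      fix g assume g: "g \<in> ?D"
      then have "g \<in> fourier_J n ` GB n" using bij_betw_imp_surj_on[OF bij_fourier_J[of n]] sub(2) by blast
      then obtain f where "f \<in> GB n" "g = fourier_J n f" by blast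
      then show "g \<in> fourier_J n ` ?M" using g fourier_J_muD_iff by blast
    qed (use J in auto)
  qed
  show ?thesis
  proof (rule algebra_isoI)
    fix f g assume fg: "f \<in> ?M" "g \<in> ?M"
    show "J_aut n (f \<otimes>\<^bsub>group_algebra (muD_group n)\<^esub> g) = J_aut n f \<otimes>\<^bsub>group_algebra (D_group n)\<^esub> J_aut n g"
      using fg group_algebra_mult_closed[OF group_muD, of n f g]
      by (simp add: eq multD J multM fourier_J_mult)
  next
    have "delta (\<one>\<^bsub>muD_group n\<^esub>) \<in> ?M"
      using group_muD(1) by (intro delta_in_group_algebra) (simp add: group.is_monoid monoid.one_closed)
    then show "J_aut n (delta \<one>\<^bsub>muD_group n\<^esub>) = delta \<one>\<^bsub>D_group n\<^esub>"
      using fourier_J_delta_diagonal[of "{}" n] by (simp add: eq) (simp add: one)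
  next
    show "bij_betw (J_aut n) ?M ?D" using bij by (simp add: eq cong: bij_betw_cong)
  qed (simp_all add: eq J fourier_J_linear group_algebra_closed)
qed

section \<open>Characters labelled by bipartitions\<close>

text \<open>The permutations of \<open>{1..a}\<close> and \<open>{1..b}\<close> that a permutation of \<open>{..<a + b}\<close> induces on its
  first \<open>a\<close> and its last \<open>b\<close> points. Matrix indices start at 0, whereas symmetric groups act on
  numbers from 1.\<close>

definition upper_block :: "nat \<Rightarrow> (nat \<Rightarrow> nat) \<Rightarrow> nat \<Rightarrow> nat" where
  "upper_block a u j = (if j \<in> {1..a} then u (j - 1) + 1 else j)"

definition lower_block :: "nat \<Rightarrow> nat \<Rightarrow> (nat \<Rightarrow> nat) \<Rightarrow> nat \<Rightarrow> nat" where
  "lower_block a b u j = (if j \<in> {1..b} then u (j - 1 + a) - a + 1 else j)"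

lemma perm_of_smat:
  assumes y: "y \<in> perms b"
  shows "perm_of b (smat b y L) j = (if j \<in> {1..b} then y (j - 1) + 1 else j)"
proof (cases "j \<in> {1..b}")
  case True
  then have yj: "y (j - 1) < b" using perms_less[OF y, of "j - 1"] by auto
  have "(THE i. i \<in> {1..b} \<and> smat b y L $$ (i - 1, j - 1) \<noteq> 0) = y (j - 1) + 1"
  proof (rule the_equality)
    show "y (j - 1) + 1 \<in> {1..b} \<and> smat b y L $$ (y (j - 1) + 1 - 1, j - 1) \<noteq> 0"
      using True yj by (auto simp: smat_def)
    fix i assume i: "i \<in> {1..b} \<and> smat b y L $$ (i - 1, j - 1) \<noteq> 0"
    then have "i - 1 = y (j - 1)" using True by (auto simp: smat_def split: if_splits)
    then show "i = y (j - 1) + 1" using i by auto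
  qed
  then show ?thesis using True by (simp add: perm_of_def)
next
  case False
  then show ?thesis unfolding perm_of_def by (simp only: if_False)
qed

lemma preserves_iff:
  assumes u: "u \<in> perms (a + b)" and pres: "u ` {..<a} = {..<a}"
  shows "u i < a \<longleftrightarrow> i < a"
proof -
  have "inj u" using u permutes_inj by blast
  then show ?thesis using pres inj_image_mem_iff[of u i "{..<a}"] by simp
qed

lemma block_perms:
  assumes u: "u \<in> perms (a + b)" and pres: "u ` {..<a} = {..<a}"
  shows "(\<lambda>j. if j < a then u j else j) \<in> perms a" "(\<lambda>j. if j < b then u (j + a) - a else j) \<in> perms b"
proof -
  note iff = preserves_iff[OF u pres]
  have inj: "inj u" using u permutes_inj by blast
  have "bij_betw u {..<a} {..<a}" using pres inj by (simp add: bij_betw_def inj_on_subset[OF inj])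
  then have "bij_betw (\<lambda>j. if j < a then u j else j) {..<a} {..<a}"
    by (subst bij_betw_cong[of _ _ u]) auto
  then show "(\<lambda>j. if j < a then u j else j) \<in> perms a"
    unfolding mem_Collect_eq by (rule bij_imp_permutes) auto
  let ?f = "\<lambda>j. if j < b then u (j + a) - a else j"
  have ge: "a \<le> u (j + a)" for j using iff[of "j + a"] by simp
  have less: "u (j + a) < a + b" if "j < b" for j using perms_less[OF u, of "j + a"] that by simp
  have "inj_on ?f {..<b}"
  proof (rule inj_onI)
    fix i j assume "i \<in> {..<b}" "j \<in> {..<b}" "?f i = ?f j"
    then have "u (i + a) - a = u (j + a) - a" by simp
    then have "u (i + a) = u (j + a)" by (rule eq_diff_iff[OF ge ge, THEN iffD1])
    then have "i + a = j + a" by (rule injD[OF inj])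
    then show "i = j" by simp
  qed
  moreover have "?f ` {..<b} \<subseteq> {..<b}" using less ge by (auto simp: less_diff_conv2 add.commute[of b])
  ultimately have "bij_betw ?f {..<b} {..<b}"
    using endo_inj_surj[OF finite_lessThan, of ?f b] unfolding bij_betw_def by blast
  then show "?f \<in> perms b" unfolding mem_Collect_eq by (rule bij_imp_permutes) auto
qed

lemma smat_block:
  assumes u: "u \<in> perms (a + b)" and pres: "u ` {..<a} = {..<a}"
  shows "smat (a + b) u K = four_block_mat (smat a (\<lambda>j. if j < a then u j else j) K) (0\<^sub>m a b) (0\<^sub>m b a)
     (smat b (\<lambda>j. if j < b then u (j + a) - a else j) {j. j + a \<in> K})"
    (is "_ = ?r")
proof (rule eq_matI)
  note iff = preserves_iff[OF u pres]
  fix i j assume "i < dim_row ?r" "j < dim_col ?r"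
  then have ij: "i < a + b" "j < a + b" by (simp_all add: smat_def)
  consider "i < a" "j < a" | "i < a" "a \<le> j" | "a \<le> i" "j < a" | "a \<le> i" "a \<le> j" by linarith
  then show "smat (a + b) u K $$ (i, j) = ?r $$ (i, j)"
  proof cases
    case 4
    then have "a \<le> u j" using iff[of j] by simp
    then have "i - a = u j - a \<longleftrightarrow> i = u j" using 4 by linarith
    then show ?thesis using 4 ij by (auto simp: smat_def sgn_set_def)
  qed (use ij iff[of j] in \<open>auto simp: smat_def sgn_set_def\<close>)
qed (simp_all add: smat_def)

lemma smat_block_iff:
  assumes u: "u \<in> perms (a + b)"
  shows "smat (a + b) u K \<in> block_subgroup a b \<longleftrightarrow> u ` {..<a} = {..<a}"
proof
  assume pres: "u ` {..<a} = {..<a}"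
  show "smat (a + b) u K \<in> block_subgroup a b"
    unfolding block_subgroup_def smat_block[OF u pres] mem_Collect_eq
    using smat_in_B[OF block_perms(1)[OF u pres]] smat_in_B[OF block_perms(2)[OF u pres]] by blast
next
  assume "smat (a + b) u K \<in> block_subgroup a b"
  then obtain X Y where XY: "smat (a + b) u K = four_block_mat X (0\<^sub>m a b) (0\<^sub>m b a) Y"
    "X \<in> carrier_mat a a" "Y \<in> carrier_mat b b"
    by (auto simp: block_subgroup_def B_simps signed_monomial_def)
  have "u j < a" if j: "j < a" for j
  proof (rule ccontr)
    assume n: "\<not> u j < a"
    have uj: "u j < a + b" using perms_less[OF u, of j] j by simp
    have "smat (a + b) u K $$ (u j, j) = 0" unfolding XY(1) using XY(2,3) n uj j by simp
    then show False using uj j by (simp add: smat_def)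
  qed
  then have "u ` {..<a} \<subseteq> {..<a}" by auto
  moreover have "inj_on u {..<a}" using u permutes_inj_on by blast
  ultimately show "u ` {..<a} = {..<a}" by (simp add: endo_inj_surj)
qed

definition block_char :: "nat list \<Rightarrow> nat list \<Rightarrow> complex mat \<Rightarrow> complex" where
  "block_char \<alpha> \<beta> M = (case split_block M (sum_list \<alpha>) (sum_list \<alpha>) of (X, _, _, Y) \<Rightarrow>
      pullback_char \<alpha> X * (entry_prod Y * pullback_char \<beta> Y))"

lemma block_char_smat:
  assumes u: "u \<in> perms (sum_list \<alpha> + sum_list \<beta>)" and pres: "u ` {..<sum_list \<alpha>} = {..<sum_list \<alpha>}"
  shows "block_char \<alpha> \<beta> (smat (sum_list \<alpha> + sum_list \<beta>) u K) =
    sym_char \<alpha> (upper_block (sum_list \<alpha>) u) * (chi {sum_list \<alpha>..<sum_list \<alpha> + sum_list \<beta>} K *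
    sym_char \<beta> (lower_block (sum_list \<alpha>) (sum_list \<beta>) u))"
proof -
  let ?a = "sum_list \<alpha>" and ?b = "sum_list \<beta>"
  let ?X = "smat ?a (\<lambda>j. if j < ?a then u j else j) K"
  let ?Y = "smat ?b (\<lambda>j. if j < ?b then u (j + ?a) - ?a else j) {j. j + ?a \<in> K}"
  note p = block_perms[OF u pres]
  have "split_block (smat (?a + ?b) u K) ?a ?a = (?X, 0\<^sub>m ?a ?b, 0\<^sub>m ?b ?a, ?Y)"
    unfolding smat_block[OF u pres] split_block_def Let_def
    by (auto intro!: eq_matI simp: smat_def)
  then have "block_char \<alpha> \<beta> (smat (?a + ?b) u K) = pullback_char \<alpha> ?X * (entry_prod ?Y * pullback_char \<beta> ?Y)"
    by (simp add: block_char_def)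
  moreover have "perm_of ?a ?X = upper_block ?a u"
    by (rule ext) (auto simp: perm_of_smat[OF p(1)] upper_block_def)
  moreover have "perm_of ?b ?Y = lower_block ?a ?b u"
    by (rule ext) (auto simp: perm_of_smat[OF p(2)] lower_block_def)
  moreover have "entry_prod ?Y = chi {?a..<?a + ?b} K"
  proof -
    have "entry_prod ?Y = (\<Prod>j<?b. sgn_set K (j + ?a))"
      by (simp add: entry_prod_smat[OF p(2)] chi_def sgn_set_def)
    also have "\<dots> = chi {?a..<?a + ?b} K"
      unfolding chi_def
      by (rule prod.reindex_bij_witness[of _ "\<lambda>j. j - ?a" "\<lambda>j. j + ?a"]) auto
    finally show ?thesis .
  qed
  ultimately show ?thesis by (simp add: pullback_char_def)
qed

text \<open>The part that depends on permutations only in the summand of the induced character that belongs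
  to conjugation by \<open>v t\<^sub>L\<close>.\<close>

definition conjugate_weight :: "nat list \<Rightarrow> nat list \<Rightarrow> (nat \<Rightarrow> nat) \<Rightarrow> (nat \<Rightarrow> nat) \<Rightarrow> complex" where
  "conjugate_weight \<alpha> \<beta> v w = (let u = inv' v \<circ> w \<circ> v in
     if u ` {..<sum_list \<alpha>} = {..<sum_list \<alpha>}
     then sym_char \<alpha> (upper_block (sum_list \<alpha>) u) * sym_char \<beta> (lower_block (sum_list \<alpha>) (sum_list \<beta>) u) else 0)"

definition conjugate_block_char :: "nat list \<Rightarrow> nat list \<Rightarrow> complex mat \<Rightarrow> complex mat \<Rightarrow> complex" where
  "conjugate_block_char \<alpha> \<beta> x g =
    (let y = inv\<^bsub>B_group (sum_list \<alpha> + sum_list \<beta>)\<^esub> x \<otimes>\<^bsub>B_group (sum_list \<alpha> + sum_list \<beta>)\<^esub> g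
        \<otimes>\<^bsub>B_group (sum_list \<alpha> + sum_list \<beta>)\<^esub> x
     in if y \<in> block_subgroup (sum_list \<alpha>) (sum_list \<beta>) then block_char \<alpha> \<beta> y else 0)"

lemma bipartition_char_eq:
  "bipartition_char \<alpha> \<beta> = (\<lambda>g\<in>carrier (B_group (sum_list \<alpha> + sum_list \<beta>)).
     (\<Sum>x\<in>carrier (B_group (sum_list \<alpha> + sum_list \<beta>)). conjugate_block_char \<alpha> \<beta> x g) /
     of_nat (card (block_subgroup (sum_list \<alpha>) (sum_list \<beta>))))"
  unfolding bipartition_char_def induced_char_def conjugate_block_char_def block_char_def Let_def by (rule refl)

lemma preserves_complement:
  assumes u: "u \<in> perms (a + b)" and pres: "u ` {..<a} = {..<a}"
  shows "u ` {a..<a + b} = {a..<a + b}"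
proof -
  have "{a..<a + b} = {..<a + b} - {..<a}" by auto
  moreover have "u ` ({..<a + b} - {..<a}) = u ` {..<a + b} - u ` {..<a}"
    using u permutes_inj by (intro image_set_diff) blast
  ultimately show ?thesis using pres u permutes_image[of u "{..<a + b}"] by simp
qed

text \<open>Let \<open>u = v\<^sup>-\<^sup>1 w v\<close>. At position \<open>j\<close>, conjugation by \<open>v t\<^sub>L\<close> contributes the signs of \<open>L\<close> at
  \<open>u j\<close> and at \<open>j\<close>. If \<open>u\<close> preserves the final segment, their product over that segment is \<open>1\<close>, so
  \<open>L\<close> disappears and only the character labelled by the \<open>v\<close>-image of the segment remains.\<close>

lemma conjugate_block_char_smat:
  fixes \<alpha> \<beta> :: "nat list"
  defines "n \<equiv> sum_list \<alpha> + sum_list \<beta>"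
  assumes v: "v \<in> perms n" and L: "L \<subseteq> {..<n}" and w: "w \<in> perms n" and K: "K \<subseteq> {..<n}"
  shows "conjugate_block_char \<alpha> \<beta> (smat n v L) (smat n w K) =
    conjugate_weight \<alpha> \<beta> v w * chi (v ` {sum_list \<alpha>..<n}) K"
proof -
  interpret B: group "B_group n" by (rule group_B)
  let ?a = "sum_list \<alpha>" and ?b = "sum_list \<beta>"
  let ?x = "smat n v L" and ?g = "smat n w K"
  let ?C = "{?a..<n}"
  have x: "?x \<in> carrier (B_group n)" and g: "?g \<in> carrier (B_group n)" by (rule smat_in_B v w)+
  define y where "y = inv\<^bsub>B_group n\<^esub> ?x \<otimes>\<^bsub>B_group n\<^esub> ?g \<otimes>\<^bsub>B_group n\<^esub> ?x"
  have "y \<in> carrier (B_group n)" unfolding y_def by (intro B.m_closed B.inv_closed x g)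
  then obtain u M where u: "u \<in> perms n" "M \<subseteq> {..<n}" "y = smat n u M" by (rule B_obtain)
  have "?x \<otimes>\<^bsub>B_group n\<^esub> y = ?g \<otimes>\<^bsub>B_group n\<^esub> ?x"
    unfolding y_def using x g by (simp add: B.m_assoc[symmetric])
  then have "smat n (v \<circ> u) (pull_sign n u L M) = smat n (w \<circ> v) (pull_sign n v K L)"
    by (simp only: u(3) B_simps(2) smat_mult[OF u(1)] smat_mult[OF v])
  then have eq: "v \<circ> u = w \<circ> v" "pull_sign n u L M = pull_sign n v K L"
    using smat_eqD[OF _ perms_compose[OF v u(1)] perms_compose[OF w v] pull_sign_subset pull_sign_subset] by blast+
  have "inv' v \<circ> (v \<circ> u) = u" using v permutes_inv_o(2)[of v "{..<n}"] by (simp only: mem_Collect_eq comp_assoc[symmetric] id_comp)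
  then have u_eq: "inv' v \<circ> w \<circ> v = u" by (simp only: eq(1) comp_assoc)
  have u': "u \<in> perms (?a + ?b)" using u(1) by (simp add: n_def)
  have "conjugate_block_char \<alpha> \<beta> ?x ?g = (if y \<in> block_subgroup ?a ?b then block_char \<alpha> \<beta> y else 0)"
    by (simp only: conjugate_block_char_def Let_def y_def n_def)
  also have "\<dots> = conjugate_weight \<alpha> \<beta> v w * chi (v ` ?C) K"
  proof (cases "u ` {..<?a} = {..<?a}")
    case True
    have C: "?C \<subseteq> {..<n}" by auto
    have uC: "u ` ?C = ?C" using preserves_complement[OF u' True] by (simp add: n_def)
    have "chi ?C L * chi ?C M = chi (v ` ?C) K * chi ?C L"
      using chi_pull_sign[OF u(1) C, of L M] chi_pull_sign[OF v C, of K L] by (simp only: eq(2) uC)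
    then have "chi ?C L * (chi ?C L * chi ?C M) = chi ?C L * (chi (v ` ?C) K * chi ?C L)" by simp
    then have "chi ?C M = chi (v ` ?C) K"
      using chi_square[of ?C L] by (simp add: mult.left_commute mult.assoc[symmetric])
    moreover have "y \<in> block_subgroup ?a ?b" using True smat_block_iff[OF u', of M] u(3) by (simp add: n_def)
    moreover have "block_char \<alpha> \<beta> y = sym_char \<alpha> (upper_block ?a u) * (chi ?C M * sym_char \<beta> (lower_block ?a ?b u))"
      using block_char_smat[OF u' True, of M] u(3) by (simp add: n_def)
    ultimately show ?thesis using True by (simp add: conjugate_weight_def u_eq)
  next
    case False
    then have "y \<notin> block_subgroup ?a ?b" using smat_block_iff[OF u', of M] u(3) by (simp add: n_def)
    then show ?thesis using False by (simp add: conjugate_weight_def u_eq)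
  qed
  finally show ?thesis .
qed

text \<open>The weight vanishes unless \<open>w\<close> preserves the \<open>v\<close>-image of the final segment. In that case the
  cocycle is the sign of the permutation induced on the second block, by which \<open>\<chi>\<^sub>\<beta>\<close> and the
  character of the conjugate partition differ.\<close>

lemma conjugate_weight_cocycle:
  fixes \<alpha> \<beta> :: "nat list"
  defines "n \<equiv> sum_list \<alpha> + sum_list \<beta>"
  assumes \<beta>: "is_partition \<beta>" and v: "v \<in> perms n" and w: "w \<in> perms n"
  shows "conjugate_weight \<alpha> \<beta> v w * cocycle n w (v ` {sum_list \<alpha>..<n}) =
    conjugate_weight \<alpha> (conjugate_partition \<beta>) v w"
proof -
  let ?a = "sum_list \<alpha>" and ?b = "sum_list \<beta>"
  let ?C = "{?a..<n}"
  define u where "u = inv' v \<circ> w \<circ> v"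
  have u: "u \<in> perms n" unfolding u_def by (intro perms_compose perms_inv v w)
  then have u': "u \<in> perms (?a + ?b)" by (simp add: n_def)
  have eq: "w \<circ> v = v \<circ> u"
    unfolding u_def using v permutes_inv_o(1)[of v "{..<n}"] by (simp only: mem_Collect_eq comp_assoc[symmetric] id_comp)
  show ?thesis
  proof (cases "u ` {..<?a} = {..<?a}")
    case True
    let ?q = "lower_block ?a ?b u"
    have iff: "u i < ?a \<longleftrightarrow> i < ?a" for i by (rule preserves_iff[OF u' True])
    have less: "u i < ?a + ?b \<longleftrightarrow> i < ?a + ?b" for i by (rule perms_less[OF u'])
    have ge: "?a \<le> u (k + ?a)" for k using iff[of "k + ?a"] by simp
    have q: "?q permutes {1..?b}"
    proof (rule bij_imp_permutes)
      have "inj_on ?q {1..?b}"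
      proof (rule inj_onI)
        fix i j assume ij: "i \<in> {1..?b}" "j \<in> {1..?b}" "?q i = ?q j"
        have "u (i - 1 + ?a) - ?a = u (j - 1 + ?a) - ?a" using ij by (simp add: lower_block_def)
        then have "u (i - 1 + ?a) = u (j - 1 + ?a)" by (rule eq_diff_iff[OF ge ge, THEN iffD1])
        moreover have "inj u" using u permutes_inj by blast
        ultimately have "i - 1 + ?a = j - 1 + ?a" by (simp only: inj_eq)
        then show "i = j" using ij by auto
      qed
      moreover have "?q ` {1..?b} \<subseteq> {1..?b}"
      proof clarsimp
        fix j assume j: "Suc 0 \<le> j" "j \<le> ?b"
        then show "Suc 0 \<le> ?q j \<and> ?q j \<le> ?b"
          using less[of "j - 1 + ?a"] iff[of "j - 1 + ?a"] by (auto simp: lower_block_def)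
      qed
      ultimately show "bij_betw ?q {1..?b} {1..?b}" by (simp add: bij_betw_def endo_inj_surj)
    qed (auto simp: lower_block_def)
    have "cocycle n w (v ` ?C) = cocycle n u ?C"
      using v w u eq preserves_complement[OF u' True] by (intro cocycle_conjugate) (simp_all add: n_def)
    also have "\<dots> = of_int (sign ?q)"
      unfolding n_def
    proof (rule cocycle_block[OF _ True q])
      show "u permutes {..<?a + ?b}" using u' by simp
      show "u (j - 1 + ?a) = ?q j - 1 + ?a" if "j \<in> {1..?b}" for j
        using that ge[of "j - 1"] by (simp add: lower_block_def)
    qed
    finally show ?thesis
      using sym_char_conjugate[OF \<beta> q] True
      by (simp add: conjugate_weight_def u_def[symmetric] sum_list_conjugate[OF \<beta>])
  next
    case False
    then show ?thesis by (simp add: conjugate_weight_def u_def[symmetric])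
  qed
qed

text \<open>Each summand of the induced character is a function of \<open>w\<close> times a fixed character of the
  diagonal subgroup, so pairing it with \<open>J h\<close> evaluates a single Fourier coefficient and yields a
  value of the cocycle. This gives the correspondence of labels on all of \<open>B\<^sub>n\<close>, from which the
  one for the two subgroups follows by restriction.\<close>

theorem bipartition_char_fourier_J:
  fixes \<alpha> \<beta> :: "nat list"
  defines "n \<equiv> sum_list \<alpha> + sum_list \<beta>"
  assumes \<beta>: "is_partition \<beta>" and h: "h \<in> carrier (B_group n)"
  shows "(\<Sum>g\<in>carrier (B_group n). fourier_J n (delta h) g * bipartition_char \<alpha> \<beta> g) =
    bipartition_char \<alpha> (conjugate_partition \<beta>) h"
proof -
  let ?\<beta> = "conjugate_partition \<beta>" and ?B = "carrier (B_group n)"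
  let ?c = "of_nat (card (block_subgroup (sum_list \<alpha>) (sum_list \<beta>))) :: complex"
  have sl: "sum_list ?\<beta> = sum_list \<beta>" by (rule sum_list_conjugate[OF \<beta>])
  obtain w K where w: "w \<in> perms n" "K \<subseteq> {..<n}" "h = smat n w K" using h by (rule B_obtain)
  have key: "(\<Sum>g\<in>?B. fourier_J n (delta h) g * conjugate_block_char \<alpha> \<beta> x g) = conjugate_block_char \<alpha> ?\<beta> x h"
    if x: "x \<in> ?B" for x
  proof -
    obtain v L where v: "v \<in> perms n" "L \<subseteq> {..<n}" "x = smat n v L" using x by (rule B_obtain)
    let ?I = "v ` {sum_list \<alpha>..<n}"
    have I: "?I \<subseteq> {..<n}" by (rule perms_image_subset[OF v(1)]) auto
    have "(\<Sum>g\<in>?B. fourier_J n (delta h) g * conjugate_block_char \<alpha> \<beta> x g) =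
       (\<Sum>w'\<in>perms n. \<Sum>K'\<in>Pow {..<n}. conjugate_weight \<alpha> \<beta> v w' * (chi ?I K' * fourier_J n (delta h) (smat n w' K')))"
      unfolding sum_B
    proof (intro sum.cong refl)
      fix w' K' assume w': "w' \<in> perms n" and K': "K' \<in> Pow {..<n}"
      have "conjugate_block_char \<alpha> \<beta> x (smat n w' K') = conjugate_weight \<alpha> \<beta> v w' * chi ?I K'"
        unfolding v(3) n_def
        by (rule conjugate_block_char_smat) (use v w' K' in \<open>simp_all add: n_def\<close>)
      then show "fourier_J n (delta h) (smat n w' K') * conjugate_block_char \<alpha> \<beta> x (smat n w' K') =
          conjugate_weight \<alpha> \<beta> v w' * (chi ?I K' * fourier_J n (delta h) (smat n w' K'))" by simp
    qed
    also have "\<dots> = (\<Sum>w'\<in>perms n. conjugate_weight \<alpha> \<beta> v w' * fourier n (fourier_J n (delta h)) w' ?I)"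
      by (simp add: fourier_def sum_distrib_left)
    also have "\<dots> = (\<Sum>w'\<in>perms n. if w' = w then conjugate_weight \<alpha> \<beta> v w' * (cocycle n w' ?I * chi ?I K) else 0)"
    proof (rule sum.cong[OF refl])
      fix w' assume w': "w' \<in> perms n"
      show "conjugate_weight \<alpha> \<beta> v w' * fourier n (fourier_J n (delta h)) w' ?I =
          (if w' = w then conjugate_weight \<alpha> \<beta> v w' * (cocycle n w' ?I * chi ?I K) else 0)"
        unfolding fourier_fourier_J[OF w' I] w(3) fourier_delta[OF w' w(1,2)] by simp
    qed
    also have "\<dots> = conjugate_weight \<alpha> \<beta> v w * cocycle n w ?I * chi ?I K"
      using w(1) by (simp add: finite_perms mult.assoc)
    also have "\<dots> = conjugate_weight \<alpha> ?\<beta> v w * chi ?I K"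
      using conjugate_weight_cocycle[OF \<beta>, of v \<alpha> w] v(1) w(1) by (simp add: n_def)
    also have "\<dots> = conjugate_block_char \<alpha> ?\<beta> x h"
      using conjugate_block_char_smat[of v \<alpha> ?\<beta> L w K] v w by (simp add: n_def sl)
    finally show ?thesis .
  qed
  have "(\<Sum>g\<in>?B. fourier_J n (delta h) g * bipartition_char \<alpha> \<beta> g) =
      (\<Sum>g\<in>?B. \<Sum>x\<in>?B. fourier_J n (delta h) g * conjugate_block_char \<alpha> \<beta> x g / ?c)"
    by (intro sum.cong refl) (simp add: bipartition_char_eq n_def sum_distrib_left sum_divide_distrib)
  also have "\<dots> = (\<Sum>x\<in>?B. \<Sum>g\<in>?B. fourier_J n (delta h) g * conjugate_block_char \<alpha> \<beta> x g / ?c)"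
    by (rule sum.swap)
  also have "\<dots> = (\<Sum>x\<in>?B. conjugate_block_char \<alpha> ?\<beta> x h / ?c)"
    by (intro sum.cong refl) (simp add: key flip: sum_divide_distrib)
  also have "\<dots> = bipartition_char \<alpha> ?\<beta> h"
    using h by (simp add: bipartition_char_eq sl n_def sum_divide_distrib)
  finally show ?thesis .
qed

lemma precompose_D_char:
  assumes bip: "is_bipartition n \<alpha> \<beta>"
  shows "precompose (D_group n) (muD_group n) (J_aut n) (D_char n \<alpha> \<beta>) = muD_char n \<alpha> (conjugate_partition \<beta>)"
proof
  fix h
  have n: "n = sum_list \<alpha> + sum_list \<beta>" and \<beta>: "is_partition \<beta>" using bip by (auto simp: is_bipartition_def)
  show "precompose (D_group n) (muD_group n) (J_aut n) (D_char n \<alpha> \<beta>) h = muD_char n \<alpha> (conjugate_partition \<beta>) h"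
  proof (cases "h \<in> carrier (muD_group n)")
    case True
    have hB: "h \<in> carrier (B_group n)" using True by (simp add: muD_kernel)
    have \<delta>: "delta h \<in> carrier (group_algebra (muD_group n))" by (rule delta_in_group_algebra[OF True])
    have \<delta>B: "delta h \<in> GB n" by (rule delta_in_group_algebra[OF hB])
    have J: "fourier_J n (delta h) \<in> carrier (group_algebra (D_group n))"
      using fourier_J_muD_iff[OF \<delta>B] \<delta> by simp
    have "precompose (D_group n) (muD_group n) (J_aut n) (D_char n \<alpha> \<beta>) h =
        (\<Sum>g\<in>carrier (D_group n). fourier_J n (delta h) g * D_char n \<alpha> \<beta> g)"
      using True \<delta>B by (simp add: precompose_def linear_ext_def J_aut_eq)
    also have "\<dots> = (\<Sum>g\<in>carrier (D_group n). fourier_J n (delta h) g * bipartition_char \<alpha> \<beta> g)"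
      by (intro sum.cong refl) (simp add: D_char_def)
    also have "\<dots> = (\<Sum>g\<in>carrier (B_group n). fourier_J n (delta h) g * bipartition_char \<alpha> \<beta> g)"
      using J finite_B[of n] by (intro sum.mono_neutral_left) (auto simp: D_kernel group_algebra_simps)
    also have "\<dots> = bipartition_char \<alpha> (conjugate_partition \<beta>) h"
      using bipartition_char_fourier_J[OF \<beta>, of h \<alpha>] hB n by simp
    finally show ?thesis using True by (simp add: muD_char_def)
  next
    case False
    then show ?thesis by (simp add: precompose_def muD_char_def)
  qed
qed

theorem proposition3p6:
  fixes n :: nat
  assumes "n \<ge> 1"
  shows "J_aut n \<in> algebra_iso (group_algebra (muD_group n)) (group_algebra (D_group n)) \<and>
    bij_betw (precompose (D_group n) (muD_group n) (J_aut n))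
      (irr_chars (D_group n)) (irr_chars (muD_group n)) \<and>
    (\<forall>\<alpha> \<beta>. is_bipartition n \<alpha> \<beta> \<and> \<alpha> \<noteq> \<beta> \<longrightarrow>
      precompose (D_group n) (muD_group n) (J_aut n) (D_char n \<alpha> \<beta>) =
        muD_char n \<alpha> (conjugate_partition \<beta>))"
  using J_aut_muD_iso algebra_iso_bij_irr_chars[OF J_aut_muD_iso group_muD group_D] precompose_D_char by blast

end
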